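(* Let $K$ be a field and $S_\infty=K[x_1,x_2,\ldots]$. Let $\mathcal{C}$ be the property on $\mathcal{I}$ such that $\mathcal{I}(\mathcal{C})$ is the set of all $I\in\mathcal{I}$ with $$\mu(I)=5,\quad \operatorname{pd}_{K[X(I)]}K[X(I)]/(I\cap K[X(I)])=3,\quad \operatorname{height} I=2,\quad I\text{ connected}.$$ Then $\{J_1,J_2,J_3\}$ is a minimal reduced generic set on $\mathcal{C}$, where each $J_i=(m_1,m_2,m_3,m_4,m_5)\subset S_\infty$ is defined as follows. For $J_1$ (where $|X(J_1)|=23$): $m_1=x_1x_3x_7x_8x_9x_{10}x_{12}x_{14}x_{15}x_{18}x_{19}x_{20}x_{21}x_{22}$, $m_2=x_2x_4x_5x_8x_9x_{11}x_{13}x_{14}x_{17}x_{18}x_{19}x_{20}x_{21}x_{23}$, $m_3=x_3x_5x_9x_{11}x_{12}x_{15}x_{16}x_{17}x_{19}x_{20}x_{22}x_{23}$, $m_4=x_4x_6x_{10}x_{11}x_{12}x_{13}x_{16}x_{18}x_{19}x_{21}x_{22}x_{23}$, $m_5=x_6x_7x_{10}x_{13}x_{14}x_{15}x_{16}x_{17}x_{20}x_{21}x_{22}x_{23}$. For $J_2$ (where $|X(J_2)|=24$): $m_1=x_1x_4x_7x_9x_{10}x_{12}x_{15}x_{16}x_{18}x_{19}x_{20}x_{22}x_{23}x_{24}$, $m_2=x_2x_5x_8x_9x_{11}x_{14}x_{15}x_{17}x_{18}x_{19}x_{21}x_{22}x_{23}x_{24}$, $m_3=x_3x_6x_7x_8x_{11}x_{12}x_{13}x_{16}x_{17}x_{19}x_{20}x_{21}x_{23}x_{24}$,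 $m_4=x_4x_5x_{10}x_{11}x_{12}x_{13}x_{14}x_{15}x_{20}x_{21}x_{22}x_{23}$, $m_5=x_6x_{10}x_{13}x_{14}x_{16}x_{17}x_{18}x_{20}x_{21}x_{22}x_{24}$. For $J_3$ (where $|X(J_3)|=25$): $m_1=x_1x_5x_6x_7x_{11}x_{12}x_{15}x_{18}x_{19}x_{20}x_{21}x_{22}x_{23}x_{24}$, $m_2=x_2x_5x_8x_9x_{11}x_{13}x_{15}x_{16}x_{17}x_{18}x_{21}x_{22}x_{24}x_{25}$, $m_3=x_3x_6x_8x_{10}x_{12}x_{14}x_{15}x_{16}x_{17}x_{20}x_{21}x_{23}x_{24}x_{25}$, $m_4=x_4x_7x_9x_{10}x_{13}x_{14}x_{17}x_{18}x_{19}x_{20}x_{22}x_{23}x_{24}x_{25}$, $m_5=x_{11}x_{12}x_{13}x_{14}x_{16}x_{19}x_{21}x_{22}x_{23}x_{25}$.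
   Context: $\mathcal{I}$ is the set of all finitely generated squarefree monomial ideals of $S_\infty=K[x_1,x_2,\ldots]$ (countably infinitely many variables). For $I\in\mathcal{I}$, $G(I)$ is its minimal set of monomial generators, $\mu(I)=|G(I)|$, and $X(I)$ is the set of all variables appearing in one of the elements of $G(I)$. A property $\mathcal{C}$ on $\mathcal{I}$ is identified with the subset $\mathcal{I}(\mathcal{C})$ of ideals satisfying it. An ideal $I$ with $G(I)=\{m_1,\ldots,m_\mu\}$ is connected if for any distinct $i,j\in\{1,\ldots,\mu\}$ there is a sequence $i=i_0,i_1,\ldots,i_\ell=j$ of indices with $\gcd(m_{i_{k-1}},m_{i_k})\neq1$ for all $k=1,\ldots,\ell$. A subset $\mathcal{A}\subset\mathcal{I}$ is a generic set on $\mathcal{C}$ if: (1) $\mathcal{A}\subset\mathcal{I}(\mathcal{C})$; and (2) for any $J\in\mathcal{I}(\mathcal{C})$ with $G(J)=\{m_1,\ldots,m_\mu\}$ there exist $I\in\mathcal{A}$ with $X(I)=\{x_1,\ldots,x_n\}$ (after naming the variables of $X(I)$ this way) and $G(I)=\{m_1',\ldots,m_\mu'\}$, where $m_i'=x_{t_{i1}}\cdots x_{t_{ij_i}}$, and (possibly trivial) squarefree monomials $M_1,\ldots,M_n$ in the variables $X(J)$ that are pairwise coprime such that $M_{t_{i1}}\cdots M_{t_{ij_i}}=m_i$ for $i=1,\ldots,\mu$. A generic set $\mathcal{A}$ on $\mathcal{C}$ is minimal if it is minimal among generic sets on $\mathcal{C}$ with respect to inclusion. The hypergraph of $I\in\mathcal{I}$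 with $G(I)=\{m_1,\ldots,m_\mu\}$ is $\mathcal{H}(I)=\{\{j\in\{1,\ldots,\mu\}: x\mid m_j\}: x\in X(I)\}$, a set of subsets (faces) of $\{1,\ldots,\mu\}$. For $\mathcal{H}=\mathcal{H}(I)$, assign a variable $x_F$ to each face $F\in\mathcal{H}$, and let $I_{\mathcal{H}}$ be the ideal of $K[x_F:F\in\mathcal{H}]$ generated by $\prod_{F\in\mathcal{H},\,j\in F}x_F$, $j=1,\ldots,\mu$. A generic set $\mathcal{A}$ on $\mathcal{C}$ is reduced if $K[x_F:F\in\mathcal{H}(I)]/I_{\mathcal{H}(I)}\cong K[X(I)]/(I\cap K[X(I)])$ for all $I\in\mathcal{A}$. *)

theory Defs
  imports
    "HOL-Library.Poly_Mapping"
    "HOL-Library.Extended_Nat"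
    "HOL-Algebra.QuotRing"
    "HOL-Algebra.Module"
begin

section \<open>Polynomial rings over a field\<close>

text \<open>
  A polynomial in the variables indexed by a type is a finitely supported function from exponent
  vectors to coefficients; multiplication is convolution (\<^theory>\<open>HOL-Library.Poly_Mapping\<close>).
\<close>

type_synonym ('v, 'k) mpoly = "('v \<Rightarrow>\<^sub>0 nat) \<Rightarrow>\<^sub>0 'k"

definition mpoly_vars :: "('v, 'k::field) mpoly \<Rightarrow> 'v set"
  where "mpoly_vars p = (\<Union>e\<in>Poly_Mapping.keys p. Poly_Mapping.keys e)"

definition mpoly_ring :: "'v set \<Rightarrow> ('v, 'k::field) mpoly ring"
  where "mpoly_ring V =
    \<lparr>carrier = {p. mpoly_vars p \<subseteq> V}, mult = (*), one = 1, zero = 0, add = (+)\<rparr>"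

definition Const :: "'k::field \<Rightarrow> ('v, 'k) mpoly"
  where "Const c = Poly_Mapping.single 0 c"

definition Var :: "'v \<Rightarrow> ('v, 'k::field) mpoly"
  where "Var v = Poly_Mapping.single (Poly_Mapping.single v 1) 1"

definition is_monomial :: "('v, 'k::field) mpoly \<Rightarrow> bool"
  where "is_monomial m \<longleftrightarrow> (\<exists>e. m = Poly_Mapping.single e 1)"

definition is_squarefree_monomial :: "('v, 'k::field) mpoly \<Rightarrow> bool"
  where "is_squarefree_monomial m \<longleftrightarrow>
    (\<exists>e. m = Poly_Mapping.single e 1 \<and> (\<forall>v. Poly_Mapping.lookup e v \<le> 1))"

text \<open>
  Two monomials have gcd 1. The constant \<^term>\<open>coprime\<close> is not available here, because
  the polynomial type is not an instance of its type class.
\<close>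

definition monom_coprime :: "('v, 'k::field) mpoly \<Rightarrow> ('v, 'k) mpoly \<Rightarrow> bool"
  where "monom_coprime m m' \<longleftrightarrow>
    (\<forall>d. is_monomial d \<longrightarrow> d dvd m \<longrightarrow> d dvd m' \<longrightarrow> d = 1)"

text \<open>\<open>S_inf\<close> is the ring $K[x_1, x_2, \ldots]$, with $x_i$ rendered as \<open>Var i\<close>, $i \geq 1$.\<close>

definition S_inf :: "(nat, 'k::field) mpoly ring"
  where "S_inf = mpoly_ring {1..}"

section \<open>Squarefree monomial ideals\<close>

definition squarefree_monomial_ideals :: "(nat, 'k::field) mpoly set set"
  where "squarefree_monomial_ideals =
    {I. \<exists>G. finite G \<and> G \<subseteq> carrier S_inf \<and> (\<forall>m\<in>G. is_squarefree_monomial m) \<and>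
        I = Idl\<^bsub>S_inf\<^esub> G}"

definition min_gens :: "(nat, 'k::field) mpoly set \<Rightarrow> (nat, 'k) mpoly set"
  where "min_gens I =
    (THE G. G \<subseteq> carrier S_inf \<and> (\<forall>m\<in>G. is_monomial m) \<and> Idl\<^bsub>S_inf\<^esub> G = I \<and>
       (\<forall>G'. G' \<subset> G \<longrightarrow> Idl\<^bsub>S_inf\<^esub> G' \<noteq> I))"

definition num_gens :: "(nat, 'k::field) mpoly set \<Rightarrow> nat"
  where "num_gens I = card (min_gens I)"

definition ideal_vars :: "(nat, 'k::field) mpoly set \<Rightarrow> nat set"
  where "ideal_vars I = (\<Union>m\<in>min_gens I. mpoly_vars m)"

definition connected_ideal :: "(nat, 'k::field) mpoly set \<Rightarrow> bool"
  where "connected_ideal I \<longleftrightarrow>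
    (\<forall>m\<in>min_gens I. \<forall>m'\<in>min_gens I. m \<noteq> m' \<longrightarrow>
      (m, m') \<in> {(a, b). a \<in> min_gens I \<and> b \<in> min_gens I \<and> \<not> monom_coprime a b}\<^sup>*)"

section \<open>Height\<close>

definition prime_height :: "('a, 'b) ring_scheme \<Rightarrow> 'a set \<Rightarrow> enat"
  where "prime_height R P =
    (SUP n\<in>{n. \<exists>Q. (\<forall>i\<le>n. primeideal (Q i) R) \<and> (\<forall>i<n. Q i \<subset> Q (Suc i)) \<and> Q n = P}. enat n)"

definition height :: "('a, 'b) ring_scheme \<Rightarrow> 'a set \<Rightarrow> enat"
  where "height R I = (INF P\<in>{P. primeideal P R \<and> I \<subseteq> P}. prime_height R P)"

section \<open>Projective dimension\<close>

definition module_hom ::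
    "('a, 'r) ring_scheme \<Rightarrow> ('a, 'm, 'x) module_scheme \<Rightarrow> ('a, 'n, 'y) module_scheme \<Rightarrow> ('m \<Rightarrow> 'n) set"
  where "module_hom R M N =
    {f. f \<in> carrier M \<rightarrow> carrier N \<and>
        (\<forall>x\<in>carrier M. \<forall>y\<in>carrier M. f (x \<oplus>\<^bsub>M\<^esub> y) = f x \<oplus>\<^bsub>N\<^esub> f y) \<and>
        (\<forall>r\<in>carrier R. \<forall>x\<in>carrier M. f (r \<odot>\<^bsub>M\<^esub> x) = r \<odot>\<^bsub>N\<^esub> f x)}"

text \<open>
  The free module with basis \<open>B\<close>: finitely supported families of ring elements. The module record
  extends the ring record, and its fields \<open>mult\<close> and \<open>one\<close> carry no meaning for modules.
\<close>

definition free_module :: "('a, 'r) ring_scheme \<Rightarrow> 'i set \<Rightarrow> ('a, 'i \<Rightarrow> 'a) module"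
  where "free_module R B =
    \<lparr>carrier = {f. (\<forall>b. f b \<in> carrier R) \<and> (\<forall>b. b \<notin> B \<longrightarrow> f b = \<zero>\<^bsub>R\<^esub>) \<and> finite {b. f b \<noteq> \<zero>\<^bsub>R\<^esub>}},
     mult = undefined, one = undefined,
     zero = (\<lambda>_. \<zero>\<^bsub>R\<^esub>), add = (\<lambda>f g b. f b \<oplus>\<^bsub>R\<^esub> g b),
     smult = (\<lambda>r f b. r \<otimes>\<^bsub>R\<^esub> f b)\<rparr>"

text \<open>
  A module is projective if it is a direct summand of a free module. Basis sets contained in the
  element type \<open>'m\<close> lose no generality: a summand of any free module is also a summand of the free
  module on its own set of elements.
\<close>

definition projective_module :: "('a, 'r) ring_scheme \<Rightarrow> ('a, 'm, 'x) module_scheme \<Rightarrow> bool"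
  where "projective_module R P \<longleftrightarrow> module R P \<and>
    (\<exists>(B :: 'm set) s p.
        s \<in> module_hom R P (free_module R B) \<and> p \<in> module_hom R (free_module R B) P \<and>
        (\<forall>x\<in>carrier P. p (s x) = x))"

text \<open>
  \<open>0 \<rightarrow> P n \<rightarrow> \<dots> \<rightarrow> P 1 \<rightarrow> P 0 \<rightarrow> M \<rightarrow> 0\<close> is exact with all \<open>P i\<close> projective, where
  \<open>d i : P (i + 1) \<rightarrow> P i\<close> and \<open>a : P 0 \<rightarrow> M\<close>.
\<close>

definition projective_resolution ::
    "('a, 'r) ring_scheme \<Rightarrow> ('a, 'm, 'x) module_scheme \<Rightarrow> nat \<Rightarrow>
     (nat \<Rightarrow> ('a, 'p) module) \<Rightarrow> (nat \<Rightarrow> 'p \<Rightarrow> 'p) \<Rightarrow> ('p \<Rightarrow> 'm) \<Rightarrow> bool"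
  where "projective_resolution R M n P d a \<longleftrightarrow>
    (\<forall>i\<le>n. projective_module R (P i)) \<and>
    a \<in> module_hom R (P 0) M \<and> a ` carrier (P 0) = carrier M \<and>
    (\<forall>i<n. d i \<in> module_hom R (P (Suc i)) (P i) \<and>
       d i ` carrier (P (Suc i)) =
         (if i = 0 then {x \<in> carrier (P 0). a x = \<zero>\<^bsub>M\<^esub>}
          else {x \<in> carrier (P i). d (i - 1) x = \<zero>\<^bsub>P (i - 1)\<^esub>})) \<and>
    (if n = 0 then inj_on a (carrier (P 0)) else inj_on (d (n - 1)) (carrier (P n)))"

text \<open>
  The least length of a projective resolution, \<open>\<infinity>\<close> if there is no finite one. HOL requires the
  elements of the resolving modules to come from a fixed type; \<open>nat \<Rightarrow> 'a\<close> contains all free modules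
  of countable rank and all their submodules. For finitely generated modules over Noetherian rings
  (the only ones it is applied to here) this is no restriction: the projective dimension is attained
  by a resolution that consists of submodules of free modules of finite rank.
\<close>

definition proj_dim :: "('a, 'r) ring_scheme \<Rightarrow> ('a, 'm, 'x) module_scheme \<Rightarrow> enat"
  where "proj_dim R M =
    (INF n\<in>{n. \<exists>(P :: nat \<Rightarrow> ('a, nat \<Rightarrow> 'a) module) d a. projective_resolution R M n P d a}. enat n)"

definition quotient_module :: "('a, 'r) ring_scheme \<Rightarrow> 'a set \<Rightarrow> ('a, 'a set) module"
  where "quotient_module R I =
    \<lparr>carrier = carrier (R Quot I), mult = mult (R Quot I), one = one (R Quot I),
     zero = zero (R Quot I), add = add (R Quot I),
     smult = (\<lambda>r A. (I +>\<^bsub>R\<^esub> r) \<otimes>\<^bsub>R Quot I\<^esub> A)\<rparr>"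

section \<open>Generic sets\<close>

text \<open>
  A property on the squarefree monomial ideals is the set \<open>C\<close> of ideals that satisfy it. The
  bijection \<open>f\<close> encodes the numberings of the two generating sets, and the monomial \<open>M v\<close> is
  substituted for the variable \<open>v\<close> of \<open>I\<close>.
\<close>

definition generic_set :: "(nat, 'k::field) mpoly set set \<Rightarrow> (nat, 'k) mpoly set set \<Rightarrow> bool"
  where "generic_set C A \<longleftrightarrow>
    A \<subseteq> C \<and>
    (\<forall>J\<in>C. \<exists>I\<in>A. \<exists>f M.
       bij_betw f (min_gens I) (min_gens J) \<and>
       (\<forall>v\<in>ideal_vars I. is_squarefree_monomial (M v) \<and> mpoly_vars (M v) \<subseteq> ideal_vars J) \<and>
       (\<forall>v\<in>ideal_vars I. \<forall>w\<in>ideal_vars I. v \<noteq> w \<longrightarrow> monom_coprime (M v) (M w)) \<and>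
       (\<forall>m\<in>min_gens I. (\<Prod>v\<in>mpoly_vars m. M v) = f m))"

definition minimal_generic_set :: "(nat, 'k::field) mpoly set set \<Rightarrow> (nat, 'k) mpoly set set \<Rightarrow> bool"
  where "minimal_generic_set C A \<longleftrightarrow>
    generic_set C A \<and> (\<forall>B. generic_set C B \<and> B \<subseteq> A \<longrightarrow> B = A)"

text \<open>
  The hypergraph of \<open>I\<close> depends on a numbering \<open>m\<close> of its minimal generators by
  \<open>1, \<dots>, \<mu>\<close>.
\<close>

definition gens_numbering :: "(nat, 'k::field) mpoly set \<Rightarrow> (nat \<Rightarrow> (nat, 'k) mpoly) \<Rightarrow> bool"
  where "gens_numbering I m \<longleftrightarrow> bij_betw m {1..num_gens I} (min_gens I)"

definition hypergraph :: "(nat, 'k::field) mpoly set \<Rightarrow> (nat \<Rightarrow> (nat, 'k) mpoly) \<Rightarrow> nat set set"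
  where "hypergraph I m = {{j \<in> {1..num_gens I}. Var x dvd m j} | x. x \<in> ideal_vars I}"

definition hypergraph_ideal :: "nat \<Rightarrow> nat set set \<Rightarrow> (nat set, 'k::field) mpoly set"
  where "hypergraph_ideal \<mu> H =
    Idl\<^bsub>mpoly_ring H\<^esub> ((\<lambda>j. \<Prod>F\<in>{F \<in> H. j \<in> F}. Var F) ` {1..\<mu>})"

text \<open>Isomorphism of \<open>K\<close>-algebras between quotients of polynomial rings.\<close>

definition quot_alg_iso ::
    "'v set \<Rightarrow> ('v, 'k::field) mpoly set \<Rightarrow> 'w set \<Rightarrow> ('w, 'k) mpoly set \<Rightarrow> bool"
  where "quot_alg_iso V I W J \<longleftrightarrow>
    (\<exists>h \<in> ring_iso (mpoly_ring V Quot I) (mpoly_ring W Quot J).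
       \<forall>c. h (I +>\<^bsub>mpoly_ring V\<^esub> Const c) = J +>\<^bsub>mpoly_ring W\<^esub> Const c)"

definition reduced_generic_set :: "(nat, 'k::field) mpoly set set \<Rightarrow> (nat, 'k) mpoly set set \<Rightarrow> bool"
  where "reduced_generic_set C A \<longleftrightarrow>
    generic_set C A \<and>
    (\<forall>I\<in>A. \<forall>m. gens_numbering I m \<longrightarrow>
       quot_alg_iso (hypergraph I m) (hypergraph_ideal (num_gens I) (hypergraph I m))
         (ideal_vars I) (I \<inter> carrier (mpoly_ring (ideal_vars I))))"

text \<open>The squarefree monomial with the given set of variables.\<close>

definition sqf :: "nat set \<Rightarrow> (nat, 'k::field) mpoly"
  where "sqf A = (\<Prod>i\<in>A. Var i)"

end

theory Submission
  imports Defs "HOL-Library.Nat_Bijection"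
begin

text \<open>
  The hypergraph of an ideal determines its projective dimension through the Taylor complex. For
  $n$ generators, comparing any projective resolution of length $n - 2$ with the Taylor complex
  and looking at constant coefficients in the degrees $n - 1$ and $n - 2$ shows that the generators
  are joined by a spanning tree none of whose edges is a face and none of whose inner vertices is
  a singleton face. Conversely, such a tree allows one to cancel the degrees $n$ and $n - 1$ of
  the Taylor complex against the tree edges in degree $n - 2$, which leaves a free resolution of
  length $n - 2$. Hence projective dimension at most $3$ means, for $n = 5$, the existence of such a
  tree. A tree on five vertices is a path, a fork or a star, and height $2$ forbids only the full
  face, so that the ideals $J_1$, $J_2$, $J_3$ are those whose hypergraphs consist of all faces
  that the respective tree permits.
\<close>

section \<open>Monomials\<close>

abbreviation "lookup \<equiv> Poly_Mapping.lookup"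
abbreviation "keys \<equiv> Poly_Mapping.keys"
abbreviation "single \<equiv> Poly_Mapping.single"

definition exp_le :: "('v \<Rightarrow>\<^sub>0 nat) \<Rightarrow> ('v \<Rightarrow>\<^sub>0 nat) \<Rightarrow> bool" (infix "\<preceq>" 50)
  where "e \<preceq> e' \<longleftrightarrow> (\<forall>v. lookup e v \<le> lookup e' v)"

definition ind :: "'v set \<Rightarrow> 'v \<Rightarrow>\<^sub>0 nat"
  where "ind A = (\<Sum>v\<in>A. single v 1)"

definition monom :: "('v \<Rightarrow>\<^sub>0 nat) \<Rightarrow> ('v, 'k::field) mpoly"
  where "monom e = single e 1"

lemma exp_le_refl [simp]: "e \<preceq> e"
  by (simp add: exp_le_def)

lemma exp_le_trans: "e \<preceq> e' \<Longrightarrow> e' \<preceq> e'' \<Longrightarrow> e \<preceq> e''"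
  unfolding exp_le_def using order_trans by blast

lemma exp_le_antisym: "e \<preceq> e' \<Longrightarrow> e' \<preceq> e \<Longrightarrow> e = e'"
  by (auto simp: exp_le_def intro!: poly_mapping_eqI order_antisym)

lemma exp_le_add [simp]: "e \<preceq> e + d" "e \<preceq> d + e"
  by (auto simp: exp_le_def lookup_add)

lemma exp_le_zero [simp]: "e \<preceq> 0 \<longleftrightarrow> e = 0"
  by (auto simp: exp_le_def intro!: poly_mapping_eqI)

lemma exp_diff_add: "e \<preceq> e' \<Longrightarrow> e' - e + e = e'" "e \<preceq> e' \<Longrightarrow> e + (e' - e) = e'"
  by (auto simp: exp_le_def lookup_add lookup_minus intro!: poly_mapping_eqI)

lemma exp_le_iff: "e \<preceq> e' \<longleftrightarrow> (\<exists>d. e' = e + d)"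
  using exp_diff_add(2) by (metis exp_le_add(1))

lemma lookup_ind: "finite A \<Longrightarrow> lookup (ind A) v = (if v \<in> A then 1 else 0)"
  by (simp add: ind_def lookup_sum lookup_single when_def)

lemma keys_ind [simp]: "finite A \<Longrightarrow> keys (ind A) = A"
  by (auto simp: in_keys_iff lookup_ind split: if_splits)

lemma ind_empty [simp]: "ind {} = 0"
  by (simp add: ind_def)

lemma ind_inject: "finite A \<Longrightarrow> finite B \<Longrightarrow> ind A = ind B \<longleftrightarrow> A = B"
  by (metis keys_ind)

lemma ind_exp_le: "finite A \<Longrightarrow> ind A \<preceq> u \<longleftrightarrow> A \<subseteq> keys u"
  by (auto simp: exp_le_def lookup_ind in_keys_iff Suc_le_eq subset_iff)

lemma ind_Un_disjoint:
  "finite A \<Longrightarrow> finite B \<Longrightarrow> A \<inter> B = {} \<Longrightarrow> ind (A \<union> B) = ind A + ind B"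
  by (simp add: ind_def sum.union_disjoint)

lemma exp_keys_add: "keys (e + d :: 'v \<Rightarrow>\<^sub>0 nat) = keys e \<union> keys d"
  by (auto simp: in_keys_iff lookup_add)

lemma exp_le_keys: "e \<preceq> e' \<Longrightarrow> keys e \<subseteq> keys e'"
  by (auto simp: exp_le_iff exp_keys_add)

lemma keys_exp_diff: "keys (e - d :: 'v \<Rightarrow>\<^sub>0 nat) \<subseteq> keys e"
  by (auto simp: in_keys_iff lookup_minus)

lemma monom_mult: "monom (e + d) = monom e * monom d"
  by (simp add: monom_def mult_single)

lemma monom_zero [simp]: "monom 0 = 1"
  by (simp add: monom_def)

lemma monom_inject [simp]: "monom e = monom d \<longleftrightarrow> e = d"
  unfolding monom_def by (metis keys_single singleton_inject zero_neq_one)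

lemma keys_monom [simp]: "keys (monom e :: ('v, 'k::field) mpoly) = {e}"
  by (simp add: monom_def)

lemma lookup_monom: "lookup (monom e) u = (if u = e then 1 else 0)"
  by (simp add: monom_def lookup_single when_def)

lemma mpoly_expand: "p = (\<Sum>e\<in>keys p. single e (lookup p e))"
  by (auto simp: lookup_sum lookup_single when_def in_keys_iff intro!: poly_mapping_eqI)

lemma lookup_single_mult:
  fixes p :: "('v, 'k::field) mpoly"
  shows "lookup (single e c * p) u = (if e \<preceq> u then c * lookup p (u - e) else 0)"
proof -
  have "single e c * p = single e c * (\<Sum>d\<in>keys p. single d (lookup p d))"
    by (rule arg_cong[OF mpoly_expand])
  also have "\<dots> = (\<Sum>d\<in>keys p. single (e + d) (c * lookup p d))"
    by (simp add: sum_distrib_left mult_single)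
  finally have eq: "lookup (single e c * p) u = (\<Sum>d\<in>keys p. (c * lookup p d when e + d = u))"
    by (simp add: lookup_sum lookup_single)
  show ?thesis
  proof (cases "e \<preceq> u")
    case True
    then have "e + d = u \<longleftrightarrow> d = u - e" for d
      using exp_diff_add(2) by (metis add_left_cancel)
    then show ?thesis
      using True by (simp add: eq when_def in_keys_iff)
  next
    case False
    then have "e + d \<noteq> u" for d
      using exp_le_iff by blast
    then show ?thesis
      using False by (simp add: eq)
  qed
qed

lemma lookup_monom_mult:
  "lookup (monom e * p) u = (if e \<preceq> u then lookup p (u - e) else 0)"
  by (simp add: monom_def lookup_single_mult)

lemma keys_mult_obtain:
  fixes p q :: "('v, 'k::field) mpoly"
  assumes "u \<in> keys (p * q)"
  obtains d e where "d \<in> keys p" "e \<in> keys q" "u = d + e"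
  using keys_mult[of p q] assms by blast

lemma sqf_eq_monom: "finite A \<Longrightarrow> (\<Prod>v\<in>A. Var v) = monom (ind A)"
  by (induction A rule: finite_induct) (auto simp: Var_def monom_def ind_def mult_single)

lemma is_squarefree_monomial_iff: "is_squarefree_monomial m \<longleftrightarrow> (\<exists>A. finite A \<and> m = monom (ind A))"
proof
  assume "is_squarefree_monomial m"
  then obtain e where e: "m = single e 1" "\<forall>v. lookup e v \<le> 1"
    unfolding is_squarefree_monomial_def by auto
  have "e = ind (keys e)"
  proof (rule poly_mapping_eqI)
    fix v
    show "lookup e v = lookup (ind (keys e)) v"
      using e(2)[rule_format, of v] by (auto simp: lookup_ind in_keys_iff)
  qed
  with e show "\<exists>A. finite A \<and> m = monom (ind A)"
    by (metis finite_keys monom_def)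
next
  assume "\<exists>A. finite A \<and> m = monom (ind A)"
  then show "is_squarefree_monomial m"
    by (auto simp: is_squarefree_monomial_def monom_def lookup_ind)
qed

lemma monom_dvdD:
  assumes "monom e dvd (monom d :: ('v, 'k::field) mpoly)"
  shows "e \<preceq> d"
proof -
  obtain q where "monom d = (monom e * q :: ('v, 'k) mpoly)" using assms by (rule dvdE)
  then have "lookup (monom e * q) d = (1 :: 'k)" by (metis lookup_monom)
  then show ?thesis by (auto simp: lookup_monom_mult split: if_splits)
qed

lemma Var_dvd_monom_ind:
  assumes "finite D"
  shows "Var x dvd (monom (ind D) :: ('v, 'k::field) mpoly) \<longleftrightarrow> x \<in> D"
proof
  assume "Var x dvd (monom (ind D) :: ('v, 'k) mpoly)"
  moreover have "Var x = (monom (single x 1) :: ('v, 'k) mpoly)" by (simp add: Var_def monom_def)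
  ultimately have "single x 1 \<preceq> ind D" using monom_dvdD by metis
  then have "keys (single x (1 :: nat)) \<subseteq> keys (ind D)" by (rule exp_le_keys)
  then show "x \<in> D" using assms by simp
next
  assume "x \<in> D"
  then show "Var x dvd (monom (ind D) :: ('v, 'k) mpoly)"
    using assms by (simp add: sqf_eq_monom[symmetric] dvd_prodI)
qed

lemma monom_coprime_iff:
  fixes A B :: "'v set"
  assumes "finite A" "finite B"
  shows "monom_coprime (monom (ind A)) (monom (ind B) :: ('v, 'k::field) mpoly) \<longleftrightarrow> A \<inter> B = {}"
proof
  assume "A \<inter> B = {}"
  show "monom_coprime (monom (ind A)) (monom (ind B) :: ('v, 'k) mpoly)"
    unfolding monom_coprime_def
  proof (intro allI impI)
    fix d :: "('v, 'k) mpoly"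
    assume "is_monomial d" and dvd: "d dvd monom (ind A)" "d dvd monom (ind B)"
    then obtain e where e: "d = monom e" by (auto simp: is_monomial_def monom_def)
    have "e \<preceq> ind A" "e \<preceq> ind B" using dvd unfolding e by (auto dest: monom_dvdD)
    then have "keys e \<subseteq> keys (ind A)" "keys e \<subseteq> keys (ind B)" by (auto dest: exp_le_keys)
    then have "keys e \<subseteq> A" "keys e \<subseteq> B" using assms by simp_all
    then have "keys e = {}" using \<open>A \<inter> B = {}\<close> by blast
    then have "e = 0" by (auto intro!: poly_mapping_eqI simp: in_keys_iff)
    then show "d = 1" by (simp add: e)
  qed
next
  assume cop: "monom_coprime (monom (ind A)) (monom (ind B) :: ('v, 'k) mpoly)"
  show "A \<inter> B = {}"
  proof (rule ccontr)
    assume "A \<inter> B \<noteq> {}"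
    then obtain x where x: "x \<in> A" "x \<in> B" by blast
    have "is_monomial (Var x :: ('v, 'k) mpoly)" by (auto simp: is_monomial_def Var_def)
    then have "Var x = (1 :: ('v, 'k) mpoly)"
      using cop x Var_dvd_monom_ind[OF assms(1)] Var_dvd_monom_ind[OF assms(2)]
      unfolding monom_coprime_def by blast
    then have "keys (Var x :: ('v, 'k) mpoly) = keys (monom 0 :: ('v, 'k) mpoly)" by simp
    then have "single x (1 :: nat) = 0" by (simp add: Var_def)
    then show False by (metis lookup_single_eq lookup_zero zero_neq_one)
  qed
qed

lemma mpoly_vars_zero [simp]: "mpoly_vars 0 = {}"
  and mpoly_vars_one [simp]: "mpoly_vars 1 = {}"
  and mpoly_vars_monom [simp]: "mpoly_vars (monom e) = keys e"
  by (auto simp: mpoly_vars_def)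

lemma mpoly_vars_single: "mpoly_vars (single e c) \<subseteq> keys e"
  by (auto simp: mpoly_vars_def split: if_splits)

lemma mpoly_vars_subset_iff: "mpoly_vars p \<subseteq> V \<longleftrightarrow> (\<forall>e\<in>keys p. keys e \<subseteq> V)"
  by (auto simp: mpoly_vars_def)

lemma mpoly_vars_add: "mpoly_vars p \<subseteq> V \<Longrightarrow> mpoly_vars q \<subseteq> V \<Longrightarrow> mpoly_vars (p + q) \<subseteq> V"
  unfolding mpoly_vars_subset_iff using keys_add[of p q] by auto

lemma keys_uminus_mpoly: "keys (- p :: ('v, 'k::field) mpoly) = keys p"
  by (auto simp: in_keys_iff)

lemma mpoly_vars_uminus [simp]: "mpoly_vars (- p) = mpoly_vars p"
  by (simp add: mpoly_vars_def keys_uminus_mpoly)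

lemma mpoly_vars_diff: "mpoly_vars p \<subseteq> V \<Longrightarrow> mpoly_vars q \<subseteq> V \<Longrightarrow> mpoly_vars (p - q) \<subseteq> V"
  using mpoly_vars_add[of p V "- q"] by simp

lemma mpoly_vars_mult:
  assumes "mpoly_vars p \<subseteq> V" "mpoly_vars q \<subseteq> V"
  shows "mpoly_vars (p * q) \<subseteq> V"
  unfolding mpoly_vars_subset_iff
proof
  fix u assume "u \<in> keys (p * q)"
  then obtain d e where "d \<in> keys p" "e \<in> keys q" "u = d + e"
    by (rule keys_mult_obtain)
  then show "keys u \<subseteq> V"
    using assms by (auto simp: mpoly_vars_subset_iff exp_keys_add)
qed

lemma mpoly_vars_sum: "(\<And>i. i \<in> X \<Longrightarrow> mpoly_vars (f i) \<subseteq> V) \<Longrightarrow> mpoly_vars (sum f X) \<subseteq> V"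
  by (induction X rule: infinite_finite_induct) (simp_all add: mpoly_vars_add)

lemma mpoly_vars_power: "mpoly_vars p \<subseteq> V \<Longrightarrow> mpoly_vars (p ^ n) \<subseteq> V"
  by (induction n) (simp_all add: mpoly_vars_mult)

lemma carrier_mpoly_ring: "p \<in> carrier (mpoly_ring V) \<longleftrightarrow> mpoly_vars p \<subseteq> V"
  by (simp add: mpoly_ring_def)

lemma mpoly_ring_simps [simp]:
  "p \<otimes>\<^bsub>mpoly_ring V\<^esub> q = p * q" "p \<oplus>\<^bsub>mpoly_ring V\<^esub> q = p + q"
  "\<one>\<^bsub>mpoly_ring V\<^esub> = 1" "\<zero>\<^bsub>mpoly_ring V\<^esub> = 0"
  by (simp_all add: mpoly_ring_def)

lemma cring_mpoly_ring: "cring (mpoly_ring V :: ('v, 'k::field) mpoly ring)"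
proof (rule cringI)
  show "abelian_group (mpoly_ring V :: ('v, 'k) mpoly ring)"
  proof (rule abelian_groupI)
    fix p :: "('v, 'k) mpoly"
    assume "p \<in> carrier (mpoly_ring V)"
    then show "\<exists>q\<in>carrier (mpoly_ring V). q \<oplus>\<^bsub>mpoly_ring V\<^esub> p = \<zero>\<^bsub>mpoly_ring V\<^esub>"
      by (intro bexI[of _ "- p"]) (auto simp: carrier_mpoly_ring)
  qed (simp_all add: carrier_mpoly_ring add.assoc add.commute mpoly_vars_add)
  show "comm_monoid (mpoly_ring V :: ('v, 'k) mpoly ring)"
    by (rule comm_monoidI) (simp_all add: carrier_mpoly_ring mult.assoc mult.commute mpoly_vars_mult)
qed (auto simp: carrier_mpoly_ring algebra_simps)

lemma a_inv_mpoly_ring: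
  "mpoly_vars p \<subseteq> V \<Longrightarrow> \<ominus>\<^bsub>mpoly_ring V\<^esub> p = (- p :: ('v, 'k::field) mpoly)"
proof -
  assume p: "mpoly_vars p \<subseteq> V"
  interpret cring "mpoly_ring V :: ('v, 'k) mpoly ring" by (rule cring_mpoly_ring)
  show ?thesis
    using p minus_equality[of "- p" p] by (auto simp: carrier_mpoly_ring)
qed

section \<open>Monomial ideals\<close>

definition mon_ideal :: "'v set \<Rightarrow> ('v \<Rightarrow>\<^sub>0 nat) set \<Rightarrow> ('v, 'k::field) mpoly set"
  where "mon_ideal V E = {p. mpoly_vars p \<subseteq> V \<and> (\<forall>e\<in>keys p. \<exists>g\<in>E. g \<preceq> e)}"

lemma ideal_mpoly_ringI:
  fixes I :: "('v, 'k::field) mpoly set"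
  assumes "I \<subseteq> carrier (mpoly_ring V)" "0 \<in> I" "\<And>p q. p \<in> I \<Longrightarrow> q \<in> I \<Longrightarrow> p + q \<in> I"
    "\<And>p q. p \<in> I \<Longrightarrow> mpoly_vars q \<subseteq> V \<Longrightarrow> q * p \<in> I"
  shows "ideal I (mpoly_ring V)"
proof -
  interpret cring "mpoly_ring V :: ('v, 'k) mpoly ring" by (rule cring_mpoly_ring)
  show ?thesis
  proof (rule idealI)
    show "subgroup I (add_monoid (mpoly_ring V))"
    proof
      fix p assume p: "p \<in> I"
      then have "(- 1) * p \<in> I" by (intro assms) auto
      moreover have "inv\<^bsub>add_monoid (mpoly_ring V)\<^esub> p = - p"
        using a_inv_mpoly_ring[of p V] p assms(1)
        by (auto simp: a_inv_def carrier_mpoly_ring subset_iff)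
      ultimately show "inv\<^bsub>add_monoid (mpoly_ring V)\<^esub> p \<in> I" by simp
    qed (use assms in auto)
    fix p q :: "('v, 'k) mpoly"
    assume "p \<in> I" "q \<in> carrier (mpoly_ring V)"
    then have "q * p \<in> I" by (simp add: assms(4) carrier_mpoly_ring)
    then show "q \<otimes>\<^bsub>mpoly_ring V\<^esub> p \<in> I" "p \<otimes>\<^bsub>mpoly_ring V\<^esub> q \<in> I"
      by (simp_all add: mult.commute)
  qed (rule ring_axioms)
qed

lemma ideal_mpoly_ringD:
  fixes I :: "('v, 'k::field) mpoly set"
  assumes "ideal I (mpoly_ring V)"
  shows "p \<in> I \<Longrightarrow> mpoly_vars p \<subseteq> V" "0 \<in> I" "p \<in> I \<Longrightarrow> q \<in> I \<Longrightarrow> p + q \<in> I"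
    "p \<in> I \<Longrightarrow> mpoly_vars r \<subseteq> V \<Longrightarrow> r * p \<in> I" "p \<in> I \<Longrightarrow> q \<in> I \<Longrightarrow> p - q \<in> I"
proof -
  interpret ideal I "mpoly_ring V" by fact
  show 1: "p \<in> I \<Longrightarrow> mpoly_vars p \<subseteq> V" for p
    by (metis a_Hcarr carrier_mpoly_ring)
  show "0 \<in> I" using additive_subgroup.zero_closed[OF is_additive_subgroup] by simp
  show 3: "p \<in> I \<Longrightarrow> q \<in> I \<Longrightarrow> p + q \<in> I" for p q using additive_subgroup.a_closed[OF is_additive_subgroup, of p q] by simp
  show 4: "p \<in> I \<Longrightarrow> mpoly_vars r \<subseteq> V \<Longrightarrow> r * p \<in> I" for p r
    using I_l_closed[of p r] by (simp add: carrier_mpoly_ring)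
  show "p \<in> I \<Longrightarrow> q \<in> I \<Longrightarrow> p - q \<in> I" for p q
    using 3[of p "- q"] 4[of q "- 1"] by simp
qed

lemma ideal_sum_closed:
  fixes I :: "('v, 'k::field) mpoly set"
  assumes "ideal I (mpoly_ring V)" "\<And>i. i \<in> X \<Longrightarrow> f i \<in> I"
  shows "sum f X \<in> I"
  using assms(2)
  by (induction X rule: infinite_finite_induct) (auto intro: ideal_mpoly_ringD[OF assms(1)])

lemma ideal_mon_ideal: "ideal (mon_ideal V E) (mpoly_ring V)"
proof (rule ideal_mpoly_ringI)
  fix p q :: "('a, 'b) mpoly"
  assume p: "p \<in> mon_ideal V E" and q: "mpoly_vars q \<subseteq> V"
  have "\<exists>g\<in>E. g \<preceq> u" if "u \<in> keys (q * p)" for u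
  proof -
    obtain d e where "d \<in> keys q" "e \<in> keys p" "u = d + e"
      using \<open>u \<in> keys (q * p)\<close> by (rule keys_mult_obtain)
    then show ?thesis
      using p exp_le_trans[of _ e u] exp_le_add by (fastforce simp: mon_ideal_def)
  qed
  then show "q * p \<in> mon_ideal V E"
    using p q by (simp add: mon_ideal_def mpoly_vars_mult)
next
  fix p q :: "('a, 'b) mpoly"
  assume "p \<in> mon_ideal V E" "q \<in> mon_ideal V E"
  then show "p + q \<in> mon_ideal V E"
    using keys_add[of p q] by (auto simp: mon_ideal_def mpoly_vars_add[THEN subsetD])
qed (auto simp: mon_ideal_def carrier_mpoly_ring)

lemma monom_in_mon_ideal: "monom e \<in> mon_ideal V E \<longleftrightarrow> keys e \<subseteq> V \<and> (\<exists>g\<in>E. g \<preceq> e)"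
  by (simp add: mon_ideal_def)

lemma single_mult_monom: "g \<preceq> e \<Longrightarrow> single (e - g) c * monom g = single e c"
  by (simp add: monom_def mult_single exp_diff_add)

lemma mon_ideal_minimal:
  fixes I :: "('v, 'k::field) mpoly set"
  assumes I: "ideal I (mpoly_ring V)" and E: "monom ` E \<subseteq> I"
  shows "mon_ideal V E \<subseteq> I"
proof
  fix p :: "('v, 'k) mpoly"
  assume p: "p \<in> mon_ideal V E"
  have "single e (lookup p e) \<in> I" if e: "e \<in> keys p" for e
  proof -
    obtain g where g: "g \<in> E" "g \<preceq> e" using p e by (auto simp: mon_ideal_def)
    have "keys e \<subseteq> V" using p e by (auto simp: mon_ideal_def mpoly_vars_subset_iff)
    then have "mpoly_vars (single (e - g) (lookup p e)) \<subseteq> V"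
      using mpoly_vars_single[of "e - g"] keys_exp_diff[of e g] by blast
    moreover have "monom g \<in> I" using E g by blast
    ultimately have "single (e - g) (lookup p e) * monom g \<in> I"
      by (intro ideal_mpoly_ringD(4)[OF I])
    then show ?thesis using g by (simp add: single_mult_monom)
  qed
  then have "(\<Sum>e\<in>keys p. single e (lookup p e)) \<in> I"
    by (intro ideal_sum_closed[OF I]) auto
  then show "p \<in> I" by (simp only: mpoly_expand[symmetric])
qed

lemma genideal_monom:
  assumes "\<And>e. e \<in> E \<Longrightarrow> keys e \<subseteq> V"
  shows "Idl\<^bsub>mpoly_ring V\<^esub> (monom ` E) = (mon_ideal V E :: ('v, 'k::field) mpoly set)"
proof -
  interpret cring "mpoly_ring V :: ('v, 'k) mpoly ring" by (rule cring_mpoly_ring)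
  have sub: "monom ` E \<subseteq> carrier (mpoly_ring V :: ('v, 'k) mpoly ring)"
    using assms by (auto simp: carrier_mpoly_ring)
  have "monom ` E \<subseteq> (mon_ideal V E :: ('v, 'k) mpoly set)"
    using assms exp_le_refl by (simp only: monom_in_mon_ideal image_subset_iff) blast
  then have "Idl\<^bsub>mpoly_ring V\<^esub> (monom ` E) \<subseteq> (mon_ideal V E :: ('v, 'k) mpoly set)"
    by (rule genideal_minimal[OF ideal_mon_ideal])
  moreover have "(mon_ideal V E :: ('v, 'k) mpoly set) \<subseteq> Idl\<^bsub>mpoly_ring V\<^esub> (monom ` E)"
    using genideal_ideal[OF sub] genideal_self[OF sub] by (rule mon_ideal_minimal)
  ultimately show ?thesis by blast
qed

lemma mon_ideal_eq_iff_monom: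
  assumes "(mon_ideal V E :: ('v, 'k::field) mpoly set) = mon_ideal V E'" "e \<in> E" "keys e \<subseteq> V"
  shows "\<exists>g\<in>E'. g \<preceq> e"
  using assms monom_in_mon_ideal[of e V E] monom_in_mon_ideal[of e V E', where ?'b = 'k]
  by (metis exp_le_refl)

definition antichain :: "('v \<Rightarrow>\<^sub>0 nat) set \<Rightarrow> bool"
  where "antichain E \<longleftrightarrow> (\<forall>e\<in>E. \<forall>e'\<in>E. e \<preceq> e' \<longrightarrow> e = e')"

lemma antichain_mon_ideal_eq:
  assumes "antichain E" "antichain E'" "\<And>e. e \<in> E \<union> E' \<Longrightarrow> keys e \<subseteq> V"
    and eq: "(mon_ideal V E :: ('v, 'k::field) mpoly set) = mon_ideal V E'"
  shows "E = E'"
proof -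
  have aux: "e \<in> D'" if D: "antichain D" "antichain D'" "\<And>e. e \<in> D \<union> D' \<Longrightarrow> keys e \<subseteq> V"
    and eq: "(mon_ideal V D :: ('v, 'k::field) mpoly set) = mon_ideal V D'" and "e \<in> D" for D D' e
  proof -
    obtain g where g: "g \<in> D'" "g \<preceq> e"
      using mon_ideal_eq_iff_monom[OF eq \<open>e \<in> D\<close>] D(3)[of e] \<open>e \<in> D\<close> by blast
    obtain h where h: "h \<in> D" "h \<preceq> g"
      using mon_ideal_eq_iff_monom[OF eq[symmetric] g(1)] D(3)[of g] g(1) by blast
    have "h = e" using D(1) \<open>e \<in> D\<close> g h exp_le_trans[of h g e] unfolding antichain_def by blast
    then have "g = e" using g h exp_le_antisym by blast
    with g show ?thesis by simp
  qed
  have "e \<in> E'" if "e \<in> E" for e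
    by (rule aux[OF assms(1,2) _ eq that]) (use assms(3) in auto)
  moreover have "e \<in> E" if "e \<in> E'" for e
    by (rule aux[OF assms(2,1) _ eq[symmetric] that]) (use assms(3) in auto)
  ultimately show ?thesis by blast
qed

lemma antichain_irredundant:
  assumes E: "antichain E" "\<And>e. e \<in> E \<Longrightarrow> keys e \<subseteq> V" and "E' \<subset> E"
  shows "(mon_ideal V E' :: ('v, 'k::field) mpoly set) \<noteq> mon_ideal V E"
proof
  assume eq: "(mon_ideal V E' :: ('v, 'k) mpoly set) = mon_ideal V E"
  have "antichain E'" using E(1) \<open>E' \<subset> E\<close> by (auto simp: antichain_def)
  then have "E' = E" using eq E \<open>E' \<subset> E\<close> by (intro antichain_mon_ideal_eq) auto
  with \<open>E' \<subset> E\<close> show False by simp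
qed

lemma mon_ideal_cong:
  assumes "D \<subseteq> E" "\<And>e. e \<in> E \<Longrightarrow> \<exists>g\<in>D. g \<preceq> e"
  shows "mon_ideal V D = mon_ideal V E"
proof -
  have "(\<exists>g\<in>D. g \<preceq> e) \<longleftrightarrow> (\<exists>g\<in>E. g \<preceq> e)" for e
    using assms exp_le_trans by blast
  then show ?thesis by (simp add: mon_ideal_def)
qed

lemma genideal_S_inf_monom:
  assumes "\<And>e. e \<in> E \<Longrightarrow> keys e \<subseteq> {1..}"
  shows "Idl\<^bsub>S_inf\<^esub> (monom ` E) = (mon_ideal {1..} E :: (nat, 'k::field) mpoly set)"
  using assms genideal_monom[of E "{1..}"] by (simp add: S_inf_def)

lemma min_gens_eqI:
  fixes E :: "(nat \<Rightarrow>\<^sub>0 nat) set"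
  assumes E: "antichain E" "\<And>e. e \<in> E \<Longrightarrow> keys e \<subseteq> {1..}"
  shows "min_gens (mon_ideal {1..} E :: (nat, 'k::field) mpoly set) = monom ` E"
  unfolding min_gens_def
proof (rule the_equality)
  let ?I = "mon_ideal {1..} E :: (nat, 'k) mpoly set"
  have red: "Idl\<^bsub>S_inf\<^esub> G' \<noteq> ?I" if sub: "G' \<subset> monom ` E" for G' :: "(nat, 'k) mpoly set"
  proof -
    obtain E' where E': "E' \<subseteq> E" "G' = monom ` E'"
      using psubset_imp_subset[OF sub] unfolding subset_image_iff by blast
    then have "E' \<subset> E" using sub by blast
    then have "(mon_ideal {1..} E' :: (nat, 'k) mpoly set) \<noteq> ?I"
      using antichain_irredundant[OF E, of E'] by blast
    moreover have "Idl\<^bsub>S_inf\<^esub> (monom ` E') = (mon_ideal {1..} E' :: (nat, 'k) mpoly set)"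
      by (rule genideal_S_inf_monom) (use E' E in blast)
    ultimately show ?thesis using E' by simp
  qed
  have idl: "Idl\<^bsub>S_inf\<^esub> (monom ` E) = ?I"
    by (rule genideal_S_inf_monom[OF E(2)])
  have mon: "\<forall>m\<in>monom ` E. is_monomial (m :: (nat, 'k) mpoly)"
    by (auto simp: is_monomial_def monom_def)
  have sub: "monom ` E \<subseteq> (carrier S_inf :: (nat, 'k) mpoly set)"
    using E(2) by (simp only: S_inf_def carrier_mpoly_ring image_subset_iff mpoly_vars_monom) blast
  show "monom ` E \<subseteq> (carrier S_inf :: (nat, 'k) mpoly set) \<and> (\<forall>m\<in>monom ` E. is_monomial (m :: (nat, 'k) mpoly)) \<and>
      Idl\<^bsub>S_inf\<^esub> (monom ` E) = ?I \<and> (\<forall>G'. G' \<subset> monom ` E \<longrightarrow> Idl\<^bsub>S_inf\<^esub> G' \<noteq> ?I)"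
    by (intro conjI sub mon idl allI impI red)
next
  let ?I = "mon_ideal {1..} E :: (nat, 'k) mpoly set"
  fix G :: "(nat, 'k) mpoly set"
  assume G: "G \<subseteq> carrier S_inf \<and> (\<forall>m\<in>G. is_monomial m) \<and> Idl\<^bsub>S_inf\<^esub> G = ?I \<and>
      (\<forall>G'. G' \<subset> G \<longrightarrow> Idl\<^bsub>S_inf\<^esub> G' \<noteq> ?I)"
  then have "G \<subseteq> range monom" by (auto simp: is_monomial_def monom_def)
  then obtain D where D: "G = monom ` D" by (rule subset_imageE)
  have vars: "keys e \<subseteq> {1..}" if "e \<in> D" for e
  proof -
    have "monom e \<in> (carrier S_inf :: (nat, 'k) mpoly set)" using G D \<open>e \<in> D\<close> by blast
    then show ?thesis by (simp add: S_inf_def carrier_mpoly_ring)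
  qed
  have I: "mon_ideal {1..} D = ?I"
    using G D genideal_S_inf_monom[OF vars] by metis
  have "antichain D"
    unfolding antichain_def
  proof (intro ballI impI, rule ccontr)
    fix e e' assume e: "e \<in> D" "e' \<in> D" "e \<preceq> e'" "e \<noteq> e'"
    have "monom e' \<notin> (monom ` (D - {e'}) :: (nat, 'k) mpoly set)" by auto
    then have "monom ` (D - {e'}) \<subset> (G :: (nat, 'k) mpoly set)" using D e(2) by blast
    then have "Idl\<^bsub>S_inf\<^esub> (monom ` (D - {e'})) \<noteq> ?I" using G by blast
    moreover have "Idl\<^bsub>S_inf\<^esub> (monom ` (D - {e'})) = (mon_ideal {1..} (D - {e'}) :: (nat, 'k) mpoly set)"
      by (rule genideal_S_inf_monom) (use vars in blast)
    moreover have "\<exists>g\<in>D - {e'}. g \<preceq> d" if "d \<in> D" for d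
      using that e exp_le_refl by (metis Diff_iff singletonD)
    then have "(mon_ideal {1..} (D - {e'}) :: (nat, 'k) mpoly set) = mon_ideal {1..} D"
      by (intro mon_ideal_cong) auto
    ultimately show False using I by simp
  qed
  then have "D = E" using E vars by (intro antichain_mon_ideal_eq[OF _ _ _ I]) blast+
  with D show "G = monom ` E" by simp
qed

lemma finite_exp_minimal:
  assumes "finite E"
  obtains D where "D \<subseteq> E" "antichain D" "\<And>e. e \<in> E \<Longrightarrow> \<exists>g\<in>D. g \<preceq> e"
  using assms
proof (induction E arbitrary: thesis rule: finite_induct)
  case empty
  then show ?case by (auto simp: antichain_def)
next
  case (insert x E)
  obtain D where D: "D \<subseteq> E" "antichain D" "\<And>e. e \<in> E \<Longrightarrow> \<exists>g\<in>D. g \<preceq> e"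
    using insert.IH by metis
  show ?case
  proof (cases "\<exists>g\<in>D. g \<preceq> x")
    case True
    then show ?thesis using D by (intro insert.prems[of D]) auto
  next
    case False
    let ?D = "insert x {g \<in> D. \<not> x \<preceq> g}"
    have "\<exists>g\<in>?D. g \<preceq> e" if "e \<in> insert x E" for e
      using that D(3)[of e] exp_le_trans by auto
    moreover have "antichain ?D"
      using D(2) False by (auto simp: antichain_def)
    ultimately show ?thesis using D(1) by (intro insert.prems[of ?D]) auto
  qed
qed

lemma squarefree_monomial_idealsE:
  fixes I :: "(nat, 'k::field) mpoly set"
  assumes "I \<in> squarefree_monomial_ideals"
  obtains E where "finite E" "antichain (ind ` E)" "\<And>A. A \<in> E \<Longrightarrow> finite A \<and> A \<subseteq> {1..}"
    "I = mon_ideal {1..} (ind ` E)" "min_gens I = monom ` ind ` E"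
proof -
  obtain G :: "(nat, 'k) mpoly set" where G: "finite G" "G \<subseteq> carrier S_inf" "\<forall>m\<in>G. is_squarefree_monomial m"
      "I = Idl\<^bsub>S_inf\<^esub> G"
    using assms by (auto simp: squarefree_monomial_ideals_def)
  define X where "X = {A. finite A \<and> monom (ind A) \<in> G}"
  have GX: "G = monom ` ind ` X"
    using G(3) by (auto simp: X_def is_squarefree_monomial_iff)
  have vars: "finite A \<and> A \<subseteq> {1..}" if "A \<in> X" for A
    using that G(2) unfolding X_def S_inf_def carrier_mpoly_ring subset_iff by auto
  have "finite (ind ` X)" using G(1) unfolding GX by (rule finite_imageD) (auto intro: inj_onI)
  then obtain D where D: "D \<subseteq> ind ` X" "antichain D" "\<And>e. e \<in> ind ` X \<Longrightarrow> \<exists>g\<in>D. g \<preceq> e"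
    by (rule finite_exp_minimal) blast
  obtain E where E: "E \<subseteq> X" "D = ind ` E" using D(1) by (meson subset_image_iff)
  have fin: "finite E"
  proof (rule finite_imageD)
    show "finite (ind ` E)" using \<open>finite (ind ` X)\<close> D(1) E finite_subset by blast
    show "inj_on ind E" using E vars by (auto simp: inj_on_def ind_inject subset_iff)
  qed
  have "I = mon_ideal {1..} (ind ` X)"
    unfolding G(4) GX by (rule genideal_S_inf_monom) (use vars in fastforce)
  also have "\<dots> = mon_ideal {1..} (ind ` E)"
    using D E by (intro mon_ideal_cong[symmetric]) auto
  finally have I: "I = mon_ideal {1..} (ind ` E)" .
  have "min_gens I = monom ` ind ` E"
    unfolding I using D(2) E vars by (intro min_gens_eqI) (auto simp: subset_iff)
  then show ?thesis using that[of E] fin D(2) E vars I by auto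
qed

section \<open>Modules and projective resolutions\<close>

lemma module_homI:
  assumes "\<And>x. x \<in> carrier M \<Longrightarrow> f x \<in> carrier N"
    "\<And>x y. x \<in> carrier M \<Longrightarrow> y \<in> carrier M \<Longrightarrow> f (x \<oplus>\<^bsub>M\<^esub> y) = f x \<oplus>\<^bsub>N\<^esub> f y"
    "\<And>r x. r \<in> carrier R \<Longrightarrow> x \<in> carrier M \<Longrightarrow> f (r \<odot>\<^bsub>M\<^esub> x) = r \<odot>\<^bsub>N\<^esub> f x"
  shows "f \<in> module_hom R M N"
  using assms by (simp add: module_hom_def)

lemma module_homD:
  assumes "f \<in> module_hom R M N"
  shows "x \<in> carrier M \<Longrightarrow> f x \<in> carrier N"
    "x \<in> carrier M \<Longrightarrow> y \<in> carrier M \<Longrightarrow> f (x \<oplus>\<^bsub>M\<^esub> y) = f x \<oplus>\<^bsub>N\<^esub> f y"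
    "r \<in> carrier R \<Longrightarrow> x \<in> carrier M \<Longrightarrow> f (r \<odot>\<^bsub>M\<^esub> x) = r \<odot>\<^bsub>N\<^esub> f x"
  using assms by (auto simp: module_hom_def)

lemma module_hom_id: "(\<lambda>x. x) \<in> module_hom R M M"
  by (rule module_homI) auto

lemma module_hom_comp:
  assumes "f \<in> module_hom R M N" "g \<in> module_hom R N L"
  shows "(\<lambda>x. g (f x)) \<in> module_hom R M L"
  by (rule module_homI) (simp_all add: module_homD[OF assms(1)] module_homD[OF assms(2)])

lemma module_hom_zero:
  assumes "module R M" "module R N" "f \<in> module_hom R M N"
  shows "f \<zero>\<^bsub>M\<^esub> = \<zero>\<^bsub>N\<^esub>"
proof -
  interpret M: module R M by fact
  interpret N: module R N by fact
  have "f (\<zero>\<^bsub>R\<^esub> \<odot>\<^bsub>M\<^esub> \<zero>\<^bsub>M\<^esub>) = \<zero>\<^bsub>R\<^esub> \<odot>\<^bsub>N\<^esub> f \<zero>\<^bsub>M\<^esub>"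
    by (rule module_homD(3)[OF assms(3)]) auto
  moreover have "f \<zero>\<^bsub>M\<^esub> \<in> carrier N"
    using module_homD(1)[OF assms(3)] by simp
  ultimately show ?thesis by simp
qed

lemma module_hom_add:
  assumes "module R N" "f \<in> module_hom R M N" "g \<in> module_hom R M N"
  shows "(\<lambda>x. f x \<oplus>\<^bsub>N\<^esub> g x) \<in> module_hom R M N"
proof -
  interpret N: module R N by fact
  show ?thesis
    by (rule module_homI)
      (simp_all add: module_homD[OF assms(2)] module_homD[OF assms(3)] N.smult_r_distr N.M.add.m_ac)
qed

lemma module_hom_minus:
  assumes "module R N" "f \<in> module_hom R M N"
  shows "(\<lambda>x. \<ominus>\<^bsub>N\<^esub> f x) \<in> module_hom R M N"
proof -
  interpret N: module R N by fact
  show ?thesis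
    by (rule module_homI) (simp_all add: module_homD[OF assms(2)] N.smult_r_minus N.M.minus_add)
qed

lemma module_hom_a_inv:
  assumes "module R M" "module R N" "f \<in> module_hom R M N" "x \<in> carrier M"
  shows "f (\<ominus>\<^bsub>M\<^esub> x) = \<ominus>\<^bsub>N\<^esub> f x"
proof -
  interpret M: module R M by fact
  interpret N: module R N by fact
  note f = module_homD[OF assms(3)]
  have "f (\<ominus>\<^bsub>M\<^esub> x) \<oplus>\<^bsub>N\<^esub> f x = f (\<ominus>\<^bsub>M\<^esub> x \<oplus>\<^bsub>M\<^esub> x)"
    using assms(4) by (simp add: f)
  also have "\<dots> = \<zero>\<^bsub>N\<^esub>"
    using module_hom_zero[OF assms(1-3)] assms(4) by (simp add: M.M.l_neg)
  finally show ?thesis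
    using assms(4) by (intro N.M.minus_equality[symmetric]) (simp_all add: f)
qed

lemma carrier_free_module:
  "f \<in> carrier (free_module R B) \<longleftrightarrow>
    (\<forall>b. f b \<in> carrier R) \<and> (\<forall>b. b \<notin> B \<longrightarrow> f b = \<zero>\<^bsub>R\<^esub>) \<and> finite {b. f b \<noteq> \<zero>\<^bsub>R\<^esub>}"
  by (simp add: free_module_def)

lemma free_module_simps [simp]:
  "\<zero>\<^bsub>free_module R B\<^esub> = (\<lambda>_. \<zero>\<^bsub>R\<^esub>)"
  "f \<oplus>\<^bsub>free_module R B\<^esub> g = (\<lambda>b. f b \<oplus>\<^bsub>R\<^esub> g b)"
  "r \<odot>\<^bsub>free_module R B\<^esub> f = (\<lambda>b. r \<otimes>\<^bsub>R\<^esub> f b)"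
  by (simp_all add: free_module_def)

lemma module_free_module:
  assumes "cring R"
  shows "module R (free_module R B)"
proof -
  interpret cring R by fact
  have add: "finite {b. f b \<oplus>\<^bsub>R\<^esub> g b \<noteq> \<zero>\<^bsub>R\<^esub>}"
    if "finite {b. f b \<noteq> \<zero>\<^bsub>R\<^esub>}" "finite {b. g b \<noteq> \<zero>\<^bsub>R\<^esub>}" for f g :: "'c \<Rightarrow> 'a"
  proof (rule finite_subset)
    show "{b. f b \<oplus>\<^bsub>R\<^esub> g b \<noteq> \<zero>\<^bsub>R\<^esub>} \<subseteq> {b. f b \<noteq> \<zero>\<^bsub>R\<^esub>} \<union> {b. g b \<noteq> \<zero>\<^bsub>R\<^esub>}" by auto
  qed (use that in auto)
  have smult: "finite {b. r \<otimes>\<^bsub>R\<^esub> f b \<noteq> \<zero>\<^bsub>R\<^esub>}"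
    if "finite {b. f b \<noteq> \<zero>\<^bsub>R\<^esub>}" "r \<in> carrier R" for r and f :: "'c \<Rightarrow> 'a"
  proof (rule finite_subset)
    show "{b. r \<otimes>\<^bsub>R\<^esub> f b \<noteq> \<zero>\<^bsub>R\<^esub>} \<subseteq> {b. f b \<noteq> \<zero>\<^bsub>R\<^esub>}" using that by auto
  qed (use that in auto)
  have "abelian_group (free_module R B)"
  proof (rule abelian_groupI)
    fix f assume f: "f \<in> carrier (free_module R B)"
    have "{b. \<ominus>\<^bsub>R\<^esub> f b \<noteq> \<zero>\<^bsub>R\<^esub>} \<subseteq> {b. f b \<noteq> \<zero>\<^bsub>R\<^esub>}" by auto
    then have "finite {b. \<ominus>\<^bsub>R\<^esub> f b \<noteq> \<zero>\<^bsub>R\<^esub>}"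
      using f finite_subset by (auto simp: carrier_free_module)
    then show "\<exists>g\<in>carrier (free_module R B). g \<oplus>\<^bsub>free_module R B\<^esub> f = \<zero>\<^bsub>free_module R B\<^esub>"
      using f by (intro bexI[of _ "\<lambda>b. \<ominus>\<^bsub>R\<^esub> f b"]) (auto simp: carrier_free_module l_neg)
  qed (auto simp: carrier_free_module a_ac add)
  then show ?thesis
    by (rule moduleI[OF assms]) (auto simp: carrier_free_module add smult l_distr r_distr m_assoc)
qed

definition unit_vec :: "('a, 'r) ring_scheme \<Rightarrow> 'i \<Rightarrow> 'i \<Rightarrow> 'a"
  where "unit_vec R b = (\<lambda>b'. if b' = b then \<one>\<^bsub>R\<^esub> else \<zero>\<^bsub>R\<^esub>)"

lemma unit_vec_carrier: "cring R \<Longrightarrow> b \<in> B \<Longrightarrow> unit_vec R b \<in> carrier (free_module R B)"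
  by (auto simp: carrier_free_module unit_vec_def cring.axioms(1) ring.ring_simprules)

lemma free_module_induct [consumes 2, case_names zero add]:
  assumes R: "cring R" and "f \<in> carrier (free_module R B)"
    and zero: "P (\<lambda>_. \<zero>\<^bsub>R\<^esub>)"
    and add: "\<And>f r b. f \<in> carrier (free_module R B) \<Longrightarrow> P f \<Longrightarrow> r \<in> carrier R \<Longrightarrow> b \<in> B \<Longrightarrow> f b = \<zero>\<^bsub>R\<^esub> \<Longrightarrow>
      P (f \<oplus>\<^bsub>free_module R B\<^esub> (r \<odot>\<^bsub>free_module R B\<^esub> unit_vec R b))"
  shows "P f"
proof -
  interpret cring R by fact
  show ?thesis
    using assms(2)
  proof (induction "card {b. f b \<noteq> \<zero>\<^bsub>R\<^esub>}" arbitrary: f rule: less_induct)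
    case less
    show ?case
    proof (cases "\<forall>b. f b = \<zero>\<^bsub>R\<^esub>")
      case True
      then have "f = (\<lambda>_. \<zero>\<^bsub>R\<^esub>)" by auto
      then show ?thesis using zero by simp
    next
      case False
      then obtain b where b: "f b \<noteq> \<zero>\<^bsub>R\<^esub>" by blast
      define f' where "f' = f(b := \<zero>\<^bsub>R\<^esub>)"
      have eq: "{c. f' c \<noteq> \<zero>\<^bsub>R\<^esub>} = {c. f c \<noteq> \<zero>\<^bsub>R\<^esub>} - {b}" by (auto simp: f'_def)
      have fin: "finite {c. f c \<noteq> \<zero>\<^bsub>R\<^esub>}" using less.prems by (simp add: carrier_free_module)
      have f': "f' \<in> carrier (free_module R B)"
        using less.prems fin eq by (auto simp: carrier_free_module f'_def)
      have "card {c. f' c \<noteq> \<zero>\<^bsub>R\<^esub>} < card {c. f c \<noteq> \<zero>\<^bsub>R\<^esub>}"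
        unfolding eq using fin b by (intro psubset_card_mono) auto
      then have "P f'" by (rule less.hyps[OF _ f'])
      moreover have fb: "f c \<in> carrier R" for c using less.prems by (simp add: carrier_free_module)
      have "b \<in> B" using b less.prems by (auto simp: carrier_free_module)
      ultimately have "P (f' \<oplus>\<^bsub>free_module R B\<^esub> (f b \<odot>\<^bsub>free_module R B\<^esub> unit_vec R b))"
        using f' fb by (intro add) (auto simp: f'_def)
      moreover have "f' \<oplus>\<^bsub>free_module R B\<^esub> (f b \<odot>\<^bsub>free_module R B\<^esub> unit_vec R b) = f"
        using fb by (auto simp: f'_def unit_vec_def)
      ultimately show ?thesis by simp
    qed
  qed
qed

lemma free_module_extend:
  assumes R: "cring R" and Q: "module R Q" and q: "\<And>b. b \<in> B \<Longrightarrow> q b \<in> carrier Q"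
  shows "\<exists>f\<in>module_hom R (free_module R B) Q. \<forall>b\<in>B. f (unit_vec R b) = q b"
proof -
  interpret cring R by fact
  interpret Q: module R Q by fact
  define f where "f x = finsum Q (\<lambda>b. x b \<odot>\<^bsub>Q\<^esub> q b) {b. x b \<noteq> \<zero>\<^bsub>R\<^esub>}" for x
  have f_eq: "f x = finsum Q (\<lambda>b. x b \<odot>\<^bsub>Q\<^esub> q b) S"
    if "x \<in> carrier (free_module R B)" "finite S" "S \<subseteq> B" "{b. x b \<noteq> \<zero>\<^bsub>R\<^esub>} \<subseteq> S" for x S
    unfolding f_def using that q
    by (intro Q.M.add.finprod_mono_neutral_cong_left) (auto simp: carrier_free_module)
  have F: "module R (free_module R B)" by (rule module_free_module[OF R])
  interpret F: module R "free_module R B" by (rule F)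
  have supp: "finite {b. x b \<noteq> \<zero>\<^bsub>R\<^esub>}" "{b. x b \<noteq> \<zero>\<^bsub>R\<^esub>} \<subseteq> B" "x b \<in> carrier R"
    if "x \<in> carrier (free_module R B)" for x b
    using that by (auto simp: carrier_free_module)
  have "f \<in> module_hom R (free_module R B) Q"
  proof (rule module_homI)
    fix x assume x: "x \<in> carrier (free_module R B)"
    then show "f x \<in> carrier Q"
      unfolding f_def using q supp[OF x] by (intro Q.M.add.finprod_closed) auto
  next
    fix x y assume xy: "x \<in> carrier (free_module R B)" "y \<in> carrier (free_module R B)"
    let ?S = "{b. x b \<noteq> \<zero>\<^bsub>R\<^esub>} \<union> {b. y b \<noteq> \<zero>\<^bsub>R\<^esub>}"
    have S: "finite ?S" "?S \<subseteq> B" using supp xy by auto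
    have "f (x \<oplus>\<^bsub>free_module R B\<^esub> y) = finsum Q (\<lambda>b. (x b \<oplus>\<^bsub>R\<^esub> y b) \<odot>\<^bsub>Q\<^esub> q b) ?S"
      using F.M.a_closed[OF xy] S by (subst f_eq[of _ ?S]) auto
    also have "\<dots> = finsum Q (\<lambda>b. x b \<odot>\<^bsub>Q\<^esub> q b \<oplus>\<^bsub>Q\<^esub> y b \<odot>\<^bsub>Q\<^esub> q b) ?S"
      using S q supp(3) xy by (intro Q.M.add.finprod_cong') (auto simp: Q.smult_l_distr subset_iff)
    also have "\<dots> = finsum Q (\<lambda>b. x b \<odot>\<^bsub>Q\<^esub> q b) ?S \<oplus>\<^bsub>Q\<^esub> finsum Q (\<lambda>b. y b \<odot>\<^bsub>Q\<^esub> q b) ?S"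
      using S q supp(3) xy by (intro Q.M.add.finprod_multf) (auto simp: subset_iff)
    also have "\<dots> = f x \<oplus>\<^bsub>Q\<^esub> f y"
      using S xy by (subst (1 2) f_eq[of _ ?S]) auto
    finally show "f (x \<oplus>\<^bsub>free_module R B\<^esub> y) = f x \<oplus>\<^bsub>Q\<^esub> f y" .
  next
    fix r x assume r: "r \<in> carrier R" and x: "x \<in> carrier (free_module R B)"
    let ?S = "{b. x b \<noteq> \<zero>\<^bsub>R\<^esub>}"
    have "f (r \<odot>\<^bsub>free_module R B\<^esub> x) = finsum Q (\<lambda>b. (r \<otimes>\<^bsub>R\<^esub> x b) \<odot>\<^bsub>Q\<^esub> q b) ?S"
      using F.smult_closed[OF r x] supp[OF x] r by (subst f_eq[of _ ?S]) auto
    also have "\<dots> = finsum Q (\<lambda>b. r \<odot>\<^bsub>Q\<^esub> (x b \<odot>\<^bsub>Q\<^esub> q b)) ?S"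
      using q supp[OF x] r by (intro Q.M.add.finprod_cong') (auto simp: Q.smult_assoc1 subset_iff)
    also have "\<dots> = r \<odot>\<^bsub>Q\<^esub> f x"
      unfolding f_def using q supp[OF x] r by (intro Q.finsum_smult_ldistr[symmetric]) auto
    finally show "f (r \<odot>\<^bsub>free_module R B\<^esub> x) = r \<odot>\<^bsub>Q\<^esub> f x" .
  qed
  moreover have "f (unit_vec R b) = q b" if "b \<in> B" for b
  proof -
    have "f (unit_vec R b) = finsum Q (\<lambda>c. unit_vec R b c \<odot>\<^bsub>Q\<^esub> q c) {b}"
      using unit_vec_carrier[OF R that] that by (intro f_eq) (auto simp: unit_vec_def)
    then show ?thesis using q[OF that] by (simp add: unit_vec_def)
  qed
  ultimately show ?thesis by blast
qed

lemma free_module_hom_eqI: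
  assumes R: "cring R" and N: "module R N"
    and f: "f \<in> module_hom R (free_module R B) N" and g: "g \<in> module_hom R (free_module R B) N"
    and eq: "\<And>b. b \<in> B \<Longrightarrow> f (unit_vec R b) = g (unit_vec R b)" and x: "x \<in> carrier (free_module R B)"
  shows "f x = g x"
proof -
  interpret F: module R "free_module R B" by (rule module_free_module[OF R])
  show ?thesis
    using R x
  proof (induction rule: free_module_induct)
    case zero
    then show ?case
      using module_hom_zero[OF F.module_axioms N f] module_hom_zero[OF F.module_axioms N g] by simp
  next
    case (add x r b)
    then show ?case
      using unit_vec_carrier[OF R, of b B] eq[of b]
      by (simp only: module_homD(2)[OF f] module_homD(2)[OF g] module_homD(3)[OF f]
          module_homD(3)[OF g] F.smult_closed)
  qed
qed

lemma free_module_lift: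
  assumes R: "cring R" and Q: "module R Q" and N: "module R N"
    and f: "f \<in> module_hom R (free_module R B) N" and g: "g \<in> module_hom R Q N"
    and im: "f ` carrier (free_module R B) \<subseteq> g ` carrier Q"
  shows "\<exists>\<phi>\<in>module_hom R (free_module R B) Q. \<forall>x\<in>carrier (free_module R B). g (\<phi> x) = f x"
proof -
  have "\<exists>y\<in>carrier Q. g y = f (unit_vec R b)" if "b \<in> B" for b
    using subsetD[OF im imageI[OF unit_vec_carrier[OF R that]]] by (elim imageE) metis
  then obtain q where q: "\<And>b. b \<in> B \<Longrightarrow> q b \<in> carrier Q" "\<And>b. b \<in> B \<Longrightarrow> g (q b) = f (unit_vec R b)"
    by metis
  obtain \<phi> where \<phi>: "\<phi> \<in> module_hom R (free_module R B) Q" "\<And>b. b \<in> B \<Longrightarrow> \<phi> (unit_vec R b) = q b"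
    using free_module_extend[of R Q B q, OF R Q q(1)] by blast
  have "g (\<phi> x) = f x" if "x \<in> carrier (free_module R B)" for x
    using free_module_hom_eqI[OF R N module_hom_comp[OF \<phi>(1) g] f _ that] \<phi>(2) q(2) by simp
  with \<phi>(1) show ?thesis by blast
qed

lemma projective_lift:
  fixes P :: "('a, 'm, 'x) module_scheme"
  assumes P: "projective_module R P" and Q: "module R Q" and N: "module R N"
    and f: "f \<in> module_hom R P N" and g: "g \<in> module_hom R Q N"
    and im: "\<And>x. x \<in> carrier P \<Longrightarrow> f x \<in> g ` carrier Q"
  shows "\<exists>\<phi>\<in>module_hom R P Q. \<forall>x\<in>carrier P. g (\<phi> x) = f x"
proof -
  obtain B :: "'m set" and s p where P': "module R P" "s \<in> module_hom R P (free_module R B)"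
    "p \<in> module_hom R (free_module R B) P" "\<And>x. x \<in> carrier P \<Longrightarrow> p (s x) = x"
    using P unfolding projective_module_def by blast
  have R: "cring R" using P'(1) by (simp add: module_def)
  have "(\<lambda>x. f (p x)) ` carrier (free_module R B) \<subseteq> g ` carrier Q"
    using im module_homD(1)[OF P'(3)] by auto
  then obtain \<psi> where \<psi>: "\<psi> \<in> module_hom R (free_module R B) Q"
      "\<forall>x\<in>carrier (free_module R B). g (\<psi> x) = f (p x)"
    using free_module_lift[OF R Q N module_hom_comp[OF P'(3) f] g] by metis
  show ?thesis
    using module_hom_comp[OF P'(2) \<psi>(1)] \<psi>(2) P'(4) module_homD(1)[OF P'(2)] by fastforce
qed

lemma free_module_reindex:
  assumes R: "cring R" and e: "inj_on e B"
  defines "p \<equiv> \<lambda>g b. if b \<in> B then g (e b) else \<zero>\<^bsub>R\<^esub>"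
    and "s \<equiv> \<lambda>f x. if x \<in> e ` B then f (inv_into B e x) else \<zero>\<^bsub>R\<^esub>"
  shows "p \<in> module_hom R (free_module R (e ` B)) (free_module R B)"
    "s \<in> module_hom R (free_module R B) (free_module R (e ` B))"
    "f \<in> carrier (free_module R B) \<Longrightarrow> p (s f) = f"
    "g \<in> carrier (free_module R (e ` B)) \<Longrightarrow> s (p g) = g"
proof -
  interpret cring R by fact
  show "p \<in> module_hom R (free_module R (e ` B)) (free_module R B)"
  proof (rule module_homI)
    fix g assume g: "g \<in> carrier (free_module R (e ` B))"
    have "{b. p g b \<noteq> \<zero>\<^bsub>R\<^esub>} \<subseteq> {b \<in> B. g (e b) \<noteq> \<zero>\<^bsub>R\<^esub>}" by (auto simp: p_def)
    moreover have "finite {b \<in> B. g (e b) \<noteq> \<zero>\<^bsub>R\<^esub>}"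
    proof (rule finite_imageD)
      have "e ` {b \<in> B. g (e b) \<noteq> \<zero>\<^bsub>R\<^esub>} \<subseteq> {b. g b \<noteq> \<zero>\<^bsub>R\<^esub>}" by auto
      then show "finite (e ` {b \<in> B. g (e b) \<noteq> \<zero>\<^bsub>R\<^esub>})"
        using g unfolding carrier_free_module by (meson finite_subset)
      show "inj_on e {b \<in> B. g (e b) \<noteq> \<zero>\<^bsub>R\<^esub>}" using e by (rule inj_on_subset) auto
    qed
    ultimately have "finite {b. p g b \<noteq> \<zero>\<^bsub>R\<^esub>}" by (rule finite_subset)
    then show "p g \<in> carrier (free_module R B)"
      using g by (auto simp: carrier_free_module p_def)
  qed (auto simp: p_def)
  show "s \<in> module_hom R (free_module R B) (free_module R (e ` B))"
  proof (rule module_homI)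
    fix f assume f: "f \<in> carrier (free_module R B)"
    have "{x. s f x \<noteq> \<zero>\<^bsub>R\<^esub>} \<subseteq> e ` {b. f b \<noteq> \<zero>\<^bsub>R\<^esub>}"
      using e by (auto simp: s_def split: if_splits)
    then have "finite {x. s f x \<noteq> \<zero>\<^bsub>R\<^esub>}"
      using f by (auto simp: carrier_free_module dest: finite_subset)
    then show "s f \<in> carrier (free_module R (e ` B))"
      using f by (auto simp: carrier_free_module s_def)
  qed (auto simp: s_def)
  show "f \<in> carrier (free_module R B) \<Longrightarrow> p (s f) = f"
    using e by (auto simp: p_def s_def carrier_free_module)
  show "g \<in> carrier (free_module R (e ` B)) \<Longrightarrow> s (p g) = g"
    using e by (auto simp: p_def s_def carrier_free_module f_inv_into_f inv_into_into)
qed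

lemma projective_free_module:
  assumes R: "cring R" and "\<one>\<^bsub>R\<^esub> \<noteq> \<zero>\<^bsub>R\<^esub>"
  shows "projective_module R (free_module R B)"
proof -
  have "inj_on (unit_vec R) B"
    using assms(2) by (auto simp: inj_on_def unit_vec_def fun_eq_iff split: if_splits)
  note reindex = free_module_reindex[OF R this]
  show ?thesis
    unfolding projective_module_def
    using module_free_module[OF R] reindex(1-3) by blast
qed

subsection \<open>Comparison of resolutions\<close>

lemma comparison_step:
  assumes T0: "module R T0" and T1: "projective_module R T1" and T2: "module R T2"
    and P0: "module R P0" and P1: "projective_module R P1"
    and dT: "dT \<in> module_hom R T1 T0" and dT': "dT' \<in> module_hom R T2 T1"
    and dP: "dP \<in> module_hom R P1 P0"
    and \<alpha>: "\<alpha> \<in> module_hom R T0 P0" and \<beta>: "\<beta> \<in> module_hom R P0 T0" and h: "h \<in> module_hom R T0 T1"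
    and im\<alpha>: "\<And>x. x \<in> carrier T1 \<Longrightarrow> \<alpha> (dT x) \<in> dP ` carrier P1"
    and im\<beta>: "\<And>y. y \<in> carrier P1 \<Longrightarrow> \<beta> (dP y) \<in> dT ` carrier T1"
    and homotopy: "\<And>x. x \<in> carrier T1 \<Longrightarrow> dT x = \<beta> (\<alpha> (dT x)) \<oplus>\<^bsub>T0\<^esub> dT (h (dT x))"
    and exact: "\<And>x. x \<in> carrier T1 \<Longrightarrow> dT x = \<zero>\<^bsub>T0\<^esub> \<Longrightarrow> x \<in> dT' ` carrier T2"
  shows "\<exists>\<alpha>'\<in>module_hom R T1 P1. \<exists>\<beta>'\<in>module_hom R P1 T1. \<exists>h'\<in>module_hom R T1 T2.
    (\<forall>x\<in>carrier T1. dP (\<alpha>' x) = \<alpha> (dT x)) \<and>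
    (\<forall>y\<in>carrier P1. dT (\<beta>' y) = \<beta> (dP y)) \<and>
    (\<forall>x\<in>carrier T1. x = \<beta>' (\<alpha>' x) \<oplus>\<^bsub>T1\<^esub> h (dT x) \<oplus>\<^bsub>T1\<^esub> dT' (h' x))"
proof -
  have T1': "module R T1" and P1': "module R P1" using T1 P1 by (auto simp: projective_module_def)
  interpret T0: module R T0 by fact
  interpret T1: module R T1 by fact
  obtain \<alpha>' where \<alpha>': "\<alpha>' \<in> module_hom R T1 P1" "\<And>x. x \<in> carrier T1 \<Longrightarrow> dP (\<alpha>' x) = \<alpha> (dT x)"
    using projective_lift[OF T1 P1' P0 module_hom_comp[OF dT \<alpha>] dP im\<alpha>] by blast
  obtain \<beta>' where \<beta>': "\<beta>' \<in> module_hom R P1 T1" "\<And>y. y \<in> carrier P1 \<Longrightarrow> dT (\<beta>' y) = \<beta> (dP y)"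
    using projective_lift[OF P1 T1' T0 module_hom_comp[OF dP \<beta>] dT im\<beta>] by blast
  define g where "g x = \<beta>' (\<alpha>' x) \<oplus>\<^bsub>T1\<^esub> h (dT x)" for x
  have g: "g \<in> module_hom R T1 T1"
    unfolding g_def
    by (intro module_hom_add[OF T1'] module_hom_comp[OF \<alpha>'(1) \<beta>'(1)] module_hom_comp[OF dT h])
  have k: "(\<lambda>x. x \<oplus>\<^bsub>T1\<^esub> (\<ominus>\<^bsub>T1\<^esub> g x)) \<in> module_hom R T1 T1"
    by (intro module_hom_add[OF T1'] module_hom_id module_hom_minus[OF T1'] g)
  have "x \<oplus>\<^bsub>T1\<^esub> (\<ominus>\<^bsub>T1\<^esub> g x) \<in> dT' ` carrier T2" if x: "x \<in> carrier T1" for x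
  proof (rule exact)
    show "x \<oplus>\<^bsub>T1\<^esub> (\<ominus>\<^bsub>T1\<^esub> g x) \<in> carrier T1" using module_homD(1)[OF k x] .
    have cl: "\<beta>' (\<alpha>' x) \<in> carrier T1" "h (dT x) \<in> carrier T1" "g x \<in> carrier T1" "\<alpha>' x \<in> carrier P1"
      using x module_homD(1)[OF g] module_homD(1)[OF \<alpha>'(1)] module_homD(1)[OF \<beta>'(1)]
        module_homD(1)[OF h] module_homD(1)[OF dT] by auto
    have "dT (g x) = \<beta> (\<alpha> (dT x)) \<oplus>\<^bsub>T0\<^esub> dT (h (dT x))"
      unfolding g_def using cl x by (simp add: module_homD(2)[OF dT] \<beta>'(2) \<alpha>'(2))
    then have "dT (g x) = dT x" using homotopy[OF x] by simp
    then show "dT (x \<oplus>\<^bsub>T1\<^esub> (\<ominus>\<^bsub>T1\<^esub> g x)) = \<zero>\<^bsub>T0\<^esub>"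
      using x cl module_hom_a_inv[OF T1' T0 dT cl(3)] module_homD(1)[OF dT x]
      by (simp add: module_homD(2)[OF dT] T0.M.r_neg)
  qed
  then obtain h' where h': "h' \<in> module_hom R T1 T2"
      "\<And>x. x \<in> carrier T1 \<Longrightarrow> dT' (h' x) = x \<oplus>\<^bsub>T1\<^esub> (\<ominus>\<^bsub>T1\<^esub> g x)"
    using projective_lift[OF T1 T2 T1' k dT'] by blast
  have "x = \<beta>' (\<alpha>' x) \<oplus>\<^bsub>T1\<^esub> h (dT x) \<oplus>\<^bsub>T1\<^esub> dT' (h' x)" if x: "x \<in> carrier T1" for x
  proof -
    have "g x \<oplus>\<^bsub>T1\<^esub> (x \<oplus>\<^bsub>T1\<^esub> (\<ominus>\<^bsub>T1\<^esub> g x)) = x"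
      using x module_homD(1)[OF g x]
      by (metis T1.M.a_comm T1.M.a_inv_closed T1.M.add.inv_solve_right' T1.M.a_closed)
    then show ?thesis
      unfolding h'(2)[OF x] by (simp add: g_def)
  qed
  then show ?thesis
    using \<alpha>' \<beta>' h'(1) by (intro bexI conjI ballI)
qed

lemma resolution_homotopy:
  fixes T :: "nat \<Rightarrow> ('a, 't) module" and P :: "nat \<Rightarrow> ('a, 'p) module"
  assumes M: "module R M" and res: "projective_resolution R M m P d a"
    and T: "\<And>i. projective_module R (T i)" and dT: "\<And>i. dT i \<in> module_hom R (T (Suc i)) (T i)"
    and aT: "aT \<in> module_hom R (T 0) M" "aT ` carrier (T 0) = carrier M"
    and exact0: "dT 0 ` carrier (T (Suc 0)) = {x \<in> carrier (T 0). aT x = \<zero>\<^bsub>M\<^esub>}"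
    and exact: "\<And>i. dT (Suc i) ` carrier (T (Suc (Suc i))) = {x \<in> carrier (T (Suc i)). dT i x = \<zero>\<^bsub>T i\<^esub>}"
  obtains h where "h \<in> module_hom R (T m) (T (Suc m))"
    "\<And>x. x \<in> carrier (T (Suc m)) \<Longrightarrow>
      \<exists>w\<in>carrier (T (Suc (Suc m))). x = h (dT m x) \<oplus>\<^bsub>T (Suc m)\<^esub> dT (Suc m) w"
proof -
  have P: "projective_module R (P i)" if "i \<le> m" for i
    using res that by (simp add: projective_resolution_def)
  have P': "module R (P i)" if "i \<le> m" for i
    using P[OF that] by (simp add: projective_module_def)
  have T': "module R (T i)" for i using T by (simp add: projective_module_def)
  have a: "a \<in> module_hom R (P 0) M" "a ` carrier (P 0) = carrier M"
    using res by (auto simp: projective_resolution_def)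
  have d: "d i \<in> module_hom R (P (Suc i)) (P i)" if "i < m" for i
    using res that by (simp add: projective_resolution_def)
  have dP: "d i ` carrier (P (Suc i)) = (if i = 0 then {x \<in> carrier (P 0). a x = \<zero>\<^bsub>M\<^esub>}
          else {x \<in> carrier (P i). d (i - 1) x = \<zero>\<^bsub>P (i - 1)\<^esub>})" if "i < m" for i
    using res that by (simp add: projective_resolution_def)
  have inj: "if m = 0 then inj_on a (carrier (P 0)) else inj_on (d (m - 1)) (carrier (P m))"
    using res unfolding projective_resolution_def by blast
  define kerP where "kerP i = (if i = 0 then {x \<in> carrier (P 0). a x = \<zero>\<^bsub>M\<^esub>}
          else {x \<in> carrier (P i). d (i - 1) x = \<zero>\<^bsub>P (i - 1)\<^esub>})" for i
  have key: "i \<le> m \<Longrightarrow> \<exists>\<alpha> \<beta> h. \<alpha> \<in> module_hom R (T i) (P i) \<and> \<beta> \<in> module_hom R (P i) (T i) \<and>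
      h \<in> module_hom R (T i) (T (Suc i)) \<and>
      (\<forall>z\<in>carrier (T (Suc i)). \<alpha> (dT i z) \<in> kerP i) \<and>
      (i < m \<longrightarrow> (\<forall>y\<in>carrier (P (Suc i)). \<beta> (d i y) \<in> dT i ` carrier (T (Suc i)))) \<and>
      (\<forall>z\<in>carrier (T (Suc i)). dT i z = \<beta> (\<alpha> (dT i z)) \<oplus>\<^bsub>T i\<^esub> dT i (h (dT i z)))" for i
  proof (induction i)
    case 0
    interpret M: module R M by fact
    interpret T0: module R "T 0" by (rule T')
    have z: "(\<lambda>_. \<zero>\<^bsub>T 0\<^esub>) \<in> module_hom R M (T 0)" by (rule module_homI) auto
    have az: "aT \<zero>\<^bsub>T 0\<^esub> = \<zero>\<^bsub>M\<^esub>" by (rule module_hom_zero[OF T' M aT(1)])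
    have e: "x \<in> dT 0 ` carrier (T (Suc 0))" if "x \<in> carrier (T 0)" "aT x = \<zero>\<^bsub>M\<^esub>" for x
      using exact0 that by simp
    have im: "aT x \<in> a ` carrier (P 0)" "a y \<in> aT ` carrier (T 0)"
      "aT x = aT x \<oplus>\<^bsub>M\<^esub> aT \<zero>\<^bsub>T 0\<^esub>" if "x \<in> carrier (T 0)" "y \<in> carrier (P 0)" for x y
      using aT(2) a(2) that az module_homD(1)[OF aT(1) that(1)] by (auto simp: imageI)
    have P0: "\<zero>\<^bsub>P 0\<^esub> \<in> carrier (P 0)"
      using P'[of 0] by (simp add: module_def abelian_group_def abelian_monoid.zero_closed)
    have "\<exists>\<alpha>\<in>module_hom R (T 0) (P 0). \<exists>\<beta>\<in>module_hom R (P 0) (T 0). \<exists>h\<in>module_hom R (T 0) (T (Suc 0)).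
      (\<forall>x\<in>carrier (T 0). a (\<alpha> x) = aT x) \<and> (\<forall>y\<in>carrier (P 0). aT (\<beta> y) = a y) \<and>
      (\<forall>x\<in>carrier (T 0). x = \<beta> (\<alpha> x) \<oplus>\<^bsub>T 0\<^esub> \<zero>\<^bsub>T 0\<^esub> \<oplus>\<^bsub>T 0\<^esub> dT 0 (h x))"
    proof (rule comparison_step[OF M T T' M P[OF le0] aT(1) dT a(1) module_hom_id module_hom_id z])
      show "aT x \<in> a ` carrier (P 0)" if "x \<in> carrier (T 0)" for x by (rule im(1)[OF that P0])
      show "a y \<in> aT ` carrier (T 0)" if "y \<in> carrier (P 0)" for y
        by (rule im(2)[OF T0.M.zero_closed that])
      show "aT x = aT x \<oplus>\<^bsub>M\<^esub> aT \<zero>\<^bsub>T 0\<^esub>" if "x \<in> carrier (T 0)" for x by (rule im(3)[OF that P0])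
    qed (rule e)
    then obtain \<alpha> \<beta> h where *: "\<alpha> \<in> module_hom R (T 0) (P 0)" "\<beta> \<in> module_hom R (P 0) (T 0)"
      "h \<in> module_hom R (T 0) (T (Suc 0))"
      "\<And>x. x \<in> carrier (T 0) \<Longrightarrow> a (\<alpha> x) = aT x"
      "\<And>y. y \<in> carrier (P 0) \<Longrightarrow> aT (\<beta> y) = a y"
      "\<And>x. x \<in> carrier (T 0) \<Longrightarrow> x = \<beta> (\<alpha> x) \<oplus>\<^bsub>T 0\<^esub> \<zero>\<^bsub>T 0\<^esub> \<oplus>\<^bsub>T 0\<^esub> dT 0 (h x)"
      by (elim bexE conjE) (rule that, assumption+, (erule bspec, assumption)+)
    have k: "dT 0 z \<in> carrier (T 0)" "aT (dT 0 z) = \<zero>\<^bsub>M\<^esub>" if "z \<in> carrier (T (Suc 0))" for z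
      using exact0 that by blast+
    have "\<alpha> (dT 0 z) \<in> kerP 0" if "z \<in> carrier (T (Suc 0))" for z
      using k[OF that] *(4) module_homD(1)[OF *(1)] by (simp add: kerP_def)
    moreover have "\<beta> (d 0 y) \<in> dT 0 ` carrier (T (Suc 0))" if "0 < m" "y \<in> carrier (P (Suc 0))" for y
    proof (rule e)
      have "d 0 y \<in> carrier (P 0)" "a (d 0 y) = \<zero>\<^bsub>M\<^esub>" using dP[OF that(1)] that(2) by auto
      then show "\<beta> (d 0 y) \<in> carrier (T 0)" "aT (\<beta> (d 0 y)) = \<zero>\<^bsub>M\<^esub>"
        using *(5) module_homD(1)[OF *(2)] by auto
    qed
    moreover have "dT 0 z = \<beta> (\<alpha> (dT 0 z)) \<oplus>\<^bsub>T 0\<^esub> dT 0 (h (dT 0 z))" if "z \<in> carrier (T (Suc 0))" for z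
      using *(6)[OF k(1)[OF that]] k(1)[OF that] module_homD(1)[OF *(1)] module_homD(1)[OF *(2)]
      by simp
    ultimately show ?case using *(1-3) by blast
  next
    case (Suc i)
    then have i: "i < m" "i \<le> m" by auto
    obtain \<alpha> \<beta> h where IH: "\<alpha> \<in> module_hom R (T i) (P i)" "\<beta> \<in> module_hom R (P i) (T i)"
      "h \<in> module_hom R (T i) (T (Suc i))"
      "\<And>z. z \<in> carrier (T (Suc i)) \<Longrightarrow> \<alpha> (dT i z) \<in> d i ` carrier (P (Suc i))"
      "\<And>y. y \<in> carrier (P (Suc i)) \<Longrightarrow> \<beta> (d i y) \<in> dT i ` carrier (T (Suc i))"
      "\<And>z. z \<in> carrier (T (Suc i)) \<Longrightarrow> dT i z = \<beta> (\<alpha> (dT i z)) \<oplus>\<^bsub>T i\<^esub> dT i (h (dT i z))"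
    proof -
      have "kerP i = d i ` carrier (P (Suc i))" using dP[OF i(1)] by (simp add: kerP_def)
      note IH = Suc.IH[OF i(2), unfolded this]
      show thesis
        using IH by (elim exE conjE) (rule that, assumption+, simp_all add: i(1))
    qed
    interpret Ti: module R "T i" by (rule T')
    interpret Ts: module R "T (Suc i)" by (rule T')
    have e: "x \<in> dT (Suc i) ` carrier (T (Suc (Suc i)))"
      if "x \<in> carrier (T (Suc i))" "dT i x = \<zero>\<^bsub>T i\<^esub>" for x
      using exact that by simp
    have "\<exists>\<alpha>'\<in>module_hom R (T (Suc i)) (P (Suc i)). \<exists>\<beta>'\<in>module_hom R (P (Suc i)) (T (Suc i)).
      \<exists>h'\<in>module_hom R (T (Suc i)) (T (Suc (Suc i))).
      (\<forall>x\<in>carrier (T (Suc i)). d i (\<alpha>' x) = \<alpha> (dT i x)) \<and>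
      (\<forall>y\<in>carrier (P (Suc i)). dT i (\<beta>' y) = \<beta> (d i y)) \<and>
      (\<forall>x\<in>carrier (T (Suc i)). x = \<beta>' (\<alpha>' x) \<oplus>\<^bsub>T (Suc i)\<^esub> h (dT i x) \<oplus>\<^bsub>T (Suc i)\<^esub> dT (Suc i) (h' x))"
      by (rule comparison_step[OF T' T T' P'[OF i(2)] P[OF Suc.prems] dT dT d[OF i(1)] IH(1-3)];
          rule IH(4-6) e; assumption)
    then obtain \<alpha>' \<beta>' h' where *: "\<alpha>' \<in> module_hom R (T (Suc i)) (P (Suc i))"
      "\<beta>' \<in> module_hom R (P (Suc i)) (T (Suc i))"
      "h' \<in> module_hom R (T (Suc i)) (T (Suc (Suc i)))"
      "\<And>x. x \<in> carrier (T (Suc i)) \<Longrightarrow> d i (\<alpha>' x) = \<alpha> (dT i x)"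
      "\<And>y. y \<in> carrier (P (Suc i)) \<Longrightarrow> dT i (\<beta>' y) = \<beta> (d i y)"
      "\<And>x. x \<in> carrier (T (Suc i)) \<Longrightarrow> x = \<beta>' (\<alpha>' x) \<oplus>\<^bsub>T (Suc i)\<^esub> h (dT i x) \<oplus>\<^bsub>T (Suc i)\<^esub> dT (Suc i) (h' x)"
      by (elim bexE conjE) (rule that, assumption+, (erule bspec, assumption)+)
    have k: "dT (Suc i) z \<in> carrier (T (Suc i))" "dT i (dT (Suc i) z) = \<zero>\<^bsub>T i\<^esub>"
      if "z \<in> carrier (T (Suc (Suc i)))" for z
      using exact[of i] that by blast+
    have "\<alpha>' (dT (Suc i) z) \<in> kerP (Suc i)" if "z \<in> carrier (T (Suc (Suc i)))" for z
      using k[OF that] *(4) module_homD(1)[OF *(1)] module_hom_zero[OF T' P'[OF i(2)] IH(1)]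
      by (simp add: kerP_def)
    moreover have "\<beta>' (d (Suc i) y) \<in> dT (Suc i) ` carrier (T (Suc (Suc i)))"
      if "Suc i < m" "y \<in> carrier (P (Suc (Suc i)))" for y
    proof (rule e)
      have "d (Suc i) y \<in> carrier (P (Suc i))" "d i (d (Suc i) y) = \<zero>\<^bsub>P i\<^esub>"
        using dP[OF that(1)] that(2) by auto
      then show "\<beta>' (d (Suc i) y) \<in> carrier (T (Suc i))" "dT i (\<beta>' (d (Suc i) y)) = \<zero>\<^bsub>T i\<^esub>"
        using *(5) module_homD(1)[OF *(2)] module_hom_zero[OF P'[OF i(2)] T' IH(2)] by auto
    qed
    moreover have "dT (Suc i) z = \<beta>' (\<alpha>' (dT (Suc i) z)) \<oplus>\<^bsub>T (Suc i)\<^esub> dT (Suc i) (h' (dT (Suc i) z))"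
      if "z \<in> carrier (T (Suc (Suc i)))" for z
      using *(6)[OF k(1)[OF that]] k[OF that] module_homD(1)[OF *(1)] module_homD(1)[OF *(2)]
        module_hom_zero[OF T' T' IH(3)] by simp
    ultimately show ?case using *(1-3) by blast
  qed
  obtain \<alpha> \<beta> h where *: "\<alpha> \<in> module_hom R (T m) (P m)" "\<beta> \<in> module_hom R (P m) (T m)"
    "h \<in> module_hom R (T m) (T (Suc m))"
    "\<And>z. z \<in> carrier (T (Suc m)) \<Longrightarrow> \<alpha> (dT m z) \<in> kerP m"
    "\<And>z. z \<in> carrier (T (Suc m)) \<Longrightarrow> dT m z = \<beta> (\<alpha> (dT m z)) \<oplus>\<^bsub>T m\<^esub> dT m (h (dT m z))"
    using key[OF order_refl] by (elim exE conjE) (rule that, assumption+, simp_all)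
  have ker: "x = \<zero>\<^bsub>P m\<^esub>" if "x \<in> kerP m" for x
  proof (cases "m = 0")
    case True
    interpret P0: module R "P 0" by (rule P') simp
    show ?thesis
      using that True inj module_hom_zero[OF P'[of 0] M a(1)] by (auto simp: kerP_def inj_on_def)
  next
    case False
    then have m: "m - 1 < m" "Suc (m - 1) = m" by auto
    interpret Pm: module R "P m" by (rule P') simp
    show ?thesis
      using that False inj module_hom_zero[OF P'[of m] P'[of "m - 1"]] d[OF m(1)] m
      by (auto simp: kerP_def inj_on_def)
  qed
  interpret Tm: module R "T m" by (rule T')
  interpret Ts: module R "T (Suc m)" by (rule T')
  have "\<exists>w\<in>carrier (T (Suc (Suc m))). x = h (dT m x) \<oplus>\<^bsub>T (Suc m)\<^esub> dT (Suc m) w"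
    if x: "x \<in> carrier (T (Suc m))" for x
  proof -
    have cl: "dT m x \<in> carrier (T m)" "h (dT m x) \<in> carrier (T (Suc m))"
        "dT m (h (dT m x)) \<in> carrier (T m)"
      using x module_homD(1)[OF dT] module_homD(1)[OF *(3)] by blast+
    have "\<beta> (\<alpha> (dT m x)) = \<zero>\<^bsub>T m\<^esub>"
      using ker[OF *(4)[OF x]] module_hom_zero[OF P'[of m] T' *(2)] by simp
    then have eq: "dT m x = dT m (h (dT m x))" using *(5)[OF x] cl by simp
    let ?y = "x \<oplus>\<^bsub>T (Suc m)\<^esub> (\<ominus>\<^bsub>T (Suc m)\<^esub> h (dT m x))"
    have "dT m ?y = \<zero>\<^bsub>T m\<^esub>"
      using x cl eq module_hom_a_inv[OF T' T' dT cl(2)] by (simp add: module_homD(2)[OF dT] Tm.M.r_neg)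
    then obtain w where w: "w \<in> carrier (T (Suc (Suc m)))" "?y = dT (Suc m) w"
      using exact[of m] x cl by (auto simp: set_eq_iff image_iff)
    have "h (dT m x) \<oplus>\<^bsub>T (Suc m)\<^esub> ?y = x"
      using x cl by (metis Ts.M.a_comm Ts.M.a_inv_closed Ts.M.add.inv_solve_right' Ts.M.a_closed)
    then show ?thesis using w by metis
  qed
  then show ?thesis using that *(3) by blast
qed

lemma module_quotient_module:
  assumes "cring R" and "ideal I R"
  shows "module R (quotient_module R I)"
proof -
  interpret cring R by fact
  interpret ideal I R by fact
  interpret Q: cring "R Quot I" by (rule quotient_is_cring) fact
  have hom: "a_r_coset R I \<in> ring_hom R (R Quot I)" by (rule rcos_ring_hom)
  note h = ring_hom_closed[OF hom] ring_hom_mult[OF hom] ring_hom_add[OF hom] ring_hom_one[OF hom]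
  have ag: "abelian_group (quotient_module R I)"
  proof (rule abelian_groupI)
    fix x assume "x \<in> carrier (quotient_module R I)"
    then show "\<exists>y\<in>carrier (quotient_module R I). y \<oplus>\<^bsub>quotient_module R I\<^esub> x = \<zero>\<^bsub>quotient_module R I\<^esub>"
      using Q.l_neg by (intro bexI[of _ "\<ominus>\<^bsub>R Quot I\<^esub> x"]) (auto simp: quotient_module_def)
  qed (simp_all add: quotient_module_def Q.a_ac)
  show ?thesis
    by (rule moduleI[OF assms(1) ag]) (simp_all add: quotient_module_def h Q.l_distr Q.r_distr Q.m_assoc)
qed

section \<open>The Taylor complex\<close>

definition alt :: "nat \<Rightarrow> nat set \<Rightarrow> 'a::comm_ring_1"
  where "alt i s = (- 1) ^ card {j \<in> s. j < i}"

lemma alt_insert: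
  assumes "finite s" "j \<notin> s" "i \<noteq> j"
  shows "alt i (insert j s) = (if j < i then - alt i s else alt i s)"
proof (cases "j < i")
  case True
  then have "{k \<in> insert j s. k < i} = insert j {k \<in> s. k < i}" by auto
  then show ?thesis using assms True by (simp add: alt_def)
next
  case False
  then have "{k \<in> insert j s. k < i} = {k \<in> s. k < i}" by auto
  then show ?thesis using False by (simp add: alt_def)
qed

lemma alt_swap:
  assumes "finite s" "i \<notin> s" "j \<notin> s" "i \<noteq> j"
  shows "alt i s * alt j (insert i s) = - (alt j s * alt i (insert j s))"
  using assms by (cases "i < j") (simp_all add: alt_insert)

lemma alt_square [simp]: "alt i s * alt i s = 1"
  by (simp add: alt_def flip: power_add mult_2)

lemma alt_nonzero [simp]: "alt i s \<noteq> (0 :: 'k::field)"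
  by (simp add: alt_def)

lemma lookup_alt_mult: "lookup (alt i s * p :: ('v, 'k::field) mpoly) u = alt i s * lookup p u"
  by (simp add: alt_def minus_one_power_iff)

lemma mpoly_vars_alt [simp]: "mpoly_vars (alt i s :: ('v, 'k::field) mpoly) = {}"
  by (simp add: alt_def minus_one_power_iff)

lemma sum_antisymmetric:
  fixes c :: "'i \<Rightarrow> 'i \<Rightarrow> 'a::ab_group_add"
  assumes "finite X" "\<And>i j. i \<in> X \<Longrightarrow> j \<in> X \<Longrightarrow> i \<noteq> j \<Longrightarrow> c i j = - c j i"
  shows "(\<Sum>i\<in>X. \<Sum>j\<in>X - {i}. c i j) = 0"
  using assms
proof (induction X rule: finite_induct)
  case (insert x X)
  have IH: "(\<Sum>i\<in>X. \<Sum>j\<in>X - {i}. c i j) = 0"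
    by (rule insert.IH) (use insert.prems in blast)
  have anti: "c x i = - c i x" if "i \<in> X" for i
    using insert.prems[of x i] insert.hyps(2) that by auto
  have "(\<Sum>j\<in>insert x X - {i}. c i j) = c i x + (\<Sum>j\<in>X - {i}. c i j)" if "i \<in> X" for i
  proof -
    have "insert x X - {i} = insert x (X - {i})" using insert.hyps(2) that by auto
    then show ?thesis using insert.hyps that by simp
  qed
  then have "(\<Sum>i\<in>X. \<Sum>j\<in>insert x X - {i}. c i j) = (\<Sum>i\<in>X. c i x)"
    using IH by (simp add: sum.distrib)
  moreover have "(\<Sum>j\<in>insert x X - {x}. c x j) = - (\<Sum>i\<in>X. c i x)"
  proof -
    have "insert x X - {x} = X" using insert.hyps(2) by auto
    then show ?thesis using anti by (simp add: sum_negf)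
  qed
  ultimately show ?case using insert.hyps by simp
qed simp

lemma keys_ind_subset: "keys (ind A) \<subseteq> A"
proof (cases "finite A")
  case False
  then show ?thesis by (simp add: ind_def)
qed simp

lemma exp_le_sum_iff: "a \<preceq> u \<Longrightarrow> b \<preceq> u - a \<longleftrightarrow> a + b \<preceq> u"
  unfolding exp_le_def lookup_add lookup_minus by (metis add.commute le_diff_conv2)

lemma quotient_module_mpoly_simps:
  fixes I :: "('w, 'k::field) mpoly set"
  assumes "ideal I (mpoly_ring W)"
  shows "carrier (quotient_module (mpoly_ring W) I) = {I +>\<^bsub>mpoly_ring W\<^esub> p |p. mpoly_vars p \<subseteq> W}"
    "\<zero>\<^bsub>quotient_module (mpoly_ring W) I\<^esub> = I"
    "mpoly_vars p \<subseteq> W \<Longrightarrow> I +>\<^bsub>mpoly_ring W\<^esub> p = I \<longleftrightarrow> p \<in> I"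
proof -
  interpret ideal I "mpoly_ring W" by fact
  show "carrier (quotient_module (mpoly_ring W) I) = {I +>\<^bsub>mpoly_ring W\<^esub> p |p. mpoly_vars p \<subseteq> W}"
    by (auto simp: quotient_module_def FactRing_def A_RCOSETS_def' carrier_mpoly_ring)
  show "\<zero>\<^bsub>quotient_module (mpoly_ring W) I\<^esub> = I"
    by (simp add: quotient_module_def FactRing_def)
  show "I +>\<^bsub>mpoly_ring W\<^esub> p = I \<longleftrightarrow> p \<in> I" if "mpoly_vars p \<subseteq> W"
    using that a_rcos_const[of p] a_rcos_self[of p] by (auto simp: carrier_mpoly_ring)
qed

locale taylor =
  fixes n :: nat and A :: "nat \<Rightarrow> 'v set" and V :: "'v set"
  assumes finite_A: "finite (A j)" and A_subset: "A j \<subseteq> V"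
begin

definition L :: "nat set \<Rightarrow> 'v set"
  where "L s = \<Union> (A ` s)"

definition faces :: "nat \<Rightarrow> nat set set"
  where "faces k = {s. s \<subseteq> {..<n} \<and> card s = k}"

abbreviation T :: "nat \<Rightarrow> (('v, 'k::field) mpoly, nat set \<Rightarrow> ('v, 'k) mpoly) module"
  where "T k \<equiv> free_module (mpoly_ring V) (faces k)"

definition dT :: "(nat set \<Rightarrow> ('v, 'k::field) mpoly) \<Rightarrow> nat set \<Rightarrow> ('v, 'k) mpoly"
  where "dT f s = (\<Sum>i\<in>{..<n} - s. alt i s * (monom (ind (A i - L s)) * f (insert i s)))"

text \<open>The coefficient of the basis vector \<open>s\<close> of \<open>f\<close> in the multidegree \<open>u\<close>. In a fixed multidegree
  the Taylor complex is the augmented chain complex of a simplex.\<close>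

definition co :: "(nat set \<Rightarrow> ('v, 'k::field) mpoly) \<Rightarrow> nat set \<Rightarrow> ('v \<Rightarrow>\<^sub>0 nat) \<Rightarrow> 'k"
  where "co f s u = (if ind (L s) \<preceq> u then lookup (f s) (u - ind (L s)) else 0)"

definition least_in :: "nat \<Rightarrow> ('v \<Rightarrow>\<^sub>0 nat) \<Rightarrow> bool"
  where "least_in i u \<longleftrightarrow> i < n \<and> A i \<subseteq> keys u \<and> (\<forall>j<i. \<not> A j \<subseteq> keys u)"

text \<open>The contraction of that simplex to its least vertex.\<close>

definition hT :: "(nat set \<Rightarrow> ('v, 'k::field) mpoly) \<Rightarrow> nat set \<Rightarrow> ('v, 'k) mpoly"
  where "hT f s = (if s = {} then 0 else
    \<Sum>e\<in>keys (f (s - {Min s})). if least_in (Min s) (e + ind (L (s - {Min s})))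
      then single (e + ind (L (s - {Min s})) - ind (L s)) (lookup (f (s - {Min s})) e) else 0)"

lemma finite_L: "finite s \<Longrightarrow> finite (L s)"
  by (auto simp: L_def finite_A)

lemma L_subset: "L s \<subseteq> V"
  using A_subset by (auto simp: L_def)

lemma L_insert: "L (insert i s) = A i \<union> L s"
  by (simp add: L_def)

lemma L_mono: "s \<subseteq> t \<Longrightarrow> L s \<subseteq> L t"
  by (auto simp: L_def)

lemma L_empty [simp]: "L {} = {}"
  by (simp add: L_def)

lemma facesD: "s \<in> faces k \<Longrightarrow> s \<subseteq> {..<n}" "s \<in> faces k \<Longrightarrow> card s = k" "s \<in> faces k \<Longrightarrow> finite s"
  by (auto simp: faces_def finite_subset)

lemma finite_faces: "finite (faces k)"
  by (rule finite_subset[of _ "Pow {..<n}"]) (auto simp: faces_def)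

lemma carrier_T:
  "f \<in> carrier (T k) \<longleftrightarrow> (\<forall>s. mpoly_vars (f s) \<subseteq> V) \<and> (\<forall>s. s \<notin> faces k \<longrightarrow> f s = 0)"
proof -
  have "finite {s. f s \<noteq> 0}" if "\<forall>s. s \<notin> faces k \<longrightarrow> f s = 0"
    by (rule finite_subset[OF _ finite_faces[of k]]) (use that in auto)
  then show ?thesis by (auto simp: carrier_free_module carrier_mpoly_ring)
qed

lemma ind_L_insert: "finite s \<Longrightarrow> ind (L (insert i s)) = ind (L s) + ind (A i - L s)"
  using ind_Un_disjoint[of "L s" "A i - L s"]
  by (simp add: finite_L finite_A L_insert Un_commute)

lemma co_dT:
  assumes "s \<subseteq> {..<n}"
  shows "co (dT f) s u = (\<Sum>i\<in>{..<n} - s. alt i s * co f (insert i s) u)"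
proof (cases "ind (L s) \<preceq> u")
  case True
  have fin: "finite s" using assms finite_subset by blast
  have "lookup (monom (ind (A i - L s)) * f (insert i s)) (u - ind (L s)) = co f (insert i s) u" for i
    using True
    by (simp add: lookup_monom_mult co_def ind_L_insert[OF fin] exp_le_sum_iff diff_diff_eq)
  then show ?thesis
    using True by (simp add: co_def[of "dT f"] dT_def lookup_sum lookup_alt_mult)
next
  case False
  have fin: "finite s" using assms finite_subset by blast
  have "\<not> ind (L (insert i s)) \<preceq> u" for i
    using False exp_le_trans exp_le_add(1) unfolding ind_L_insert[OF fin] by blast
  then show ?thesis using False by (simp add: co_def)
qed

lemma co_eqI: "(\<And>u. co f s u = co g s u) \<Longrightarrow> f s = g s"
proof (rule poly_mapping_eqI)
  fix e assume "\<And>u. co f s u = co g s u"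
  from this[of "e + ind (L s)"] show "lookup (f s) e = lookup (g s) e"
    by (simp add: co_def)
qed

lemma co_zero [simp]: "co (\<lambda>_. 0) s u = 0"
  by (simp add: co_def)

lemma co_nonzero_subset:
  assumes "co f s u \<noteq> 0" "finite s" "i \<in> s"
  shows "A i \<subseteq> keys u"
proof -
  have "ind (L s) \<preceq> u" using assms(1) by (auto simp: co_def split: if_splits)
  then have "L s \<subseteq> keys u" using assms(2) by (simp add: ind_exp_le finite_L)
  then show ?thesis using assms(3) by (auto simp: L_def)
qed

lemma dT_closed:
  assumes "f \<in> carrier (T (Suc k))"
  shows "dT f \<in> carrier (T k)"
  unfolding carrier_T
proof (intro conjI allI impI)
  fix s
  have "keys (ind (A i - L s)) \<subseteq> V" for i
    using A_subset[of i] finite_A[of i] by auto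
  then show "mpoly_vars (dT f s) \<subseteq> V"
    unfolding dT_def using assms
    by (intro mpoly_vars_sum mpoly_vars_mult) (auto simp: carrier_T subset_iff)
next
  fix s assume s: "s \<notin> faces k"
  have "f (insert i s) = 0" if "i \<in> {..<n} - s" for i
  proof -
    have "insert i s \<notin> faces (Suc k)"
    proof
      assume ins: "insert i s \<in> faces (Suc k)"
      have "finite s" using facesD(3)[OF ins] by simp
      then have "card s = k" using facesD(2)[OF ins] that by simp
      then show False using s facesD(1)[OF ins] by (simp add: faces_def)
    qed
    then show ?thesis using assms by (simp add: carrier_T)
  qed
  then show "dT f s = 0" by (simp add: dT_def)
qed

lemma dT_hom: "dT \<in> module_hom (mpoly_ring V) (T (Suc k)) (T k :: (('v, 'k::field) mpoly, _) module)"
proof (rule module_homI)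
  fix f g :: "nat set \<Rightarrow> ('v, 'k) mpoly"
  show "dT (f \<oplus>\<^bsub>T (Suc k)\<^esub> g) = dT f \<oplus>\<^bsub>T k\<^esub> dT g"
    by (simp add: fun_eq_iff dT_def algebra_simps sum.distrib)
next
  fix r :: "('v, 'k) mpoly" and f :: "nat set \<Rightarrow> ('v, 'k) mpoly"
  show "dT (r \<odot>\<^bsub>T (Suc k)\<^esub> f) = r \<odot>\<^bsub>T k\<^esub> dT f"
    by (simp add: fun_eq_iff dT_def sum_distrib_left mult_ac)
qed (rule dT_closed)

lemma dT_dT:
  assumes "f \<in> carrier (T (Suc (Suc k)))"
  shows "dT (dT f) = (\<lambda>_. 0)"
proof
  fix s
  have cl: "dT (dT f) \<in> carrier (T k)" using assms by (intro dT_closed)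
  show "dT (dT f) s = 0"
  proof (cases "s \<in> faces k")
    case True
    note s = facesD[OF True]
    have "co (dT (dT f)) s u = co (\<lambda>_. 0) s u" for u
    proof -
      let ?X = "{..<n} - s"
      let ?c = "\<lambda>i j. alt i s * alt j (insert i s) * co f (insert j (insert i s)) u"
      have "co (dT f) (insert i s) u = (\<Sum>j\<in>?X - {i}. alt j (insert i s) * co f (insert j (insert i s)) u)"
        if "i \<in> ?X" for i
      proof -
        have "{..<n} - insert i s = ?X - {i}" by auto
        then show ?thesis using co_dT[of "insert i s" f u] s that by simp
      qed
      then have "co (dT (dT f)) s u = (\<Sum>i\<in>?X. \<Sum>j\<in>?X - {i}. ?c i j)"
        using s by (simp add: co_dT sum_distrib_left mult.assoc)
      also have "\<dots> = 0"
      proof (rule sum_antisymmetric)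
        fix i j assume "i \<in> ?X" "j \<in> ?X" "i \<noteq> j"
        then have "alt i s * alt j (insert i s) = - (alt j s * alt i (insert j s) :: 'a)"
          using s by (intro alt_swap) auto
        then show "?c i j = - ?c j i" by (simp add: insert_commute)
      qed simp
      finally show ?thesis by simp
    qed
    then show ?thesis by (rule co_eqI)
  next
    case False
    then show ?thesis using cl by (simp add: carrier_T)
  qed
qed

lemma co_hT:
  assumes s: "s \<subseteq> {..<n}" "s \<noteq> {}"
  shows "co (hT f) s u = (if least_in (Min s) u then co f (s - {Min s}) u else 0)"
proof -
  have fin: "finite s" using s finite_subset by blast
  define i where "i = Min s"
  have i: "i \<in> s" unfolding i_def using fin s by simp
  define a where "a = ind (L (s - {i}))"
  define b where "b = ind (L s)"
  define g where "g = f (s - {i})"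
  have ab: "a \<preceq> b"
    unfolding a_def b_def using fin L_mono[of "s - {i}" s] by (simp add: ind_exp_le finite_L)
  have "L s = L (s - {i}) \<union> A i"
    using i L_insert[of i "s - {i}"] by (simp add: insert_absorb Un_commute)
  then have b: "b \<preceq> w" if "a \<preceq> w" "least_in i w" for w
  proof -
    have "L (s - {i}) \<subseteq> keys w" using that(1) fin by (simp add: a_def ind_exp_le finite_L)
    then have "L s \<subseteq> keys w" using that(2) \<open>L s = L (s - {i}) \<union> A i\<close> by (simp add: least_in_def)
    then show ?thesis using fin by (simp add: b_def ind_exp_le finite_L)
  qed
  show ?thesis
  proof (cases "b \<preceq> u")
    case True
    then have au: "a \<preceq> u" using ab exp_le_trans by blast
    have hT_eq: "hT f s = (\<Sum>e\<in>keys g. if least_in i (e + a) then single (e + a - b) (lookup g e) else 0)"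
      unfolding hT_def i_def a_def b_def g_def using s(2) by (simp only: if_False)
    have "co (hT f) s u = lookup (hT f s) (u - b)"
      using True by (simp add: co_def b_def)
    also have "\<dots> = (\<Sum>e\<in>keys g. if least_in i (e + a) \<and> e + a - b = u - b then lookup g e else 0)"
      unfolding hT_eq lookup_sum by (intro sum.cong) (auto simp: lookup_single when_def)
    also have "\<dots> = (\<Sum>e\<in>keys g. if e = u - a then (if least_in i u then lookup g e else 0) else 0)"
    proof (intro sum.cong refl)
      fix e
      have "e + a - b = u - b \<longleftrightarrow> e + a = u" if "least_in i (e + a)"
        using b[OF _ that] True exp_diff_add(1) by (metis exp_le_add(2))
      moreover have "e + a = u \<longleftrightarrow> e = u - a"
        using au exp_diff_add(1) by (metis add_diff_cancel_right')
      moreover have "u - a + a = u" using au by (rule exp_diff_add)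
      ultimately show "(if least_in i (e + a) \<and> e + a - b = u - b then lookup g e else 0) =
          (if e = u - a then (if least_in i u then lookup g e else 0) else 0)"
        by auto
    qed
    also have "\<dots> = (if least_in i u then lookup g (u - a) else 0)"
      by (auto simp: in_keys_iff)
    also have "\<dots> = (if least_in i u then co f (s - {i}) u else 0)"
      using au by (simp add: co_def a_def g_def)
    finally show ?thesis by (simp add: i_def)
  next
    case False
    then have "co f (s - {i}) u = 0" if "least_in i u"
      using b[of u] that by (auto simp: co_def a_def)
    then show ?thesis using False by (simp add: co_def[of "hT f"] b_def i_def[symmetric])
  qed
qed

lemma hT_closed:
  assumes "f \<in> carrier (T k)"
  shows "hT f \<in> carrier (T (Suc k))"
  unfolding carrier_T
proof (intro conjI allI impI)
  fix s
  let ?a = "ind (L (s - {Min s}))" and ?g = "f (s - {Min s})"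
  have "keys ?a \<subseteq> V"
    using L_subset keys_ind_subset by (rule order_trans[rotated])
  moreover have "keys e \<subseteq> V" if "e \<in> keys ?g" for e
    using assms that unfolding carrier_T mpoly_vars_subset_iff by blast
  ultimately have *: "keys (e + ?a - ind (L s)) \<subseteq> V" if "e \<in> keys ?g" for e
    using that keys_exp_diff[of "e + ?a" "ind (L s)"] exp_keys_add[of e ?a] by blast
  have "mpoly_vars (single (e + ?a - ind (L s)) (lookup ?g e)) \<subseteq> V" if "e \<in> keys ?g" for e
    by (rule order_trans[OF mpoly_vars_single *[OF that]])
  then have "mpoly_vars (if least_in (Min s) (e + ?a) then single (e + ?a - ind (L s)) (lookup ?g e) else 0) \<subseteq> V"
    if "e \<in> keys ?g" for e using that by simp
  then have "s \<noteq> {} \<Longrightarrow> mpoly_vars (hT f s) \<subseteq> V"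
    unfolding hT_def by (simp only: if_False mpoly_vars_sum)
  then show "mpoly_vars (hT f s) \<subseteq> V" by (cases "s = {}") (simp_all add: hT_def)
next
  fix s assume s: "s \<notin> faces (Suc k)"
  show "hT f s = 0"
  proof (cases "s = {} \<or> n \<le> Min s \<or> f (s - {Min s}) = 0")
    case True
    then show ?thesis by (auto simp: hT_def least_in_def)
  next
    case False
    then have f: "s - {Min s} \<in> faces k" using assms by (auto simp: carrier_T)
    then have fin: "finite s" using facesD(3) by fastforce
    then have M: "Min s \<in> s" using False by simp
    have "card s = Suc k" using card_Suc_Diff1[OF fin M] facesD(2)[OF f] by simp
    moreover have "s \<subseteq> {..<n}" using facesD(1)[OF f] False by auto
    ultimately have "s \<in> faces (Suc k)" by (simp add: faces_def)
    then show ?thesis using s by simp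
  qed
qed

lemma homotopy:
  assumes s: "s \<subseteq> {..<n}" and i: "least_in i u"
  shows "co f s u = co (dT (hT f)) s u + (if s = {} then 0 else co (hT (dT f)) s u)"
proof (cases "\<forall>j\<in>s. A j \<subseteq> keys u")
  case False
  then obtain j where j: "j \<in> s" "\<not> A j \<subseteq> keys u" by blast
  have fin: "finite s" using s finite_subset by blast
  have "co g s u = 0" for g :: "nat set \<Rightarrow> ('v, 'a) mpoly"
    using co_nonzero_subset[OF _ fin j(1)] j(2) by blast
  then show ?thesis by simp
next
  case True
  have fin: "finite s" using s finite_subset by blast
  have ge: "i \<le> j" if "j \<in> s" for j
    using True i that by (meson least_in_def not_le)
  have "i < n" "A i \<subseteq> keys u" using i by (auto simp: least_in_def)
  have uniq: "least_in j u \<longleftrightarrow> j = i" for j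
    using i by (metis least_in_def linorder_neqE_nat)
  have ins: "insert j s \<subseteq> {..<n}" if "j < n" for j using s that by auto
  have hT_ins: "co (hT f) (insert j s) u =
      (if Min (insert j s) = i then co f (insert j s - {i}) u else 0)" if "j < n" for j
    using co_hT[OF ins[OF that], of f u] uniq by simp
  show ?thesis
  proof (cases "i \<in> s")
    case True
    then have Min: "Min s = i" using ge fin by (intro Min_eqI) auto
    have "co (hT (dT f)) s u = co (dT f) (s - {i}) u"
      using co_hT[of s "dT f" u] s True uniq Min by auto
    also have "\<dots> = (\<Sum>j\<in>insert i ({..<n} - s). alt j (s - {i}) * co f (insert j (s - {i})) u)"
    proof -
      have "{..<n} - (s - {i}) = insert i ({..<n} - s)" using s True by auto
      then show ?thesis using co_dT[of "s - {i}" f u] s by auto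
    qed
    also have "\<dots> = alt i (s - {i}) * co f s u +
        (\<Sum>j\<in>{..<n} - s. alt j (s - {i}) * co f (insert j (s - {i})) u)"
      using True by (simp add: insert_absorb)
    also have "alt i (s - {i}) = (1 :: 'a)"
    proof -
      have "{j \<in> s - {i}. j < i} = {}" using leD[OF ge] by blast
      then show ?thesis unfolding alt_def by (simp only: card.empty power_0)
    qed
    finally have 1: "co (hT (dT f)) s u = co f s u +
        (\<Sum>j\<in>{..<n} - s. alt j (s - {i}) * co f (insert j (s - {i})) u)" by simp
    have "co (dT (hT f)) s u = (\<Sum>j\<in>{..<n} - s. alt j s * co (hT f) (insert j s) u)"
      by (rule co_dT[OF s])
    also have "\<dots> = (\<Sum>j\<in>{..<n} - s. - (alt j (s - {i}) * co f (insert j (s - {i})) u))"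
    proof (intro sum.cong refl)
      fix j assume j: "j \<in> {..<n} - s"
      then have ji: "j \<noteq> i" using True by auto
      have set: "insert j s - {i} = insert j (s - {i})" using ji by auto
      show "alt j s * co (hT f) (insert j s) u = - (alt j (s - {i}) * co f (insert j (s - {i})) u)"
      proof (cases "A j \<subseteq> keys u")
        case True
        then have "i < j" using i ji by (metis least_in_def linorder_neqE_nat)
        then have "Min (insert j s) = i" using ge fin \<open>i \<in> s\<close> by (intro Min_eqI) auto
        moreover have "alt j s = (- alt j (s - {i}) :: 'a)"
          using alt_insert[of "s - {i}" i j] fin \<open>i < j\<close> \<open>i \<in> s\<close> by (simp add: insert_absorb)
        ultimately show ?thesis using hT_ins[of j] j set by simp
      next
        case False
        have "co (hT f) (insert j s) u = 0" "co f (insert j (s - {i})) u = 0"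
          using co_nonzero_subset[of _ "insert j _" u j] fin False by blast+
        then show ?thesis by simp
      qed
    qed
    finally show ?thesis using 1 True by (auto simp: sum_negf)
  next
    case False
    have "co (dT (hT f)) s u = (\<Sum>j\<in>{..<n} - s. alt j s * co (hT f) (insert j s) u)"
      by (rule co_dT[OF s])
    also have "\<dots> = (\<Sum>j\<in>{..<n} - s. if j = i then co f s u else 0)"
    proof (intro sum.cong refl)
      fix j assume j: "j \<in> {..<n} - s"
      show "alt j s * co (hT f) (insert j s) u = (if j = i then co f s u else 0)"
      proof (cases "j = i")
        case True
        have "{k \<in> s. k < i} = {}" using leD[OF ge] by blast
        then have "alt i s = (1 :: 'a)" unfolding alt_def by (simp only: card.empty power_0)
        moreover have "Min (insert i s) = i" using ge fin by (intro Min_eqI) auto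
        moreover have "insert i s - {i} = s" using \<open>i \<notin> s\<close> by auto
        ultimately show ?thesis using hT_ins[of i] \<open>i < n\<close> True by simp
      next
        case False
        have "Min (insert j s) \<in> insert j s" using fin by (intro Min_in) auto
        then have "Min (insert j s) \<noteq> i" using False \<open>i \<notin> s\<close> by auto
        then show ?thesis using hT_ins[of j] j False by simp
      qed
    qed
    also have "\<dots> = co f s u" using \<open>i < n\<close> False by simp
    finally have 1: "co (dT (hT f)) s u = co f s u" .
    have "co (hT (dT f)) s u = 0" if "s \<noteq> {}"
    proof -
      have "Min s \<noteq> i" using False fin that Min_in by metis
      then show ?thesis using co_hT[OF s that, of "dT f" u] uniq by simp
    qed
    then show ?thesis using 1 by auto
  qed
qed

lemma least_in_exists: "j < n \<Longrightarrow> A j \<subseteq> keys u \<Longrightarrow> \<exists>i. least_in i u"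
proof (induction j rule: less_induct)
  case (less j)
  show ?case
  proof (cases "\<exists>k<j. A k \<subseteq> keys u")
    case True
    then show ?thesis using less by (meson less_trans)
  next
    case False
    then show ?thesis using less.prems by (auto simp: least_in_def)
  qed
qed

lemma exact_aux:
  assumes f: "f \<in> carrier (T k)" and cyc: "k = 0 \<or> dT f = (\<lambda>_. 0)"
    and supp: "\<And>s u. s \<in> faces k \<Longrightarrow> co f s u \<noteq> 0 \<Longrightarrow> \<exists>j<n. A j \<subseteq> keys u"
  shows "dT (hT f) = f"
proof
  fix s
  have cl: "dT (hT f) \<in> carrier (T k)" using f by (intro dT_closed hT_closed)
  show "dT (hT f) s = f s"
  proof (cases "s \<in> faces k")
    case True
    note s = facesD[OF True]
    have "co (dT (hT f)) s u = co f s u" for u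
    proof (cases "\<exists>i. least_in i u")
      case True
      then obtain i where i: "least_in i u" by blast
      have "co (hT (dT f)) s u = 0" if "s \<noteq> {}"
      proof -
        have "dT f = (\<lambda>_. 0)" using cyc s that by auto
        then show ?thesis using co_hT[OF s(1) that, of "dT f" u] by simp
      qed
      then show ?thesis using homotopy[OF s(1) i, of f] by auto
    next
      case False
      then have no: "\<not> A j \<subseteq> keys u" if "j < n" for j using least_in_exists that by blast
      have "co (hT f) (insert i s) u = 0" if "i \<in> {..<n} - s" for i
        using co_nonzero_subset[of "hT f" "insert i s" u i] s no that by blast
      then have "co (dT (hT f)) s u = 0" using co_dT[OF s(1), of "hT f" u] by simp
      moreover have "co f s u = 0" using supp[OF True] no by blast
      ultimately show ?thesis by simp
    qed
    then show ?thesis by (rule co_eqI)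
  next
    case False
    then show ?thesis using cl f by (simp add: carrier_T)
  qed
qed

lemma exact:
  "dT ` carrier (T (Suc (Suc k))) = {f \<in> carrier (T (Suc k) :: (('v, 'k::field) mpoly, _) module). dT f = (\<lambda>_. 0)}"
proof (intro equalityI subsetI)
  fix f :: "nat set \<Rightarrow> ('v, 'k) mpoly"
  assume f: "f \<in> {f \<in> carrier (T (Suc k)). dT f = (\<lambda>_. 0)}"
  have "dT (hT f) = f"
  proof (rule exact_aux)
    fix s u assume s: "s \<in> faces (Suc k)" "co f s u \<noteq> 0"
    then obtain j where "j \<in> s" using facesD(2)[OF s(1)] by fastforce
    then show "\<exists>j<n. A j \<subseteq> keys u"
      using co_nonzero_subset[OF s(2) facesD(3)[OF s(1)]] facesD(1)[OF s(1)] by auto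
  qed (use f in auto)
  moreover have "hT f \<in> carrier (T (Suc (Suc k)))" using f by (intro hT_closed) auto
  ultimately show "f \<in> dT ` carrier (T (Suc (Suc k)))" by (metis image_eqI)
qed (auto simp: dT_closed dT_dT)

abbreviation I :: "('v, 'k::field) mpoly set"
  where "I \<equiv> mon_ideal V (ind ` A ` {..<n})"

definition aT :: "(nat set \<Rightarrow> ('v, 'k::field) mpoly) \<Rightarrow> ('v, 'k) mpoly set"
  where "aT f = I +>\<^bsub>mpoly_ring V\<^esub> f {}"

lemma exact_0:
  "dT ` carrier (T (Suc 0)) = {f \<in> carrier (T 0 :: (('v, 'k::field) mpoly, _) module). f {} \<in> I}"
proof (intro equalityI subsetI)
  fix f :: "nat set \<Rightarrow> ('v, 'k) mpoly"
  assume f: "f \<in> {f \<in> carrier (T 0). f {} \<in> I}"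
  have "dT (hT f) = f"
  proof (rule exact_aux)
    fix s u assume s: "s \<in> faces 0" "co f s u \<noteq> 0"
    then have "s = {}" using facesD(2)[OF s(1)] facesD(3)[OF s(1)] by simp
    moreover have "u - ind (L {}) = u" by simp
    ultimately have "u \<in> keys (f {})" using s(2) by (auto simp: co_def in_keys_iff split: if_splits)
    then show "\<exists>j<n. A j \<subseteq> keys u"
      using f finite_A by (auto simp: mon_ideal_def ind_exp_le)
  qed (use f in auto)
  moreover have "hT f \<in> carrier (T (Suc 0))" using f by (intro hT_closed) auto
  ultimately show "f \<in> dT ` carrier (T (Suc 0))" by (metis image_eqI)
next
  fix f :: "nat set \<Rightarrow> ('v, 'k) mpoly"
  assume "f \<in> dT ` carrier (T (Suc 0))"
  then obtain g where g: "g \<in> carrier (T (Suc 0))" "f = dT g" by blast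
  have "monom (ind (A i)) \<in> (I :: ('v, 'k) mpoly set)" if "i < n" for i
    using that A_subset[of i] finite_A[of i] unfolding monom_in_mon_ideal by (auto intro!: bexI[of _ i])
  then have "alt i {} * g {i} * monom (ind (A i)) \<in> (I :: ('v, 'k) mpoly set)" if "i < n" for i
    using that g(1)
    by (intro ideal_mpoly_ringD(4)[OF ideal_mon_ideal] mpoly_vars_mult) (auto simp: carrier_T)
  then have "dT g {} \<in> I"
    unfolding dT_def by (intro ideal_sum_closed[OF ideal_mon_ideal]) (simp add: mult_ac)
  then show "f \<in> {f \<in> carrier (T 0). f {} \<in> I}" using g dT_closed by auto
qed

lemma aT_hom: "aT \<in> module_hom (mpoly_ring V) (T 0) (quotient_module (mpoly_ring V) (I :: ('v, 'k::field) mpoly set))"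
proof -
  interpret cring "mpoly_ring V :: ('v, 'k) mpoly ring" by (rule cring_mpoly_ring)
  interpret ideal "I :: ('v, 'k) mpoly set" "mpoly_ring V" by (rule ideal_mon_ideal)
  note hom = rcos_ring_hom
  show ?thesis
  proof (rule module_homI)
    fix f g :: "nat set \<Rightarrow> ('v, 'k) mpoly"
    assume fg: "f \<in> carrier (T 0)" "g \<in> carrier (T 0)"
    then have "f {} \<in> carrier (mpoly_ring V)" "g {} \<in> carrier (mpoly_ring V)"
      by (auto simp: carrier_T carrier_mpoly_ring)
    then show "aT (f \<oplus>\<^bsub>T 0\<^esub> g) = aT f \<oplus>\<^bsub>quotient_module (mpoly_ring V) I\<^esub> aT g"
      using ring_hom_add[OF hom] by (simp add: aT_def quotient_module_def)
  next
    fix r :: "('v, 'k) mpoly" and f :: "nat set \<Rightarrow> ('v, 'k) mpoly"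
    assume rf: "r \<in> carrier (mpoly_ring V)" "f \<in> carrier (T 0)"
    then have "f {} \<in> carrier (mpoly_ring V)"
      by (auto simp: carrier_T carrier_mpoly_ring)
    then show "aT (r \<odot>\<^bsub>T 0\<^esub> f) = r \<odot>\<^bsub>quotient_module (mpoly_ring V) I\<^esub> aT f"
      using ring_hom_mult[OF hom rf(1)] by (simp add: aT_def quotient_module_def)
  next
    fix f :: "nat set \<Rightarrow> ('v, 'k) mpoly"
    assume "f \<in> carrier (T 0)"
    then have "f {} \<in> carrier (mpoly_ring V)"
      by (auto simp: carrier_T carrier_mpoly_ring)
    then show "aT f \<in> carrier (quotient_module (mpoly_ring V) I)"
      using ring_hom_closed[OF hom] by (simp add: aT_def quotient_module_def)
  qed
qed

lemma aT_surj: "aT ` carrier (T 0) = carrier (quotient_module (mpoly_ring V) (I :: ('v, 'k::field) mpoly set))"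
proof
  show "aT ` carrier (T 0) \<subseteq> carrier (quotient_module (mpoly_ring V) (I :: ('v, 'k) mpoly set))"
    using module_homD(1)[OF aT_hom] by blast
  show "carrier (quotient_module (mpoly_ring V) (I :: ('v, 'k) mpoly set)) \<subseteq> aT ` carrier (T 0)"
  proof
    fix x :: "('v, 'k) mpoly set"
    assume "x \<in> carrier (quotient_module (mpoly_ring V) I)"
    then obtain p where p: "mpoly_vars p \<subseteq> V" "x = I +>\<^bsub>mpoly_ring V\<^esub> p"
      unfolding quotient_module_mpoly_simps(1)[OF ideal_mon_ideal] by blast
    have "{} \<in> faces 0" by (simp add: faces_def)
    then have m: "(\<lambda>s. if s = {} then p else 0) \<in> carrier (T 0 :: (('v, 'k) mpoly, _) module)"
      using p(1) by (auto simp: carrier_T)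
    have "x = aT (\<lambda>s. if s = {} then p else 0)"
      using p(2) by (simp add: aT_def)
    then show "x \<in> aT ` carrier (T 0)" using imageI[OF m, of aT] by simp
  qed
qed

lemma aT_kernel:
  "{f \<in> carrier (T 0). aT f = \<zero>\<^bsub>quotient_module (mpoly_ring V) (I :: ('v, 'k::field) mpoly set)\<^esub>} =
    {f \<in> carrier (T 0). f {} \<in> I}"
proof -
  have id: "ideal (I :: ('v, 'k) mpoly set) (mpoly_ring V)" by (rule ideal_mon_ideal)
  note q = quotient_module_mpoly_simps(2,3)[OF id]
  have "aT f = \<zero>\<^bsub>quotient_module (mpoly_ring V) (I :: ('v, 'k) mpoly set)\<^esub> \<longleftrightarrow> f {} \<in> I"
    if "f \<in> carrier (T 0)" for f :: "nat set \<Rightarrow> ('v, 'k) mpoly"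
    using that q by (simp only: aT_def carrier_T)
  then show ?thesis by blast
qed

end

section \<open>Projective dimension of monomial ideals\<close>

lemma lookup_mult_zero: "lookup (p * q :: ('v, 'k::field) mpoly) 0 = lookup p 0 * lookup q 0"
proof -
  have "lookup (p * q) 0 = lookup ((\<Sum>e\<in>keys p. single e (lookup p e)) * q) 0"
    by (simp only: mpoly_expand[symmetric])
  also have "\<dots> = (\<Sum>e\<in>keys p. if e = 0 then lookup p e * lookup q 0 else 0)"
    by (auto simp: sum_distrib_right lookup_sum lookup_single_mult intro!: sum.cong)
  also have "\<dots> = lookup p 0 * lookup q 0"
    by (auto simp: in_keys_iff)
  finally show ?thesis .
qed

lemma module_hom_constant_coeff:
  fixes h :: "('i \<Rightarrow> ('v, 'k::field) mpoly) \<Rightarrow> ('j \<Rightarrow> ('v, 'k) mpoly)"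
  assumes h: "h \<in> module_hom (mpoly_ring V) (free_module (mpoly_ring V) B) (free_module (mpoly_ring V) B')"
    and x: "x \<in> carrier (free_module (mpoly_ring V) B)" and zero: "\<And>b. lookup (x b) 0 = 0"
  shows "lookup (h x b') 0 = 0"
proof -
  let ?R = "mpoly_ring V :: ('v, 'k) mpoly ring"
  have R: "cring ?R" by (rule cring_mpoly_ring)
  interpret F: module ?R "free_module ?R B" by (rule module_free_module[OF R])
  have "(\<forall>b. lookup (x b) 0 = 0) \<longrightarrow> lookup (h x b') 0 = 0"
    using R x
  proof (induction rule: free_module_induct)
    case zero
    have "h (\<lambda>_. 0) = (\<lambda>_. 0)"
      using module_hom_zero[OF module_free_module[OF R] module_free_module[OF R] h] by simp
    then show ?case by simp
  next
    case (add f r b)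
    show ?case
    proof
      assume z: "\<forall>c. lookup ((f \<oplus>\<^bsub>free_module ?R B\<^esub> (r \<odot>\<^bsub>free_module ?R B\<^esub> unit_vec ?R b)) c) 0 = 0"
      then have r: "lookup r 0 = 0"
        using spec[OF z, of b] \<open>f b = \<zero>\<^bsub>?R\<^esub>\<close> by (simp add: unit_vec_def lookup_add)
      have "lookup (f c) 0 = 0" for c
        using spec[OF z, of c] r by (simp add: lookup_add lookup_mult_zero)
      then have "lookup (h f b') 0 = 0" using add.IH by simp
      moreover have "h (f \<oplus>\<^bsub>free_module ?R B\<^esub> (r \<odot>\<^bsub>free_module ?R B\<^esub> unit_vec ?R b)) =
          (\<lambda>c. h f c + r * h (unit_vec ?R b) c)"
        using add.hyps(1,2) unit_vec_carrier[OF R add.hyps(3)]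
          F.smult_closed[OF add.hyps(2) unit_vec_carrier[OF R add.hyps(3)]]
        by (simp only: module_homD(2)[OF h] module_homD(3)[OF h]) simp
      ultimately show "lookup (h (f \<oplus>\<^bsub>free_module ?R B\<^esub> (r \<odot>\<^bsub>free_module ?R B\<^esub> unit_vec ?R b)) b') 0 = 0"
        by (simp only: lookup_add lookup_mult_zero r) simp
    qed
  qed
  with zero show ?thesis by blast
qed

lemma proj_dim_eqI:
  fixes P :: "nat \<Rightarrow> ('a, nat \<Rightarrow> 'a) module"
  assumes "projective_resolution R M m P d a"
    and "\<And>m' (P :: nat \<Rightarrow> ('a, nat \<Rightarrow> 'a) module) d a. m' < m \<Longrightarrow> \<not> projective_resolution R M m' P d a"
  shows "proj_dim R M = enat m"
proof -
  let ?N = "{n. \<exists>(P :: nat \<Rightarrow> ('a, nat \<Rightarrow> 'a) module) d a. projective_resolution R M n P d a}"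
  have "enat m \<le> enat m'" if "m' \<in> ?N" for m'
    using assms(2)[of m'] that by (auto simp: not_less[symmetric])
  moreover have "m \<in> ?N" using assms(1) by blast
  ultimately show ?thesis
    unfolding proj_dim_def by (intro antisym INF_lower INF_greatest)
qed

lemma proj_dim_eqD:
  assumes "proj_dim R (M :: ('a, 'm, 'x) module_scheme) = enat m"
  shows "\<exists>(P :: nat \<Rightarrow> ('a, nat \<Rightarrow> 'a) module) d a. projective_resolution R M m P d a"
proof -
  let ?N = "{n. \<exists>(P :: nat \<Rightarrow> ('a, nat \<Rightarrow> 'a) module) d a. projective_resolution R M n P d a}"
  have eq: "Inf (enat ` ?N) = enat m" using assms by (simp add: proj_dim_def)
  have "enat ` ?N \<noteq> {}"
  proof
    assume "enat ` ?N = {}"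
    then have "Inf (enat ` ?N) = \<infinity>" by (simp add: Inf_enat_def)
    with eq show False by simp
  qed
  then have "Inf (enat ` ?N) \<in> enat ` ?N"
    unfolding Inf_enat_def by (simp only: if_False) (meson LeastI ex_in_conv)
  then have "m \<in> ?N" unfolding eq by blast
  then show ?thesis by blast
qed

lemma free_resolution_transport:
  fixes B :: "nat \<Rightarrow> 'i set" and e :: "'i \<Rightarrow> nat" and R :: "('a, 'r) ring_scheme" and d a
  assumes R: "cring R" "\<one>\<^bsub>R\<^esub> \<noteq> \<zero>\<^bsub>R\<^esub>" and M: "module R M" and e: "\<And>i. i \<le> m \<Longrightarrow> inj_on e (B i)"
    and a: "a \<in> module_hom R (free_module R (B 0)) M" "a ` carrier (free_module R (B 0)) = carrier M"
    and d: "\<And>i. i < m \<Longrightarrow> d i \<in> module_hom R (free_module R (B (Suc i))) (free_module R (B i))"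
    and exact0: "0 < m \<Longrightarrow> d 0 ` carrier (free_module R (B (Suc 0))) =
        {x \<in> carrier (free_module R (B 0)). a x = \<zero>\<^bsub>M\<^esub>}"
    and exact: "\<And>i. Suc i < m \<Longrightarrow> d (Suc i) ` carrier (free_module R (B (Suc (Suc i)))) =
        {x \<in> carrier (free_module R (B (Suc i))). d i x = \<zero>\<^bsub>free_module R (B i)\<^esub>}"
    and inj: "0 < m \<Longrightarrow> inj_on (d (m - 1)) (carrier (free_module R (B m)))" and m: "0 < m"
  shows "\<exists>(P :: nat \<Rightarrow> ('a, nat \<Rightarrow> 'a) module) d a. projective_resolution R M m P d a"
proof -
  interpret cring R by fact
  define p where "p i = (\<lambda>g b. if b \<in> B i then g (e b) else \<zero>\<^bsub>R\<^esub>)" for i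
  define s where "s i = (\<lambda>f x. if x \<in> e ` B i then f (inv_into (B i) e x) else \<zero>\<^bsub>R\<^esub>)" for i
  define F where "F i = free_module R (B i)" for i
  define P :: "nat \<Rightarrow> ('a, nat \<Rightarrow> 'a) module" where "P i = free_module R (e ` B i)" for i
  have p: "p i \<in> module_hom R (P i) (F i)" and s: "s i \<in> module_hom R (F i) (P i)"
    and ps: "\<And>f. f \<in> carrier (F i) \<Longrightarrow> p i (s i f) = f"
    and sp: "\<And>g. g \<in> carrier (P i) \<Longrightarrow> s i (p i g) = g" if "i \<le> m" for i
    using free_module_reindex[OF R(1) e[OF that]] unfolding p_def s_def F_def P_def by auto
  have FM: "module R (F i)" and PM: "module R (P i)" for i
    unfolding F_def P_def by (rule module_free_module[OF R(1)])+
  have zeros: "\<zero>\<^bsub>P i\<^esub> = (\<lambda>_. \<zero>\<^bsub>R\<^esub>)" "\<zero>\<^bsub>F i\<^esub> = (\<lambda>_. \<zero>\<^bsub>R\<^esub>)" for i by (simp_all add: P_def F_def)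
  have pcl: "p i g \<in> carrier (F i)" if "i \<le> m" "g \<in> carrier (P i)" for i g
    using module_homD(1)[OF p[OF that(1)] that(2)] .
  have scl: "s i g \<in> carrier (P i)" if "i \<le> m" "g \<in> carrier (F i)" for i g
    using module_homD(1)[OF s[OF that(1)] that(2)] .
  have s0: "s i x = \<zero>\<^bsub>P i\<^esub> \<longleftrightarrow> x = \<zero>\<^bsub>F i\<^esub>" if "i \<le> m" "x \<in> carrier (F i)" for i x
    using module_hom_zero[OF FM PM s[OF that(1)]] module_hom_zero[OF PM FM p[OF that(1)]] ps[OF that]
    by metis
  have p_im: "p i ` carrier (P i) = carrier (F i)" if "i \<le> m" for i
    using pcl[OF that] ps[OF that] scl[OF that] by force
  define d' where "d' i = (\<lambda>x. s i (d i (p (Suc i) x)))" for i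
  have dF: "d i \<in> module_hom R (F (Suc i)) (F i)" if "i < m" for i
    using d[OF that] by (simp add: F_def)
  have d': "d' i \<in> module_hom R (P (Suc i)) (P i)" if "i < m" for i
    unfolding d'_def using that
    by (intro module_hom_comp[OF module_hom_comp[OF p dF] s]) auto
  have d'_im: "d' i ` carrier (P (Suc i)) = {x \<in> carrier (P i). p i x \<in> d i ` carrier (F (Suc i))}"
    if "i < m" for i
  proof -
    have "d' i ` carrier (P (Suc i)) = s i ` d i ` carrier (F (Suc i))"
    proof -
      have "d' i ` carrier (P (Suc i)) = s i ` d i ` p (Suc i) ` carrier (P (Suc i))"
        unfolding d'_def by (simp only: image_image)
      then show ?thesis using p_im[of "Suc i"] that by simp
    qed
    also have "\<dots> = {x \<in> carrier (P i). p i x \<in> d i ` carrier (F (Suc i))}"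
    proof (intro equalityI subsetI)
      fix x assume "x \<in> s i ` d i ` carrier (F (Suc i))"
      then obtain y where y: "y \<in> carrier (F (Suc i))" "x = s i (d i y)" by blast
      have "d i y \<in> carrier (F i)" using module_homD(1)[OF dF[OF that] y(1)] .
      then show "x \<in> {x \<in> carrier (P i). p i x \<in> d i ` carrier (F (Suc i))}"
        using y that ps[of i "d i y"] scl[of i "d i y"] by auto
    next
      fix x assume x: "x \<in> {x \<in> carrier (P i). p i x \<in> d i ` carrier (F (Suc i))}"
      then have "s i (p i x) = x" using sp[of i x] that by simp
      then show "x \<in> s i ` d i ` carrier (F (Suc i))" using x by (metis (lifting) image_eqI mem_Collect_eq)
    qed
    finally show ?thesis .
  qed
  have "projective_resolution R M m P d' (\<lambda>x. a (p 0 x))"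
    unfolding projective_resolution_def
  proof (intro conjI allI impI)
    fix i show "projective_module R (P i)"
      unfolding P_def by (rule projective_free_module[OF R])
  next
    show "(\<lambda>x. a (p 0 x)) \<in> module_hom R (P 0) M"
      using module_hom_comp[OF p[of 0] a(1)[folded F_def]] by simp
    show "(\<lambda>x. a (p 0 x)) ` carrier (P 0) = carrier M"
      using p_im[of 0] a(2) unfolding image_image[of a "p 0", symmetric] by (simp add: F_def)
  next
    fix i assume i: "i < m"
    show "d' i \<in> module_hom R (P (Suc i)) (P i)" by (rule d'[OF i])
    show "d' i ` carrier (P (Suc i)) = (if i = 0 then {x \<in> carrier (P 0). a (p 0 x) = \<zero>\<^bsub>M\<^esub>}
          else {x \<in> carrier (P i). d' (i - 1) x = \<zero>\<^bsub>P (i - 1)\<^esub>})"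
    proof (cases i)
      case 0
      then show ?thesis
        using d'_im[OF i] exact0 i pcl[of 0] by (auto simp: F_def)
    next
      case (Suc j)
      have "d' j x = \<zero>\<^bsub>P j\<^esub> \<longleftrightarrow> d j (p i x) = \<zero>\<^bsub>F j\<^esub>" if "x \<in> carrier (P i)" for x
      proof -
        have "d j (p i x) \<in> carrier (F j)"
          using module_homD(1)[OF dF[of j]] pcl[OF _ that] i Suc by simp
        then show ?thesis using s0[of j] i Suc by (simp add: d'_def)
      qed
      then show ?thesis
        using d'_im[OF i] exact[of j] i Suc pcl[of i] by (auto simp: F_def)
    qed
  next
    have "inj_on (d' (m - 1)) (carrier (P m))"
    proof (rule inj_onI)
      fix x y assume xy: "x \<in> carrier (P m)" "y \<in> carrier (P m)" "d' (m - 1) x = d' (m - 1) y"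
      have cl: "d (m - 1) (p m z) \<in> carrier (F (m - 1))" if "z \<in> carrier (P m)" for z
        using module_homD(1)[OF dF[of "m - 1"]] pcl[OF _ that] m by simp
      have "s (m - 1) (d (m - 1) (p m x)) = s (m - 1) (d (m - 1) (p m y))"
        using xy(3) m by (simp add: d'_def)
      then have "d (m - 1) (p m x) = d (m - 1) (p m y)"
        using ps[of "m - 1"] cl[OF xy(1)] cl[OF xy(2)] by (metis diff_le_self)
      then have "p m x = p m y"
        using inj[OF m] pcl[OF le_refl xy(1)] pcl[OF le_refl xy(2)] by (auto simp: F_def inj_on_def)
      then show "x = y" using sp[OF le_refl] xy by metis
    qed
    then show "if m = 0 then inj_on (\<lambda>x. a (p 0 x)) (carrier (P 0)) else inj_on (d' (m - 1)) (carrier (P m))"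
      using m by simp
  qed
  then show ?thesis by blast
qed

context taylor
begin

abbreviation full :: "nat set"
  where "full \<equiv> {..<n}"

definition cov :: "nat \<Rightarrow> nat \<Rightarrow> bool"
  where "cov i j \<longleftrightarrow> A i \<subseteq> L (full - {i, j})"

abbreviation M :: "(('v, 'k::field) mpoly, ('v, 'k) mpoly set) module"
  where "M \<equiv> quotient_module (mpoly_ring V) I"

lemma module_M: "module (mpoly_ring V) (M :: (('v, 'k::field) mpoly, ('v, 'k) mpoly set) module)"
  by (intro module_quotient_module cring_mpoly_ring ideal_mon_ideal)

lemma T_projective: "projective_module (mpoly_ring V) (T k)"
  by (intro projective_free_module cring_mpoly_ring) simp

lemma lookup_dT_zero:
  assumes "finite s"
  shows "lookup (dT f s) 0 = (\<Sum>i\<in>full - s. if A i \<subseteq> L s then alt i s * lookup (f (insert i s)) 0 else 0)"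
proof -
  have "ind (A i - L s) = 0 \<longleftrightarrow> A i \<subseteq> L s" for i
    using ind_inject[of "A i - L s" "{}"] finite_A by auto
  then have "lookup (monom (ind (A i - L s)) * f (insert i s)) 0 = (if A i \<subseteq> L s then lookup (f (insert i s)) 0 else 0)" for i
    unfolding lookup_monom_mult exp_le_zero by (metis diff_zero)
  then show ?thesis
    by (auto simp: dT_def lookup_sum lookup_alt_mult intro!: sum.cong)
qed

lemma short_resolution_boundary:
  fixes P :: "nat \<Rightarrow> (('v, 'k::field) mpoly, 'p) module" and z :: "nat set \<Rightarrow> ('v, 'k) mpoly"
  assumes res: "projective_resolution (mpoly_ring V) M m P d a"
    and z: "z \<in> carrier (T (Suc m))" "\<And>s. s \<in> faces m \<Longrightarrow> lookup (dT z s) 0 = 0"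
  shows "\<exists>w\<in>carrier (T (Suc (Suc m))). \<forall>s. lookup (z s) 0 = lookup (dT w s) 0"
proof -
  obtain h :: "(nat set \<Rightarrow> ('v, 'k) mpoly) \<Rightarrow> nat set \<Rightarrow> ('v, 'k) mpoly"
    where h: "h \<in> module_hom (mpoly_ring V) (T m) (T (Suc m))"
    "\<And>x. x \<in> carrier (T (Suc m)) \<Longrightarrow>
      \<exists>w\<in>carrier (T (Suc (Suc m))). x = h (dT x) \<oplus>\<^bsub>T (Suc m)\<^esub> dT w"
  proof (rule resolution_homotopy[OF module_M res, of T "\<lambda>_. dT" aT])
    show "dT ` carrier (T (Suc 0)) = {x \<in> carrier (T 0). aT x = \<zero>\<^bsub>M\<^esub>}"
      unfolding aT_kernel by (rule exact_0)
    show "dT ` carrier (T (Suc (Suc i))) = {x \<in> carrier (T (Suc i)). dT x = \<zero>\<^bsub>T i\<^esub>}" for i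
      using exact[of i] by simp
    fix h :: "(nat set \<Rightarrow> ('v, 'k) mpoly) \<Rightarrow> nat set \<Rightarrow> ('v, 'k) mpoly"
    assume h: "h \<in> module_hom (mpoly_ring V) (T m) (T (Suc m))"
      "\<And>x. x \<in> carrier (T (Suc m)) \<Longrightarrow>
        \<exists>w\<in>carrier (T (Suc (Suc m))). x = h (dT x) \<oplus>\<^bsub>T (Suc m)\<^esub> dT w"
    show thesis by (rule that, rule h(1), erule h(2))
  qed (rule T_projective dT_hom aT_hom aT_surj)+
  obtain w where w: "w \<in> carrier (T (Suc (Suc m)))" "z = (\<lambda>s. h (dT z) s + dT w s)"
    using h(2)[OF z(1)] by auto
  have dz: "dT z \<in> carrier (T m)" using z(1) by (rule dT_closed)
  then have "lookup (dT z s) 0 = 0" for s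
    using z(2)[of s] by (cases "s \<in> faces m") (simp_all add: carrier_T)
  then have "lookup (h (dT z) s) 0 = 0" for s
    by (rule module_hom_constant_coeff[OF h(1) dz])
  moreover have "z s = h (dT z) s + dT w s" for s using w(2) by (rule fun_cong)
  ultimately have "lookup (z s) 0 = lookup (dT w s) 0" for s
    by (metis add_0 lookup_add)
  then show ?thesis using w(1) by blast
qed

lemma no_resolution_below_face:
  fixes P :: "nat \<Rightarrow> (('v, 'k::field) mpoly, 'p) module"
  assumes t: "t \<in> faces k" "\<And>i. i \<in> t \<Longrightarrow> \<not> A i \<subseteq> L (t - {i})" "\<And>i. i \<in> full - t \<Longrightarrow> \<not> A i \<subseteq> L t"
    and m: "m < k"
  shows "\<not> projective_resolution (mpoly_ring V) (M :: (('v, 'k) mpoly, _) module) m P d a"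
proof
  assume res: "projective_resolution (mpoly_ring V) (M :: (('v, 'k) mpoly, _) module) m P d a"
  obtain t' where t': "t' \<subseteq> t" "card t' = Suc m"
    using obtain_subset_with_card_n[of "Suc m" t] facesD(2)[OF t(1)] m by auto
  have face: "t' \<in> faces (Suc m)" and fin: "finite t'"
    using t' facesD[OF t(1)] finite_subset[OF t'(1)] by (auto simp: faces_def)
  define z :: "nat set \<Rightarrow> ('v, 'k) mpoly" where "z s = (if s = t' then 1 else 0)" for s
  have "lookup (dT z s) 0 = 0" if "s \<in> faces m" for s
  proof -
    have "\<not> A i \<subseteq> L s" if "insert i s = t'" "i \<notin> s" for i
    proof -
      have "s \<subseteq> t - {i}" "i \<in> t" using that t' by auto
      then show ?thesis using t(2)[of i] L_mono by blast
    qed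
    then show ?thesis
      unfolding lookup_dT_zero[OF facesD(3)[OF that]] by (intro sum.neutral) (auto simp: z_def)
  qed
  moreover have "z \<in> carrier (T (Suc m))" using face by (auto simp: carrier_T z_def)
  ultimately obtain w where w: "lookup (z t') 0 = lookup (dT w t') 0"
    using short_resolution_boundary[OF res, of z] by blast
  have "\<not> A i \<subseteq> L t'" if "i \<in> full - t'" for i
  proof (cases "i \<in> t")
    case True
    then have "t' \<subseteq> t - {i}" using that t' by auto
    then show ?thesis using t(2)[OF True] L_mono by blast
  next
    case False
    then show ?thesis using t(3)[of i] that L_mono[OF t'(1)] by blast
  qed
  then have "lookup (dT w t') 0 = 0"
    unfolding lookup_dT_zero[OF fin] by (intro sum.neutral) auto
  then show False using w by (simp add: z_def)
qed

lemma cov_mono: "cov i j \<Longrightarrow> cov i i"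
  unfolding cov_def using L_mono[of "full - {i, j}" "full - {i, i}"] by blast

lemma L_remove: "i \<in> s \<Longrightarrow> A i \<subseteq> L (s - {i}) \<Longrightarrow> L (s - {i}) = L s"
  by (auto simp: L_def)

lemma cov_sym:
  assumes "cov i j" "cov j j" "i < n" "j < n"
  shows "cov j i"
proof (cases "i = j")
  case False
  have "full - {i, j} = full - {j} - {i}" by auto
  then have "L (full - {i, j}) = L (full - {j})"
    using L_remove[of i "full - {j}"] assms False by (simp add: cov_def)
  then show ?thesis using assms(2) by (simp add: cov_def insert_commute)
qed (use assms in simp)

lemma dT_diff: "dT (\<lambda>s. f s - g s) s = dT f s - dT g s"
  by (simp add: dT_def right_diff_distrib sum_subtractf)

lemma full_remove_inject: "i < n \<Longrightarrow> full - {i} = full - {j} \<longleftrightarrow> i = j"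
  by auto

lemma lookup_dT_full_remove:
  assumes "i < n"
  shows "lookup (dT w (full - {i})) 0 = (if cov i i then alt i (full - {i}) * lookup (w full) 0 else 0)"
proof -
  have "full - (full - {i}) = {i}" "insert i (full - {i}) = full" using assms by auto
  then show ?thesis by (simp add: lookup_dT_zero cov_def)
qed

lemma lookup_dT_full_remove2:
  assumes "i < n" "j < n" "i \<noteq> j"
  shows "lookup (dT z (full - {i, j})) 0 =
    (if cov i j then alt i (full - {i, j}) * lookup (z (full - {j})) 0 else 0) +
    (if cov j i then alt j (full - {i, j}) * lookup (z (full - {i})) 0 else 0)"
proof -
  have "full - (full - {i, j}) = {i, j}" "insert i (full - {i, j}) = full - {j}"
    "insert j (full - {i, j}) = full - {i}" "full - {j, i} = full - {i, j}" using assms by auto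
  then show ?thesis using assms(3) by (simp add: lookup_dT_zero cov_def)
qed

lemma face_remove2:
  assumes "s \<in> faces (n - 2)" "2 \<le> n"
  obtains i j where "i < n" "j < n" "i \<noteq> j" "s = full - {i, j}"
proof -
  have "card (full - s) = 2"
    using facesD[OF assms(1)] assms(2) by (simp add: card_Diff_subset)
  then obtain i j where ij: "full - s = {i, j}" "i \<noteq> j" by (auto simp: card_2_iff)
  then have "s = full - {i, j}" "i < n" "j < n" using facesD(1)[OF assms(1)] by auto
  with ij(2) that show ?thesis by blast
qed

lemma remove_face: "i < n \<Longrightarrow> full - {i} \<in> faces (Suc (n - 2))" if "2 \<le> n"
  using that by (auto simp: faces_def card_Diff_subset)

lemma alt_pair:
  assumes "i < n" "j < n" "i \<noteq> j"
  shows "alt i (full - {i, j}) * alt j (full - {j}) = - (alt j (full - {i, j}) * alt i (full - {i}))"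
proof -
  have "insert i (full - {i, j}) = full - {j}" "insert j (full - {i, j}) = full - {i}"
    using assms by auto
  then show ?thesis using alt_swap[of "full - {i, j}" i j] assms(3) by simp
qed

lemma short_resolution_cov:
  fixes P :: "nat \<Rightarrow> (('v, 'k::field) mpoly, 'p) module"
  assumes n: "2 \<le> n" and res: "projective_resolution (mpoly_ring V) M (n - 2) P d a"
    and e: "e < n" "\<not> cov e e"
  shows "\<exists>j<n. j \<noteq> e \<and> cov j e"
proof (rule ccontr)
  assume neg: "\<not> (\<exists>j<n. j \<noteq> e \<and> cov j e)"
  define z :: "nat set \<Rightarrow> ('v, 'k) mpoly" where "z s = (if s = full - {e} then 1 else 0)" for s
  have "lookup (dT z s) 0 = 0" if s: "s \<in> faces (n - 2)" for s
  proof -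
    obtain i j where ij: "i < n" "j < n" "i \<noteq> j" "s = full - {i, j}"
      using face_remove2[OF s n] by blast
    show ?thesis
      using neg ij unfolding ij(4) lookup_dT_full_remove2[OF ij(1-3)]
      by (auto simp: z_def full_remove_inject)
  qed
  moreover have "z \<in> carrier (T (Suc (n - 2)))"
    using remove_face[OF n e(1)] by (auto simp: carrier_T z_def)
  ultimately obtain w where "lookup (z (full - {e})) 0 = lookup (dT w (full - {e})) 0"
    using short_resolution_boundary[OF res, of z] by blast
  then show False using e by (simp add: z_def lookup_dT_full_remove)
qed

lemma short_resolution_connected:
  fixes P :: "nat \<Rightarrow> (('v, 'k::field) mpoly, 'p) module"
  assumes n: "2 \<le> n" and res: "projective_resolution (mpoly_ring V) M (n - 2) P d a"
    and U: "B \<subseteq> {i. i < n \<and> cov i i}" "b \<in> B" "c \<notin> B" "c < n" "cov c c"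
  shows "\<exists>b\<in>B. \<exists>c. c < n \<and> c \<notin> B \<and> cov c b"
proof (rule ccontr)
  assume neg: "\<not> (\<exists>b\<in>B. \<exists>c. c < n \<and> c \<notin> B \<and> cov c b)"
  define z :: "nat set \<Rightarrow> ('v, 'k) mpoly" where
    "z s = (\<Sum>i<n. if i \<in> B \<and> s = full - {i} then alt i (full - {i}) else 0)" for s
  have z: "z (full - {i}) = (if i \<in> B then alt i (full - {i}) else 0)" if "i < n" for i
  proof -
    have "z (full - {i}) = (\<Sum>j<n. if j = i then (if i \<in> B then alt i (full - {i}) else 0) else 0)"
      unfolding z_def using that by (intro sum.cong) (auto simp: full_remove_inject)
    then show ?thesis using that by simp
  qed
  have alt0: "lookup (alt i t :: ('v, 'k) mpoly) 0 = alt i t" for i t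
    using lookup_alt_mult[of i t 1 0] by simp
  have "lookup (dT z s) 0 = 0" if s: "s \<in> faces (n - 2)" for s
  proof -
    obtain i j where ij: "i < n" "j < n" "i \<noteq> j" "s = full - {i, j}"
      using face_remove2[OF s n] by blast
    have eq: "lookup (dT z s) 0 =
      (if cov i j \<and> j \<in> B then alt i (full - {i, j}) * alt j (full - {j}) else 0) +
      (if cov j i \<and> i \<in> B then alt j (full - {i, j}) * alt i (full - {i}) else 0)"
      unfolding ij(4) lookup_dT_full_remove2[OF ij(1-3)] using ij by (auto simp: z alt0)
    show ?thesis
    proof (cases "i \<in> B \<and> j \<in> B")
      case True
      then have "cov i j \<longleftrightarrow> cov j i" using cov_sym ij U(1) by blast
      then show ?thesis unfolding eq using True alt_pair[OF ij(1-3), where ?'a = 'k] by auto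
    next
      case False
      then show ?thesis unfolding eq using neg ij by auto
    qed
  qed
  moreover have "z \<in> carrier (T (Suc (n - 2)))"
    unfolding carrier_T
  proof (intro conjI allI impI)
    show "mpoly_vars (z s) \<subseteq> V" for s unfolding z_def by (intro mpoly_vars_sum) auto
    show "z s = 0" if "s \<notin> faces (Suc (n - 2))" for s
      unfolding z_def using that remove_face[OF n] by (intro sum.neutral) auto
  qed
  ultimately obtain w where w: "\<And>s. lookup (z s) 0 = lookup (dT w s) 0"
    using short_resolution_boundary[OF res, of z] by blast
  have "alt b (full - {b}) = (alt b (full - {b}) * lookup (w full) 0 :: 'k)"
    using w[of "full - {b}"] U by (auto simp: z lookup_dT_full_remove alt0)
  moreover have "alt c (full - {c}) * lookup (w full) 0 = (0 :: 'k)"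
    using w[of "full - {c}"] U by (auto simp: z lookup_dT_full_remove)
  ultimately show False by simp
qed

end

text \<open>In the top degrees the Taylor complex is the cochain complex of a simplex on the generators.
  A spanning tree of the generators along which the coverings hold cancels the two top degrees against
  its edges in degree \<open>n - 2\<close>.\<close>

locale covering_tree = taylor n A V for n and A :: "nat \<Rightarrow> 'v set" and V +
  fixes p :: "nat \<Rightarrow> nat" and r :: nat
  assumes n: "3 \<le> n" and p_less: "i < n \<Longrightarrow> p i < n" and r: "r < n" "p r = r"
    and depth: "i < n \<Longrightarrow> p (p i) = r" and p_neq: "i < n \<Longrightarrow> i \<noteq> r \<Longrightarrow> p i \<noteq> i"
    and cov_p: "i < n \<Longrightarrow> cov (p i) i"
begin

definition edge :: "nat \<Rightarrow> nat set"
  where "edge i = full - {i, p i}"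

definition cells :: "nat set set"
  where "cells = faces (n - 2) - edge ` ({..<n} - {r})"

lemma n2: "2 \<le> n" "n - 2 = Suc (n - 3)" using n by auto

lemma T_cells: "f \<in> carrier (free_module (mpoly_ring V) cells) \<longleftrightarrow>
    f \<in> carrier (T (n - 2)) \<and> (\<forall>i<n. i \<noteq> r \<longrightarrow> f (edge i) = 0)"
proof -
  have "finite {s. f s \<noteq> 0}" if "\<forall>s. s \<notin> cells \<longrightarrow> f s = 0"
    by (rule finite_subset[OF _ finite_faces[of "n - 2"]]) (use that in \<open>auto simp: cells_def\<close>)
  then show ?thesis
    unfolding carrier_T by (auto simp: carrier_free_module carrier_mpoly_ring cells_def)
qed

lemma co_dT_remove2:
  assumes "i < n" "j < n" "i \<noteq> j"
  shows "co (dT y) (full - {i, j}) u = alt i (full - {i, j}) * alt j (full - {j}) *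
    (alt j (full - {j}) * co y (full - {j}) u - alt i (full - {i}) * co y (full - {i}) u)"
proof -
  have "full - (full - {i, j}) = {i, j}" "insert i (full - {i, j}) = full - {j}"
    "insert j (full - {i, j}) = full - {i}" using assms by auto
  then have 1: "co (dT y) (full - {i, j}) u =
      alt i (full - {i, j}) * co y (full - {j}) u + alt j (full - {i, j}) * co y (full - {i}) u"
    using assms(3) co_dT[of "full - {i, j}" y u] by auto
  have "alt i (full - {i, j}) * alt j (full - {j}) * (alt j (full - {j}) * co y (full - {j}) u) =
      alt i (full - {i, j}) * (alt j (full - {j}) * alt j (full - {j})) * co y (full - {j}) u"
    by (simp only: mult.assoc)
  moreover have "alt i (full - {i, j}) * alt j (full - {j}) * (alt i (full - {i}) * co y (full - {i}) u) =
      - (alt j (full - {i, j}) * (alt i (full - {i}) * alt i (full - {i})) * co y (full - {i}) u)"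
    unfolding alt_pair[OF assms] by (simp only: mult.assoc minus_mult_left)
  ultimately show ?thesis unfolding 1 right_diff_distrib by simp
qed

lemma dT_kernel_cells:
  fixes f :: "nat set \<Rightarrow> ('v, 'k::field) mpoly"
  assumes f: "f \<in> carrier (free_module (mpoly_ring V) cells)" "dT f = (\<lambda>_. 0)"
  shows "f = (\<lambda>_. 0)"
proof
  fix s
  have fT: "f \<in> carrier (T (n - 2))" and fe: "\<And>i. i < n \<Longrightarrow> i \<noteq> r \<Longrightarrow> f (edge i) = 0"
    using f(1) by (auto simp: T_cells)
  obtain y where y: "y \<in> carrier (T (Suc (n - 2)))" "f = dT y"
    using exact[of "n - 3", where ?'k = 'k] fT f(2) unfolding n2(2)[symmetric] by blast
  show "f s = 0"
  proof (cases "s \<in> faces (n - 2)")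
    case True
    obtain i j where ij: "i < n" "j < n" "i \<noteq> j" "s = full - {i, j}"
      using face_remove2[OF True n2(1)] by blast
    have "co f s u = co (\<lambda>_. 0) s u" for u
    proof -
      define Y where "Y i = alt i (full - {i}) * co y (full - {i}) u" for i
      have step: "Y (p i) = Y i" if "i < n" for i
      proof (cases "i = r")
        case False
        have "co f (edge i) u = 0" using fe[OF that False] by (simp add: co_def)
        then show ?thesis
          using co_dT_remove2[of i "p i" y u] that p_less[OF that] p_neq[OF that False]
          by (simp add: y(2) edge_def Y_def)
      qed (simp add: r)
      have const: "Y i = Y r" if "i < n" for i
        using step[OF that] step[OF p_less[OF that]] depth[OF that] by simp
      have "Y j - Y i = 0" using const[OF ij(1)] const[OF ij(2)] by simp
      then show ?thesis
        unfolding y(2) ij(4) co_dT_remove2[OF ij(1-3)] Y_def[symmetric] by simp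
    qed
    then show ?thesis using co_eqI[of f s "\<lambda>_. 0"] by simp
  next
    case False
    then show ?thesis using fT by (simp add: carrier_T)
  qed
qed

lemma L_edge:
  assumes "i < n"
  shows "L (edge i) = L (full - {i})"
proof (cases "p i = i")
  case False
  have e: "edge i = full - {i} - {p i}" by (auto simp: edge_def)
  have "A (p i) \<subseteq> L (edge i)" using cov_p[OF assms] by (simp add: cov_def edge_def insert_commute)
  then show ?thesis
    using L_remove[of "p i" "full - {i}"] p_less[OF assms] False unfolding e by simp
qed (simp add: edge_def)

lemma L_p_edge: "i < n \<Longrightarrow> L (edge (p i)) = L full"
  using L_edge[OF p_less] L_remove[of "p i" full] cov_mono[OF cov_p[of i]] p_less[of i]
  by (simp add: cov_def)

lemma co_lift:
  assumes "finite t" "finite s" "L s \<subseteq> L t" "y s = monom (ind (L t - L s)) * f t"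
  shows "co y s u = co f t u"
proof -
  have ind: "ind (L t) = ind (L s) + ind (L t - L s)"
    using ind_Un_disjoint[of "L s" "L t - L s"] assms(1-3) finite_L by (simp add: Un_absorb1)
  show ?thesis
  proof (cases "ind (L s) \<preceq> u")
    case True
    then show ?thesis
      using assms(4) by (simp add: co_def ind exp_le_sum_iff lookup_monom_mult diff_diff_eq)
  next
    case False
    then have "\<not> ind (L t) \<preceq> u"
      unfolding ind using exp_le_trans exp_le_add(1) by blast
    then show ?thesis using False by (simp add: co_def)
  qed
qed

lemma edges_fill:
  fixes f :: "nat set \<Rightarrow> ('v, 'k::field) mpoly"
  assumes f: "f \<in> carrier (T (n - 2))"
  shows "\<exists>y\<in>carrier (T (Suc (n - 2))). \<forall>i<n. i \<noteq> r \<longrightarrow> dT y (edge i) = f (edge i)"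
proof -
  define \<kappa> :: "nat \<Rightarrow> ('v, 'k) mpoly" where "\<kappa> i = alt i (edge i) * alt (p i) (full - {p i})" for i
  define \<kappa>' :: "nat \<Rightarrow> 'k" where "\<kappa>' i = alt i (edge i) * alt (p i) (full - {p i})" for i
  define q where "q t i = monom (ind (L t - L (full - {i}))) * f t" for t i
  define Q where "Q i = alt i (full - {i}) * (- (\<kappa> i * q (edge i) i) - \<kappa> (p i) * q (edge (p i)) i)" for i
  define y where "y s = (\<Sum>i<n. if s = full - {i} then Q i else 0)" for s
  have fr: "f (edge r) = 0"
  proof -
    have "edge r = full - {r}" by (simp add: edge_def r)
    then have "card (edge r) = n - 1" using r by (simp add: card_Diff_subset)
    then have "edge r \<notin> faces (n - 2)" using n by (auto simp: faces_def)
    then show ?thesis using f by (simp add: carrier_T)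
  qed
  have y: "y (full - {i}) = Q i" if "i < n" for i
  proof -
    have "y (full - {i}) = (\<Sum>j<n. if j = i then Q i else 0)"
      unfolding y_def using that by (intro sum.cong) (auto simp: full_remove_inject)
    then show ?thesis using that by simp
  qed
  have yT: "y \<in> carrier (T (Suc (n - 2)))"
    unfolding carrier_T
  proof (intro conjI allI impI)
    have "mpoly_vars (f s) \<subseteq> V" for s using f by (simp add: carrier_T)
    moreover have "mpoly_vars (monom (ind (L t - L s)) :: ('v, 'k) mpoly) \<subseteq> V" for t s
      using keys_ind_subset[of "L t - L s"] L_subset[of t] by auto
    ultimately have q: "mpoly_vars (q t i) \<subseteq> V" for t i
      unfolding q_def by (intro mpoly_vars_mult)
    have "mpoly_vars (\<kappa> i) \<subseteq> V" for i
      unfolding \<kappa>_def by (intro mpoly_vars_mult) simp_all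
    then have "mpoly_vars (Q i) \<subseteq> V" for i
      using q unfolding Q_def by (simp add: mpoly_vars_mult mpoly_vars_diff)
    then show "mpoly_vars (y s) \<subseteq> V" for s unfolding y_def by (intro mpoly_vars_sum) auto
    show "y s = 0" if "s \<notin> faces (Suc (n - 2))" for s
      unfolding y_def using that remove_face[OF n2(1)] by (intro sum.neutral) auto
  qed
  have lookup_\<kappa>: "lookup (\<kappa> i * g) u = \<kappa>' i * lookup g u" for i g u
    by (simp add: \<kappa>_def \<kappa>'_def lookup_alt_mult mult.assoc)
  have co_q: "co (\<lambda>_. q t i) (full - {i}) u = co f t u" if "L (full - {i}) \<subseteq> L t" "finite t" for t i u
    by (rule co_lift[OF that(2) _ that(1)]) (simp_all add: q_def)
  have fin: "finite (edge i)" for i by (simp add: edge_def)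
  have co_y: "alt i (full - {i}) * co y (full - {i}) u = - (\<kappa>' i * co f (edge i) u) - \<kappa>' (p i) * co f (edge (p i)) u"
    if "i < n" for i u
  proof -
    have "co y (full - {i}) u = alt i (full - {i}) * (- (\<kappa>' i * co (\<lambda>_. q (edge i) i) (full - {i}) u)
        - \<kappa>' (p i) * co (\<lambda>_. q (edge (p i)) i) (full - {i}) u)"
      by (simp add: co_def y[OF that] Q_def lookup_alt_mult lookup_minus lookup_\<kappa>)
    moreover have "co (\<lambda>_. q (edge i) i) (full - {i}) u = co f (edge i) u"
      by (rule co_q) (simp_all add: L_edge[OF that] fin)
    moreover have "co (\<lambda>_. q (edge (p i)) i) (full - {i}) u = co f (edge (p i)) u"
      by (rule co_q) (simp_all add: L_p_edge[OF that] fin L_mono)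
    ultimately show ?thesis by (simp add: mult.assoc[symmetric])
  qed
  have "dT y (edge i) = f (edge i)" if i: "i < n" "i \<noteq> r" for i
  proof (rule co_eqI)
    fix u
    have pi: "p i < n" "i \<noteq> p i" using p_less[OF i(1)] p_neq[OF i] by auto
    have "co (dT y) (edge i) u = \<kappa>' i *
        (alt (p i) (full - {p i}) * co y (full - {p i}) u - alt i (full - {i}) * co y (full - {i}) u)"
      unfolding edge_def co_dT_remove2[OF i(1) pi] \<kappa>'_def ..
    also have "\<dots> = \<kappa>' i * (\<kappa>' i * co f (edge i) u - \<kappa>' r * co f (edge r) u)"
      unfolding co_y[OF i(1)] co_y[OF pi(1)] depth[OF i(1)] by simp
    also have "co f (edge r) u = 0" by (simp add: co_def fr)
    also have "\<kappa>' i * (\<kappa>' i * co f (edge i) u - \<kappa>' r * 0) = co f (edge i) u"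
    proof -
      have "\<kappa>' i * \<kappa>' i = (alt i (edge i) * alt i (edge i)) * (alt (p i) (full - {p i}) * alt (p i) (full - {p i}))"
        unfolding \<kappa>'_def by (simp only: mult_ac)
      then have "\<kappa>' i * \<kappa>' i = 1" by simp
      then show ?thesis by (simp add: mult.assoc[symmetric])
    qed
    finally show "co (dT y) (edge i) u = co f (edge i) u" .
  qed
  then show ?thesis using yT by blast
qed

lemma dT_cells_image:
  "dT ` carrier (free_module (mpoly_ring V) cells :: (('v, 'k::field) mpoly, _) module) = dT ` carrier (T (n - 2))"
proof
  show "dT ` carrier (free_module (mpoly_ring V) cells :: (('v, 'k) mpoly, _) module) \<subseteq> dT ` carrier (T (n - 2))"
    using T_cells by blast
  show "dT ` carrier (T (n - 2)) \<subseteq> dT ` carrier (free_module (mpoly_ring V) cells :: (('v, 'k) mpoly, _) module)"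
  proof
    fix x :: "nat set \<Rightarrow> ('v, 'k) mpoly"
    assume "x \<in> dT ` carrier (T (n - 2))"
    then obtain f where f: "f \<in> carrier (T (n - 2))" "x = dT f" by blast
    obtain y where y: "y \<in> carrier (T (Suc (n - 2)))" "\<And>i. i < n \<Longrightarrow> i \<noteq> r \<Longrightarrow> dT y (edge i) = f (edge i)"
      using edges_fill[OF f(1)] by blast
    define g where "g = (\<lambda>s. f s - dT y s)"
    have "dT y \<in> carrier (T (n - 2))" using y(1) by (rule dT_closed)
    then have g: "g \<in> carrier (free_module (mpoly_ring V) cells)"
      using f(1) y(2) unfolding T_cells g_def carrier_T by (simp add: mpoly_vars_diff)
    have "dT (dT y) = (\<lambda>_. 0)" using y(1) dT_dT[of y "n - 3"] n2(2) by simp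
    then have "dT g s = dT f s" for s
      unfolding g_def dT_diff by simp
    then have "dT g = x" using f(2) by auto
    then show "x \<in> dT ` carrier (free_module (mpoly_ring V) cells)" using imageI[OF g, of dT] by simp
  qed
qed

lemma resolution_exists:
  "\<exists>(P :: nat \<Rightarrow> (('v, 'k::field) mpoly, nat \<Rightarrow> ('v, 'k) mpoly) module) d a.
    projective_resolution (mpoly_ring V) M (n - 2) P d a"
proof -
  let ?R = "mpoly_ring V :: ('v, 'k) mpoly ring"
  let ?M = "M :: (('v, 'k) mpoly, _) module"
  define B where "B i = (if i < n - 2 then faces i else cells)" for i
  have carrier_B: "carrier (free_module ?R (B i)) \<subseteq> carrier (T i)" if "i \<le> n - 2" for i
    using that T_cells by (cases "i = n - 2") (auto simp: B_def)
  have image_B: "dT ` carrier (free_module ?R (B i)) = dT ` carrier (T i)" if "i \<le> n - 2" for i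
    using that dT_cells_image[where ?'k = 'k] by (cases "i = n - 2") (simp_all add: B_def)
  have B: "B i = faces i" if "i < n - 2" for i using that by (simp add: B_def)
  show ?thesis
  proof (rule free_resolution_transport[of ?R ?M "n - 2" set_encode B aT "\<lambda>_. dT"])
    show "inj_on set_encode (B i)" if "i \<le> n - 2" for i
    proof (rule inj_on_subset[OF inj_on_set_encode])
      show "B i \<subseteq> Collect finite" using facesD(3) by (auto simp: B_def cells_def)
    qed
    show "aT \<in> module_hom ?R (free_module ?R (B 0)) ?M" "aT ` carrier (free_module ?R (B 0)) = carrier ?M"
      using aT_hom aT_surj B[of 0] n by auto
    show "dT \<in> module_hom ?R (free_module ?R (B (Suc i))) (free_module ?R (B i))" if "i < n - 2" for i
    proof (rule module_homI)
      fix f g :: "nat set \<Rightarrow> ('v, 'k) mpoly" and c :: "('v, 'k) mpoly"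
      assume f: "f \<in> carrier (free_module ?R (B (Suc i)))"
      then have f': "f \<in> carrier (T (Suc i))" using carrier_B[of "Suc i"] that by auto
      show "dT f \<in> carrier (free_module ?R (B i))" using module_homD(1)[OF dT_hom f'] B[OF that] by simp
      show "dT (c \<odot>\<^bsub>free_module ?R (B (Suc i))\<^esub> f) = c \<odot>\<^bsub>free_module ?R (B i)\<^esub> dT f" if "c \<in> carrier ?R"
        using module_homD(3)[OF dT_hom that f'] by simp
      assume "g \<in> carrier (free_module ?R (B (Suc i)))"
      then have g': "g \<in> carrier (T (Suc i))" using carrier_B[of "Suc i"] \<open>i < n - 2\<close> by auto
      show "dT (f \<oplus>\<^bsub>free_module ?R (B (Suc i))\<^esub> g) = dT f \<oplus>\<^bsub>free_module ?R (B i)\<^esub> dT g"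
        using module_homD(2)[OF dT_hom f' g'] by simp
    qed
    show "dT ` carrier (free_module ?R (B (Suc 0))) = {x \<in> carrier (free_module ?R (B 0)). aT x = \<zero>\<^bsub>?M\<^esub>}"
      using image_B[of "Suc 0"] B[of 0] n exact_0[where ?'k = 'k] aT_kernel[where ?'k = 'k] by simp
    show "dT ` carrier (free_module ?R (B (Suc (Suc i)))) =
        {x \<in> carrier (free_module ?R (B (Suc i))). dT x = \<zero>\<^bsub>free_module ?R (B i)\<^esub>}" if "Suc i < n - 2" for i
      using image_B[of "Suc (Suc i)"] B[of "Suc i"] that exact[of i] by simp
    show "inj_on dT (carrier (free_module ?R (B (n - 2))))"
    proof (rule inj_onI)
      fix f g :: "nat set \<Rightarrow> ('v, 'k) mpoly"
      assume fg: "f \<in> carrier (free_module ?R (B (n - 2)))" "g \<in> carrier (free_module ?R (B (n - 2)))" "dT f = dT g"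
      have "(\<lambda>s. f s - g s) \<in> carrier (free_module ?R cells)"
        using fg(1,2) unfolding B_def by (simp add: T_cells carrier_T mpoly_vars_diff)
      moreover have "dT (\<lambda>s. f s - g s) = (\<lambda>_. 0)"
      proof
        fix s
        show "dT (\<lambda>s. f s - g s) s = 0" using fg(3) by (simp add: dT_diff)
      qed
      ultimately have "(\<lambda>s. f s - g s) = (\<lambda>_. 0)" by (rule dT_kernel_cells)
      then show "f = g" by (simp add: fun_eq_iff)
    qed
  qed (use n in \<open>auto intro: cring_mpoly_ring module_M\<close>)
qed

end

section \<open>Height\<close>

lemma prime_contains_Var_of_monom:
  fixes P :: "('v, 'k::field) mpoly set"
  assumes P: "primeideal P (mpoly_ring V)" and "finite A" "A \<subseteq> V" "monom (ind A) \<in> P"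
  shows "\<exists>x\<in>A. Var x \<in> P"
  using assms(2-)
proof (induction A rule: finite_induct)
  case empty
  interpret primeideal P "mpoly_ring V" by fact
  have "1 \<in> P" using empty by simp
  then have "carrier (mpoly_ring V) = P" using one_imp_carrier by simp
  then show ?case using I_notcarr by simp
next
  case (insert x A)
  interpret primeideal P "mpoly_ring V" by fact
  have "monom (ind (insert x A)) = (Var x * monom (ind A) :: ('v, 'k) mpoly)"
    using insert.hyps by (simp add: sqf_eq_monom[symmetric])
  moreover have "Var x \<in> carrier (mpoly_ring V :: ('v, 'k) mpoly ring)"
      "monom (ind A) \<in> carrier (mpoly_ring V :: ('v, 'k) mpoly ring)"
    using insert by (auto simp: carrier_mpoly_ring Var_def mpoly_vars_def split: if_splits)
  ultimately have "Var x \<in> P \<or> monom (ind A) \<in> P"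
    using I_prime[of "Var x" "monom (ind A)"] insert.prems by simp
  then show ?case using insert by auto
qed

lemma prime_mult:
  fixes P :: "('v, 'k::field) mpoly set"
  assumes "primeideal P (mpoly_ring V)" "mpoly_vars a \<subseteq> V" "mpoly_vars b \<subseteq> V" "a * b \<in> P"
  shows "a \<in> P \<or> b \<in> P"
  using primeideal.I_prime[OF assms(1), of a b] assms(2-) by (simp add: carrier_mpoly_ring)

lemma prime_power:
  fixes P :: "('v, 'k::field) mpoly set"
  assumes P: "primeideal P (mpoly_ring V)" "mpoly_vars a \<subseteq> V" "a ^ k \<in> P"
  shows "a \<in> P"
  using assms(3)
proof (induction k)
  case 0
  interpret primeideal P "mpoly_ring V" by fact
  have "carrier (mpoly_ring V) = P" using 0 one_imp_carrier by simp
  then show ?case using I_notcarr by simp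
next
  case (Suc k)
  then show ?case using prime_mult[OF P(1,2) mpoly_vars_power[OF P(2)], of k] by auto
qed

definition vars_ideal :: "nat set \<Rightarrow> (nat, 'k::field) mpoly set"
  where "vars_ideal X = {p. mpoly_vars p \<subseteq> {1..} \<and> (\<forall>e\<in>keys p. keys e \<inter> X \<noteq> {})}"

lemma vars_ideal_eq: "vars_ideal X = mon_ideal {1..} ((\<lambda>x. single x 1) ` X)"
proof -
  have "keys e \<inter> X \<noteq> {} \<longleftrightarrow> (\<exists>g\<in>(\<lambda>x. single x 1) ` X. g \<preceq> e)" for e :: "nat \<Rightarrow>\<^sub>0 nat"
  proof -
    have "single x (1 :: nat) \<preceq> e \<longleftrightarrow> x \<in> keys e" for x
      by (auto simp: exp_le_def lookup_single in_keys_iff when_def Suc_le_eq)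
    then show ?thesis by auto
  qed
  then show ?thesis by (simp add: vars_ideal_def mon_ideal_def)
qed

lemma ideal_vars_ideal: "ideal (vars_ideal X) S_inf"
  unfolding vars_ideal_eq S_inf_def by (rule ideal_mon_ideal)

lemma Var_eq_monom: "Var x = monom (single x 1)"
  by (simp add: Var_def monom_def)

lemma Var_power: "Var x ^ k = monom (single x k)"
  by (induction k) (simp_all add: Var_eq_monom flip: monom_mult single_add)

lemma mpoly_vars_Var [simp]: "mpoly_vars (Var x) = {x}"
  by (simp add: Var_eq_monom)

lemma Var_in_vars_ideal: "1 \<le> x \<Longrightarrow> Var x \<in> vars_ideal X \<longleftrightarrow> x \<in> X"
  by (simp add: vars_ideal_def Var_eq_monom)

lemma vars_ideal_subset:
  assumes "ideal Q S_inf" "\<And>x. x \<in> X \<Longrightarrow> Var x \<in> Q"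
  shows "vars_ideal X \<subseteq> Q"
  unfolding vars_ideal_eq
  using assms by (intro mon_ideal_minimal) (auto simp: S_inf_def Var_eq_monom)

lemma primeideal_vars_ideal: "primeideal (vars_ideal X :: (nat, 'k::field) mpoly set) S_inf"
proof -
  let ?P = "vars_ideal X :: (nat, 'k) mpoly set"
  define res :: "(nat, 'k) mpoly \<Rightarrow> (nat, 'k) mpoly" where
    "res p = (\<Sum>e\<in>keys p. if keys e \<inter> X = {} then single e (lookup p e) else 0)" for p
  have res: "lookup (res p) e = (if keys e \<inter> X = {} then lookup p e else 0)" for p e
  proof -
    have "lookup (res p) e = (\<Sum>d\<in>keys p. if d = e then (if keys e \<inter> X = {} then lookup p e else 0) else 0)"
      unfolding res_def lookup_sum by (intro sum.cong) (auto simp: lookup_single)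
    then show ?thesis by (simp add: in_keys_iff)
  qed
  have id: "ideal ?P (mpoly_ring {1..})"
    unfolding S_inf_def[symmetric] by (rule ideal_vars_ideal)
  have vars_res: "mpoly_vars (res p) \<subseteq> {1..}" if "mpoly_vars p \<subseteq> {1..}" for p
    using that unfolding mpoly_vars_subset_iff by (auto simp: in_keys_iff res split: if_splits)
  have diff: "p - res p \<in> ?P" if "mpoly_vars p \<subseteq> {1..}" for p
    using mpoly_vars_diff[OF that vars_res[OF that]]
    by (auto simp: vars_ideal_def in_keys_iff lookup_minus res)
  have in_P: "p \<in> ?P" if "mpoly_vars p \<subseteq> {1..}" "res p = 0" for p
    using diff[OF that(1)] that(2) by simp
  show ?thesis
    unfolding S_inf_def
  proof (rule primeidealI)
    show "ideal ?P (mpoly_ring {1..})" by (rule id)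
    show "cring (mpoly_ring {1..} :: (nat, 'k) mpoly ring)" by (rule cring_mpoly_ring)
    have "1 \<notin> ?P" by (simp add: vars_ideal_def)
    moreover have "1 \<in> carrier (mpoly_ring {1..} :: (nat, 'k) mpoly ring)"
      by (simp add: carrier_mpoly_ring)
    ultimately show "carrier (mpoly_ring {1..}) \<noteq> ?P" by blast
  next
    fix a b :: "(nat, 'k) mpoly"
    assume "a \<in> carrier (mpoly_ring {1..})" "b \<in> carrier (mpoly_ring {1..})"
      and "a \<otimes>\<^bsub>mpoly_ring {1..}\<^esub> b \<in> ?P"
    then have a: "mpoly_vars a \<subseteq> {1..}" and b: "mpoly_vars b \<subseteq> {1..}" and ab: "a * b \<in> ?P"
      by (simp_all only: carrier_mpoly_ring mpoly_ring_simps)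
    have "b * (a - res a) \<in> ?P" "res a * (b - res b) \<in> ?P"
      using ideal_mpoly_ringD(4)[OF id diff[OF a] b]
        ideal_mpoly_ringD(4)[OF id diff[OF b] vars_res[OF a]] .
    then have "a * b - b * (a - res a) - res a * (b - res b) \<in> ?P"
      using ab by (intro ideal_mpoly_ringD(5)[OF id])
    moreover have "a * b - b * (a - res a) - res a * (b - res b) = res a * res b"
      by (simp add: algebra_simps)
    ultimately have P: "res a * res b \<in> ?P" by simp
    have "res a * res b = 0"
    proof (rule ccontr)
      assume "res a * res b \<noteq> 0"
      then obtain u where u: "u \<in> keys (res a * res b)" by (meson ex_in_conv keys_eq_empty)
      then obtain d e where "d \<in> keys (res a)" "e \<in> keys (res b)" "u = d + e"
        by (rule keys_mult_obtain)
      then have "keys u \<inter> X = {}"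
        by (auto simp: exp_keys_add in_keys_iff[of _ "res _"] res split: if_splits)
      then show False using P u by (auto simp: vars_ideal_def)
    qed
    then have "res a = 0 \<or> res b = 0" by simp
    then show "a \<in> ?P \<or> b \<in> ?P" using in_P a b by blast
  qed
qed

lemma Var_factor:
  fixes p :: "('v, 'k::field) mpoly"
  assumes "p \<noteq> 0"
  obtains k p' e where "p = Var x ^ k * p'" "e \<in> keys p'" "lookup e x = 0"
    "\<And>e. e \<in> keys p' \<Longrightarrow> \<exists>d\<in>keys p. keys e \<subseteq> keys d"
proof -
  define k where "k = Min ((\<lambda>e. lookup e x) ` keys p)"
  have ne: "keys p \<noteq> {}" using assms by simp
  then have "k \<in> (\<lambda>e. lookup e x) ` keys p" unfolding k_def by (intro Min_in) auto
  then obtain d where d: "d \<in> keys p" "lookup d x = k" by auto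
  have le: "single x k \<preceq> e" if "e \<in> keys p" for e
    using that by (auto simp: exp_le_def lookup_single when_def k_def)
  define p' :: "('v, 'k) mpoly" where "p' = (\<Sum>e\<in>keys p. single (e - single x k) (lookup p e))"
  have "Var x ^ k * p' = (\<Sum>e\<in>keys p. single e (lookup p e))"
    unfolding p'_def Var_power sum_distrib_left
    by (intro sum.cong refl) (simp add: monom_def mult_single exp_diff_add le)
  then have p: "p = Var x ^ k * p'" by (simp only: mpoly_expand[symmetric])
  have "lookup p d = lookup p' (d - single x k)"
    using le[OF d(1)] by (subst p) (simp add: Var_power lookup_monom_mult)
  then have "d - single x k \<in> keys p'" using d(1) by (simp add: in_keys_iff)
  moreover have "lookup (d - single x k) x = 0" using d(2) by (simp add: lookup_minus)
  moreover have "\<exists>d\<in>keys p. keys e \<subseteq> keys d" if "e \<in> keys p'" for e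
  proof -
    have "e \<in> (\<Union>d\<in>keys p. keys (single (d - single x k) (lookup p d)))"
      by (rule subsetD[OF keys_sum]) (use that in \<open>simp add: p'_def\<close>)
    then obtain d where "d \<in> keys p" "e = d - single x k" by (auto split: if_splits)
    then show ?thesis using keys_exp_diff[of d "single x k"] by blast
  qed
  ultimately show thesis by (rule that[OF p])
qed

lemma prime_avoid:
  fixes Q :: "(nat, 'k::field) mpoly set"
  assumes Q: "primeideal Q S_inf" "Q \<subseteq> vars_ideal X" and x: "1 \<le> x" "Var x \<notin> Q"
    and B: "B \<in> Q" "\<And>e. e \<in> keys B \<Longrightarrow> keys e \<inter> X \<subseteq> {x}"
  shows "B = 0"
proof (rule ccontr)
  assume "B \<noteq> 0"
  then obtain k B' e where B': "B = Var x ^ k * B'" "e \<in> keys B'" "lookup e x = 0"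
    "\<And>e. e \<in> keys B' \<Longrightarrow> \<exists>d\<in>keys B. keys e \<subseteq> keys d"
    by (rule Var_factor[of B x]) blast
  have prime: "primeideal Q (mpoly_ring {1..})" using Q(1) by (simp add: S_inf_def)
  have "mpoly_vars B \<subseteq> {1..}" using B(1) Q(2) by (auto simp: vars_ideal_def)
  then have vars: "mpoly_vars B' \<subseteq> {1..}" unfolding mpoly_vars_subset_iff using B'(4) by blast
  have vx: "mpoly_vars (Var x :: (nat, 'k) mpoly) \<subseteq> {1..}" using x(1) by simp
  have "Var x ^ k \<in> Q \<or> B' \<in> Q"
    using prime_mult[OF prime mpoly_vars_power[OF vx] vars] B(1) B'(1) by blast
  then have "B' \<in> Q" using prime_power[OF prime vx] x(2) by blast
  then have "keys e \<inter> X \<noteq> {}" using Q(2) B'(2) by (auto simp: vars_ideal_def)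
  moreover obtain d where "d \<in> keys B" "keys e \<subseteq> keys d" using B'(2,4) by blast
  ultimately have "x \<in> keys e" using B(2) by blast
  then show False using B'(3) by (simp add: in_keys_iff)
qed

lemma power_sum_in_prime:
  fixes Q Q' :: "('v, 'k::field) mpoly set"
  assumes Q: "primeideal Q (mpoly_ring V)" "Q \<subseteq> Q'" and Q': "ideal Q' (mpoly_ring V)"
    and q: "q \<in> Q'" "q \<notin> Q"
  shows "\<lbrakk>\<And>j. j < N \<Longrightarrow> mpoly_vars (B j) \<subseteq> V; \<And>j. j < N \<Longrightarrow> B j \<in> Q' \<Longrightarrow> B j = 0;
    (\<Sum>j<N. B j * q ^ j) \<in> Q; j < N\<rbrakk> \<Longrightarrow> B j = 0"
proof (induction N arbitrary: B j)
  case (Suc N)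
  have qV: "mpoly_vars q \<subseteq> V" by (rule ideal_mpoly_ringD(1)[OF Q' q(1)])
  let ?S = "\<Sum>j<N. B (Suc j) * q ^ j"
  have eq: "(\<Sum>j<Suc N. B j * q ^ j) = B 0 + ?S * q"
    unfolding sum.lessThan_Suc_shift by (simp add: sum_distrib_left mult_ac)
  have SV: "mpoly_vars ?S \<subseteq> V"
    using Suc.prems(1) qV by (intro mpoly_vars_sum mpoly_vars_mult mpoly_vars_power) auto
  have total: "B 0 + ?S * q \<in> Q" using Suc.prems(3) unfolding eq .
  have "B 0 + ?S * q - ?S * q \<in> Q'"
    using total Q(2) ideal_mpoly_ringD(4)[OF Q' q(1) SV]
    by (intro ideal_mpoly_ringD(5)[OF Q']) auto
  then have B0: "B 0 = 0" using Suc.prems(2)[of 0] by simp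
  then have "?S * q \<in> Q" using total by simp
  then have S: "?S \<in> Q" using prime_mult[OF Q(1) SV qV] q(2) by blast
  have "B (Suc i) = 0" if "i < N" for i
    using Suc.IH[of "\<lambda>j. B (Suc j)" i] Suc.prems(1,2) S that by simp
  then show ?case using B0 Suc.prems(4) by (cases j) auto
qed simp

subsection \<open>Algebraic dependence\<close>

definition box :: "'v set \<Rightarrow> nat \<Rightarrow> ('v \<Rightarrow>\<^sub>0 nat) set"
  where "box W N = {e. keys e \<subseteq> W \<and> (\<forall>v. lookup e v < N)}"

lemma card_box:
  fixes W :: "'v set"
  assumes "finite W" "0 < N"
  shows "finite (box W N)" "card (box W N) = N ^ card W"
proof -
  define g :: "('v \<Rightarrow> nat) \<Rightarrow> 'v \<Rightarrow>\<^sub>0 nat" where "g f = (\<Sum>v\<in>W. single v (f v))" for f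
  have g: "lookup (g f) v = (if v \<in> W then f v else 0)" for f v
    using assms(1) by (simp add: g_def lookup_sum lookup_single when_def)
  have "inj_on g (W \<rightarrow>\<^sub>E {..<N})"
  proof (rule inj_onI)
    fix f f' assume f: "f \<in> W \<rightarrow>\<^sub>E {..<N}" "f' \<in> W \<rightarrow>\<^sub>E {..<N}" "g f = g f'"
    then have "f v = f' v" if "v \<in> W" for v using g[of f v] g[of f' v] that by simp
    then show "f = f'" using f by (metis PiE_ext)
  qed
  moreover have "g ` (W \<rightarrow>\<^sub>E {..<N}) = box W N"
  proof (intro equalityI subsetI)
    fix e assume "e \<in> g ` (W \<rightarrow>\<^sub>E {..<N})"
    then obtain f where "f \<in> W \<rightarrow>\<^sub>E {..<N}" "e = g f" by blast
    then show "e \<in> box W N" using assms(2) by (auto simp: box_def in_keys_iff g split: if_splits)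
  next
    fix e assume e: "e \<in> box W N"
    have "g (restrict (lookup e) W) = e"
      using e by (intro poly_mapping_eqI) (auto simp: g box_def in_keys_iff)
    moreover have "restrict (lookup e) W \<in> W \<rightarrow>\<^sub>E {..<N}" using e by (auto simp: box_def)
    ultimately show "e \<in> g ` (W \<rightarrow>\<^sub>E {..<N})" by (metis image_eqI)
  qed
  ultimately have "bij_betw g (W \<rightarrow>\<^sub>E {..<N}) (box W N)" by (simp add: bij_betw_def)
  then show "finite (box W N)" "card (box W N) = N ^ card W"
    using assms bij_betw_finite[of g "W \<rightarrow>\<^sub>E {..<N}" "box W N"] finite_PiE[of W "\<lambda>_. {..<N}"]
      bij_betw_same_card[of g "W \<rightarrow>\<^sub>E {..<N}" "box W N"] card_PiE[of W "\<lambda>_. {..<N}"]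
    by auto
qed

interpretation mpoly_vs: vector_space "\<lambda>(c :: 'k::field) (p :: ('v, 'k) mpoly). single 0 c * p"
  by unfold_locales
    (simp_all add: algebra_simps single_add mult_single flip: mult.assoc)

lemma (in vector_space) card_le_of_independent_family:
  assumes J: "finite J" and S: "finite S" and span: "\<And>j. j \<in> J \<Longrightarrow> v j \<in> span S"
    and indep: "\<And>c. (\<Sum>j\<in>J. scale (c j) (v j)) = 0 \<Longrightarrow> \<forall>j\<in>J. c j = 0"
  shows "card J \<le> card S"
proof -
  have inj: "inj_on v J"
  proof (rule inj_onI, rule ccontr)
    fix i j assume ij: "i \<in> J" "j \<in> J" "v i = v j" "i \<noteq> j"
    let ?c = "\<lambda>k. if k = i then 1 else if k = j then - 1 else 0 :: 'a"
    have "(\<Sum>k\<in>J. scale (?c k) (v k)) =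
        (\<Sum>k\<in>J. (if k = i then v i else 0) - (if k = j then v i else 0))"
      using ij by (intro sum.cong) auto
    also have "\<dots> = 0" using J ij by (simp add: sum_subtractf)
    finally have "\<forall>k\<in>J. ?c k = 0" by (rule indep)
    then show False using ij(1) by auto
  qed
  have "independent (v ` J)"
  proof (rule independent_if_scalars_zero)
    show "finite (v ` J)" using J by simp
    fix f x assume f: "(\<Sum>x\<in>v ` J. scale (f x) x) = 0" and x: "x \<in> v ` J"
    have "(\<Sum>j\<in>J. scale (f (v j)) (v j)) = 0"
      using f inj by (simp add: sum.reindex)
    then show "f x = 0" using indep[of "\<lambda>j. f (v j)"] x by blast
  qed
  then have "card (v ` J) \<le> card S"
    using independent_span_bound[OF S, of "v ` J"] span by blast
  then show ?thesis using inj by (simp add: card_image)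
qed

definition deg_le :: "nat \<Rightarrow> ('v, 'k::field) mpoly \<Rightarrow> bool"
  where "deg_le D p \<longleftrightarrow> (\<forall>e\<in>keys p. \<forall>v. lookup e v \<le> D)"

lemma deg_le_mult: "deg_le D p \<Longrightarrow> deg_le D' q \<Longrightarrow> deg_le (D + D') (p * q)"
  unfolding deg_le_def by (auto elim!: keys_mult_obtain simp: lookup_add add_mono)

lemma deg_le_power: "deg_le D p \<Longrightarrow> deg_le (k * D) (p ^ k)"
  by (induction k) (auto intro: deg_le_mult simp: deg_le_def[of 0])

lemma deg_le_exists: "\<exists>D. deg_le D p"
proof -
  let ?X = "(\<lambda>(e, v). lookup e v) ` (SIGMA e:keys p. keys e)"
  have fin: "finite ?X" by auto
  have "lookup e v \<le> Max (insert 0 ?X)" if "e \<in> keys p" for e v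
  proof (cases "v \<in> keys e")
    case True
    then have "lookup e v \<in> insert 0 ?X" using that by force
    then show ?thesis using fin by (intro Max_ge) auto
  qed (simp add: in_keys_iff)
  then show ?thesis by (auto simp: deg_le_def)
qed

lemma deg_le_mono: "deg_le D p \<Longrightarrow> D \<le> D' \<Longrightarrow> deg_le D' p"
  unfolding deg_le_def using order_trans by blast

lemma algebraic_dependence:
  fixes p q :: "('v, 'k::field) mpoly"
  assumes W: "finite W" "y \<in> W" and vars: "mpoly_vars p \<subseteq> W" "mpoly_vars q \<subseteq> W"
  obtains N and c :: "nat \<Rightarrow> nat \<Rightarrow> ('v \<Rightarrow>\<^sub>0 nat) \<Rightarrow> 'k" and k j e
  where "(\<Sum>k<N. (\<Sum>j<N. (\<Sum>e\<in>box (W - {y}) N. single e (c k j e)) * q ^ j) * p ^ k) = 0"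
    "k < N" "j < N" "e \<in> box (W - {y}) N" "c k j e \<noteq> 0"
proof -
  obtain D1 D2 where "deg_le D1 p" "deg_le D2 q" using deg_le_exists by metis
  then obtain D where D: "deg_le D p" "deg_le D q"
    using deg_le_mono[of D1 p "max D1 D2"] deg_le_mono[of D2 q "max D1 D2"] by auto
  define N where "N = Suc ((1 + 2 * D) ^ card W)"
  define B where "B = box (W - {y}) N"
  have B: "finite B" "card B = N ^ (card W - 1)"
    using card_box[of "W - {y}" N] W by (simp_all add: B_def N_def)
  define J where "J = {..<N} \<times> {..<N} \<times> B"
  define v where "v = (\<lambda>(k, j, e). monom e * q ^ j * p ^ k :: ('v, 'k) mpoly)"
  define S where "S = (monom ` box W ((1 + 2 * D) * N) :: ('v, 'k) mpoly set)"
  have cS: "finite (box W ((1 + 2 * D) * N))" "card (box W ((1 + 2 * D) * N)) = ((1 + 2 * D) * N) ^ card W"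
    using card_box[of W "(1 + 2 * D) * N"] W by (simp_all add: N_def)
  have S: "finite S" "card S \<le> ((1 + 2 * D) * N) ^ card W"
    unfolding S_def using cS card_image_le[OF cS(1), of monom] by auto
  have cw: "Suc (card W - 1) = card W" using W by (metis Suc_diff_1 card_gt_0_iff empty_iff)
  have cJ: "card J = N * N ^ card W"
    unfolding J_def using B(2) cw by (simp add: card_cartesian_product flip: power_Suc)
  have span: "v t \<in> mpoly_vs.span S" if J: "t \<in> J" for t
  proof -
    obtain k j e where t: "t = (k, j, e)" "k < N" "j < N" "e \<in> B" using J by (auto simp: J_def)
    have "lookup e v \<le> N - 1" for v
      using t(4) unfolding B_def box_def N_def by (simp add: less_Suc_eq_le)
    then have e: "deg_le (N - 1) (monom e :: ('v, 'k) mpoly)" by (simp add: deg_le_def)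
    have "deg_le (N - 1 + j * D + k * D) (v t)"
      unfolding t(1) v_def prod.case by (intro deg_le_mult deg_le_power D e)
    moreover have "N - 1 + j * D + k * D < (1 + 2 * D) * N"
    proof -
      have "j * D \<le> N * D" "k * D \<le> N * D" using t by (simp_all only: mult_le_mono1 less_imp_le)
      moreover have "N - 1 < N" by (simp add: N_def)
      moreover have "(1 + 2 * D) * N = N + N * D + N * D" by (simp add: algebra_simps)
      ultimately show ?thesis by linarith
    qed
    ultimately have d: "lookup u w < (1 + 2 * D) * N" if "u \<in> keys (v t)" for u w
      using that unfolding deg_le_def by (meson le_less_trans)
    have "keys e \<subseteq> W" using t(4) by (auto simp: B_def box_def)
    then have "mpoly_vars (v t) \<subseteq> W"
      unfolding t(1) v_def prod.case by (intro mpoly_vars_mult mpoly_vars_power vars) simp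
    then have k: "keys u \<subseteq> W" if "u \<in> keys (v t)" for u
      using that by (simp add: mpoly_vars_subset_iff)
    have "(\<Sum>u\<in>keys (v t). single 0 (lookup (v t) u) * monom u) \<in> mpoly_vs.span S"
      using d k by (intro mpoly_vs.span_sum mpoly_vs.span_scale mpoly_vs.span_base) (auto simp: S_def box_def)
    moreover have "(\<Sum>u\<in>keys (v t). single 0 (lookup (v t) u) * monom u) = v t"
      by (simp add: monom_def mult_single mpoly_expand[symmetric])
    ultimately show ?thesis by simp
  qed
  have "\<not> card J \<le> card S"
  proof
    assume "card J \<le> card S"
    then have "N * N ^ card W \<le> ((1 + 2 * D) * N) ^ card W"
      using S(2) unfolding cJ by (rule order_trans)
    then have "N * N ^ card W \<le> (1 + 2 * D) ^ card W * N ^ card W"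
      unfolding power_mult_distrib .
    moreover have "0 < N ^ card W" by (simp add: N_def)
    ultimately have "N \<le> (1 + 2 * D) ^ card W" unfolding mult_le_cancel2 by blast
    then show False by (simp add: N_def)
  qed
  then obtain c where c: "(\<Sum>t\<in>J. single 0 (c t) * v t) = 0" "\<not> (\<forall>t\<in>J. c t = 0)"
    using mpoly_vs.card_le_of_independent_family[of J S v] S(1) span B(1) by (auto simp: J_def)
  have "(\<Sum>t\<in>J. single 0 (c t) * v t) =
      (\<Sum>k<N. \<Sum>j<N. \<Sum>e\<in>B. single 0 (c (k, j, e)) * (monom e * q ^ j * p ^ k))"
    unfolding J_def v_def by (simp add: sum.cartesian_product case_prod_unfold)
  also have "\<dots> = (\<Sum>k<N. (\<Sum>j<N. (\<Sum>e\<in>B. single e (c (k, j, e))) * q ^ j) * p ^ k)"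
  proof -
    have "single 0 a * (monom e * x * y) = single e a * x * y" for a e and x y :: "('v, 'k) mpoly"
      by (simp add: monom_def mult_single flip: mult.assoc)
    then show ?thesis by (simp add: sum_distrib_right)
  qed
  finally have "(\<Sum>k<N. (\<Sum>j<N. (\<Sum>e\<in>B. single e (c (k, j, e))) * q ^ j) * p ^ k) = 0"
    using c(1) by simp
  moreover obtain k j e where "k < N" "j < N" "e \<in> B" "c (k, j, e) \<noteq> 0"
    using c(2) by (auto simp: J_def)
  ultimately show thesis
    using that[where N = N and c = "\<lambda>k j e. c (k, j, e)"] unfolding B_def by blast
qed

subsection \<open>Heights of ideals generated by variables\<close>

lemma prime_height_le:
  fixes R :: "('a, 'b) ring_scheme"
  assumes "\<And>Q. \<lbrakk>\<And>i. i \<le> Suc m \<Longrightarrow> primeideal (Q i) R; \<And>i. i \<le> m \<Longrightarrow> Q i \<subset> Q (Suc i);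
    Q (Suc m) = P\<rbrakk> \<Longrightarrow> False"
  shows "prime_height R P \<le> enat m"
  unfolding prime_height_def
proof (rule SUP_least)
  fix n
  assume "n \<in> {n. \<exists>Q. (\<forall>i\<le>n. primeideal (Q i) R) \<and> (\<forall>i<n. Q i \<subset> Q (Suc i)) \<and> Q n = P}"
  then obtain Q where Q: "\<forall>i\<le>n. primeideal (Q i) R" "\<forall>i<n. Q i \<subset> Q (Suc i)" "Q n = P" by blast
  have "n \<le> m"
  proof (rule ccontr)
    assume "\<not> n \<le> m"
    then have *: "n - Suc m + Suc m = n" by simp
    have a: "primeideal (Q (n - Suc m + i)) R" if "i \<le> Suc m" for i
    proof -
      have "n - Suc m + i \<le> n" using that * by linarith
      then show ?thesis using Q(1) by blast
    qed
    have b: "Q (n - Suc m + i) \<subset> Q (n - Suc m + Suc i)" if "i \<le> m" for i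
    proof -
      have "n - Suc m + i < n" using that * by linarith
      then show ?thesis using Q(2) by simp
    qed
    show False using assms[of "\<lambda>i. Q (n - Suc m + i)"] a b Q(3) * by metis
  qed
  then show "enat n \<le> enat m" by simp
qed

lemma prime_height_vars_ideal_1:
  assumes "1 \<le> x"
  shows "prime_height S_inf (vars_ideal {x} :: (nat, 'k::field) mpoly set) \<le> enat 1"
proof (rule prime_height_le)
  fix Q :: "nat \<Rightarrow> (nat, 'k) mpoly set"
  assume prime: "\<And>i. i \<le> Suc 1 \<Longrightarrow> primeideal (Q i) S_inf"
    and chain: "\<And>i. i \<le> 1 \<Longrightarrow> Q i \<subset> Q (Suc i)" and top: "Q (Suc 1) = vars_ideal {x}"
  have sub: "Q 0 \<subset> Q 1" "Q 1 \<subset> vars_ideal {x}" using chain[of 0] chain[of 1] top by auto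
  have id: "ideal (Q i) S_inf" if "i \<le> Suc 1" for i using prime[OF that] by (rule primeideal.axioms)
  have x: "Var x \<notin> Q 1" using vars_ideal_subset[OF id[of 1], of "{x}"] sub(2) by auto
  obtain p where p: "p \<in> Q 1" "p \<notin> Q 0" using sub(1) by blast
  have "p = 0"
    by (rule prime_avoid[OF prime[of 1] _ assms x p(1)]) (use sub(2) in auto)
  then show False using p(2) ideal_mpoly_ringD(2)[OF id[of 0, unfolded S_inf_def]] by simp
qed

lemma prime_height_vars_ideal_2:
  assumes "1 \<le> x" "1 \<le> y" "x \<noteq> y"
  shows "prime_height S_inf (vars_ideal {x, y} :: (nat, 'k::field) mpoly set) \<le> enat 2"
proof (rule prime_height_le)
  fix Q :: "nat \<Rightarrow> (nat, 'k) mpoly set"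
  assume prime: "\<And>i. i \<le> Suc 2 \<Longrightarrow> primeideal (Q i) S_inf"
    and chain: "\<And>i. i \<le> 2 \<Longrightarrow> Q i \<subset> Q (Suc i)" and top: "Q (Suc 2) = vars_ideal {x, y}"
  have sub: "Q 0 \<subset> Q 1" "Q 1 \<subset> Q 2" "Q 2 \<subset> vars_ideal {x, y}"
    using chain[of 0] chain[of 1] chain[of 2] top by (auto simp: numeral_2_eq_2)
  have prime': "primeideal (Q i) (mpoly_ring {1..})" if "i \<le> 3" for i
    using prime[of i] that by (simp add: S_inf_def)
  have id: "ideal (Q i) (mpoly_ring {1..})" if "i \<le> 3" for i
    using prime'[OF that] by (rule primeideal.axioms)
  obtain z y' where z: "{z, y'} = {x, y}" "z \<noteq> y'" "1 \<le> z" "1 \<le> y'" "Var z \<notin> Q 2"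
  proof -
    have "Var x \<notin> Q 2 \<or> Var y \<notin> Q 2"
      using vars_ideal_subset[of "Q 2" "{x, y}"] id[of 2] sub(3) by (auto simp: S_inf_def)
    then show thesis using that[of x y] that[of y x] assms by auto
  qed
  obtain p where p: "p \<in> Q 1" "p \<notin> Q 0" using sub(1) by blast
  obtain q where q: "q \<in> Q 2" "q \<notin> Q 1" using sub(2) by blast
  have pV: "mpoly_vars p \<subseteq> {1..}" and qV: "mpoly_vars q \<subseteq> {1..}"
    using ideal_mpoly_ringD(1)[OF id[of 1]] p ideal_mpoly_ringD(1)[OF id[of 2]] q by auto
  define W where "W = insert y' (mpoly_vars p \<union> mpoly_vars q)"
  have fin: "finite W" by (simp add: W_def mpoly_vars_def)
  have WV: "W \<subseteq> {1..}" using pV qV z(4) by (auto simp: W_def)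
  obtain N and c :: "nat \<Rightarrow> nat \<Rightarrow> (nat \<Rightarrow>\<^sub>0 nat) \<Rightarrow> 'k" and k j e where
    dep: "(\<Sum>k<N. (\<Sum>j<N. (\<Sum>e\<in>box (W - {y'}) N. single e (c k j e)) * q ^ j) * p ^ k) = 0"
    and kje: "k < N" "j < N" "e \<in> box (W - {y'}) N" "c k j e \<noteq> 0"
    by (rule algebraic_dependence[of W y' p q]) (use fin in \<open>auto simp: W_def\<close>)
  define b where "b k j = (\<Sum>e\<in>box (W - {y'}) N. single e (c k j e))" for k j
  define a where "a k = (\<Sum>j<N. b k j * q ^ j)" for k
  have finB: "finite (box (W - {y'}) N)" using card_box[of "W - {y'}" N] fin kje(1) by simp
  have lookup_b: "lookup (b k j) e = (if e \<in> box (W - {y'}) N then c k j e else 0)" for k j e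
    unfolding b_def lookup_sum lookup_single when_def using finB by simp
  have keys_b: "keys u \<subseteq> W - {y'}" if "u \<in> keys (b k j)" for u k j
    using that unfolding in_keys_iff lookup_b by (auto simp: box_def split: if_splits)
  have bV: "mpoly_vars (b k j) \<subseteq> {1..}" for k j
    unfolding mpoly_vars_subset_iff using keys_b WV by blast
  have aV: "mpoly_vars (a k) \<subseteq> {1..}" for k
    unfolding a_def using bV qV by (intro mpoly_vars_sum mpoly_vars_mult mpoly_vars_power) auto
  have b0: "b k j = 0" if "b k j \<in> Q 2" for k j
  proof (rule prime_avoid[OF prime[of 2] _ z(3,5) that])
    show "Q 2 \<subseteq> vars_ideal {x, y}" using sub(3) by blast
    show "keys u \<inter> {x, y} \<subseteq> {z}" if "u \<in> keys (b k j)" for u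
      using keys_b[OF that] z(1) by blast
  qed simp
  have step: "b k j = 0" if "a k \<in> Q 1" "j < N" for k j
  proof (rule power_sum_in_prime[OF prime'[of 1] _ id[of 2] q, where B = "b k" and N = N and j = j])
    show "(\<Sum>j<N. b k j * q ^ j) \<in> Q 1" using that(1) by (simp add: a_def)
  qed (use sub(2) bV b0 that(2) in auto)
  have a0: "a k = 0" if "a k \<in> Q 1" for k
    unfolding a_def using step[OF that] by simp
  have "a k = 0"
  proof (rule power_sum_in_prime[OF prime'[of 0] _ id[of 1] p, where B = a and N = N and j = k])
    show "(\<Sum>k<N. a k * p ^ k) \<in> Q 0"
      using dep ideal_mpoly_ringD(2)[OF id[of 0]] by (simp add: a_def b_def)
  qed (use sub(1) aV a0 kje(1) in auto)
  then have "a k \<in> Q 1" using ideal_mpoly_ringD(2)[OF id[of 1]] by simp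
  then have "b k j = 0" by (rule step[OF _ kje(2)])
  then show False using lookup_b[of k j e] kje(3,4) by simp
qed

lemma prime_height_ge_2:
  fixes P :: "(nat, 'k::field) mpoly set"
  assumes P: "primeideal P S_inf" and xy: "Var x \<in> P" "Var y \<in> P" "x \<noteq> y"
  shows "enat 2 \<le> prime_height S_inf P"
proof -
  have id: "ideal P S_inf" using P by (rule primeideal.axioms)
  have x1: "1 \<le> x" "1 \<le> y"
    using ideal_mpoly_ringD(1)[OF id[unfolded S_inf_def]] xy(1,2) by fastforce+
  define Q where "Q i = (if i = 0 then vars_ideal {} else if i = 1 then vars_ideal {x} else P)" for i :: nat
  have "Var x \<notin> vars_ideal {}" "Var x \<in> (vars_ideal {x} :: (nat, 'k) mpoly set)"
    "Var y \<notin> (vars_ideal {x} :: (nat, 'k) mpoly set)"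
    using x1 xy(3) by (simp_all add: Var_in_vars_ideal)
  moreover have "vars_ideal {} \<subseteq> (vars_ideal {x} :: (nat, 'k) mpoly set)"
    by (rule vars_ideal_subset[OF ideal_vars_ideal]) simp
  moreover have "vars_ideal {x} \<subseteq> P" by (rule vars_ideal_subset[OF id]) (use xy in simp)
  ultimately have "Q 0 \<subset> Q 1" "Q 1 \<subset> Q 2" using xy by (auto simp: Q_def)
  then have "Q i \<subset> Q (Suc i)" if "i = 0 \<or> i = 1" for i
    using that by (elim disjE) (simp_all add: numeral_2_eq_2)
  then have "\<forall>i<2. Q i \<subset> Q (Suc i)" by (simp add: less_2_cases_iff)
  moreover have "\<forall>i\<le>2. primeideal (Q i) S_inf"
    using P primeideal_vars_ideal by (auto simp: Q_def)
  moreover have "Q 2 = P" by (simp add: Q_def)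
  ultimately show ?thesis
    unfolding prime_height_def by (intro SUP_upper) blast
qed

lemma height_eq_2I:
  fixes E :: "nat set set"
  assumes E: "\<And>A. A \<in> E \<Longrightarrow> finite A \<and> A \<subseteq> {1..}" and common: "\<And>x. \<exists>A\<in>E. x \<notin> A"
    and cover: "1 \<le> x" "1 \<le> y" "x \<noteq> y" "\<And>A. A \<in> E \<Longrightarrow> x \<in> A \<or> y \<in> A"
  shows "height S_inf (mon_ideal {1..} (ind ` E) :: (nat, 'k::field) mpoly set) = 2"
proof -
  let ?I = "mon_ideal {1..} (ind ` E) :: (nat, 'k) mpoly set"
  have "enat 2 \<le> prime_height S_inf P" if P: "primeideal P S_inf" "?I \<subseteq> P" for P
  proof -
    have ex: "\<exists>x\<in>A. Var x \<in> P" if "A \<in> E" for A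
    proof (rule prime_contains_Var_of_monom[OF P(1)[unfolded S_inf_def]])
      show "finite A" "A \<subseteq> {1..}" using E[OF that] by auto
      have "monom (ind A) \<in> ?I" using E[OF that] that by (auto simp: monom_in_mon_ideal intro!: bexI[of _ A])
      then show "monom (ind A) \<in> P" using P(2) by blast
    qed
    obtain A where "A \<in> E" using common by blast
    then obtain v where v: "Var v \<in> P" using ex by blast
    obtain A' where A': "A' \<in> E" "v \<notin> A'" using common by blast
    then obtain w where "w \<in> A'" "Var w \<in> P" using ex by blast
    then show ?thesis using prime_height_ge_2[OF P(1) v, of w] A' by auto
  qed
  then have "enat 2 \<le> height S_inf ?I"
    unfolding height_def by (intro INF_greatest) auto
  moreover have "?I \<subseteq> vars_ideal {x, y}"
  proof (rule mon_ideal_minimal)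
    show "ideal (vars_ideal {x, y}) (mpoly_ring {1..})"
      using ideal_vars_ideal unfolding S_inf_def .
    have "monom (ind A) \<in> (vars_ideal {x, y} :: (nat, 'k) mpoly set)" if "A \<in> E" for A
      using E[OF that] cover(4)[OF that] by (auto simp: vars_ideal_def)
    then show "monom ` ind ` E \<subseteq> (vars_ideal {x, y} :: (nat, 'k) mpoly set)" by blast
  qed
  then have "height S_inf ?I \<le> prime_height S_inf (vars_ideal {x, y} :: (nat, 'k) mpoly set)"
    unfolding height_def by (intro INF_lower) (auto intro: primeideal_vars_ideal)
  then have "height S_inf ?I \<le> enat 2"
    using prime_height_vars_ideal_2[OF cover(1-3)] by (rule order_trans)
  ultimately have "height S_inf ?I = enat 2" by (rule antisym[rotated])
  then show ?thesis by (simp add: numeral_eq_enat)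
qed

lemma height_eq_2D:
  fixes E :: "nat set set"
  assumes E: "\<And>A. A \<in> E \<Longrightarrow> finite A \<and> A \<subseteq> {1..}" and x: "1 \<le> x"
    and height: "height S_inf (mon_ideal {1..} (ind ` E) :: (nat, 'k::field) mpoly set) = 2"
  shows "\<exists>A\<in>E. x \<notin> A"
proof (rule ccontr)
  assume "\<not> (\<exists>A\<in>E. x \<notin> A)"
  then have common: "x \<in> A" if "A \<in> E" for A using that by blast
  let ?I = "mon_ideal {1..} (ind ` E) :: (nat, 'k) mpoly set"
  have "?I \<subseteq> vars_ideal {x}"
  proof (rule mon_ideal_minimal)
    show "ideal (vars_ideal {x}) (mpoly_ring {1..})"
      using ideal_vars_ideal unfolding S_inf_def .
    show "monom ` ind ` E \<subseteq> vars_ideal {x}"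
      using E common by (auto simp: vars_ideal_def subset_iff)
  qed
  then have "height S_inf ?I \<le> prime_height S_inf (vars_ideal {x} :: (nat, 'k) mpoly set)"
    unfolding height_def by (intro INF_lower) (auto intro: primeideal_vars_ideal)
  then have "height S_inf ?I \<le> enat 1"
    using prime_height_vars_ideal_1[OF x] by (rule order_trans)
  then show False using height by (simp add: numeral_eq_enat)
qed

section \<open>Spanning trees on five generators\<close>

text \<open>Parent functions of rooted trees on the indices \<open>0, \<dots>, 4\<close>; a root is its own parent. The index
  \<open>i\<close> stands for the generator $m_{i+1}$.\<close>

definition path :: "nat \<Rightarrow> nat" where "path i = [3, 4, 2, 2, 2] ! i"
definition fork :: "nat \<Rightarrow> nat" where "fork i = [4, 4, 3, 4, 4] ! i"
definition star :: "nat \<Rightarrow> nat" where "star i = [4, 4, 4, 4, 4] ! i"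

lemma less_5: "i < 5 \<longleftrightarrow> i = 0 \<or> i = 1 \<or> i = 2 \<or> i = 3 \<or> i = (4 :: nat)"
  by auto

lemma grow_list:
  fixes N1 :: "nat \<Rightarrow> bool" and N2 :: "nat \<Rightarrow> nat \<Rightarrow> bool"
  assumes leaf: "\<And>e. e < n \<Longrightarrow> \<not> N1 e \<Longrightarrow> \<exists>j<n. N1 j \<and> N2 j e"
    and conn: "\<And>B b c. \<lbrakk>B \<subseteq> {i. i < n \<and> N1 i}; b \<in> B; c < n; c \<notin> B; N1 c\<rbrakk> \<Longrightarrow>
      \<exists>b\<in>B. \<exists>c<n. c \<notin> B \<and> N1 c \<and> N2 b c"
    and k: "1 \<le> k" "k \<le> n"
  shows "\<exists>vs. length vs = k \<and> distinct vs \<and> set vs \<subseteq> {..<n} \<and> N1 (vs ! 0) \<and>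
    (\<forall>j<k. 0 < j \<longrightarrow> (\<exists>i<j. N1 (vs ! i) \<and> N2 (vs ! i) (vs ! j))) \<and>
    (set vs \<subseteq> {i. i < n \<and> N1 i} \<or> {i. i < n \<and> N1 i} \<subseteq> set vs)"
  using k
proof (induction k rule: nat_induct_at_least)
  case base
  then have "0 < n" by simp
  then obtain r where "r < n" "N1 r" using leaf[of 0] by blast
  then show ?case by (intro exI[of _ "[r]"]) auto
next
  case (Suc k)
  let ?U = "{i. i < n \<and> N1 i}"
  obtain vs where vs: "length vs = k" "distinct vs" "set vs \<subseteq> {..<n}" "N1 (vs ! 0)"
    "\<forall>j<k. 0 < j \<longrightarrow> (\<exists>i<j. N1 (vs ! i) \<and> N2 (vs ! i) (vs ! j))"
    "set vs \<subseteq> ?U \<or> ?U \<subseteq> set vs"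
    using Suc.IH[OF Suc_leD[OF Suc.prems]] by (elim exE conjE) (rule that, assumption+)
  have "\<exists>b c. b \<in> set vs \<and> c < n \<and> c \<notin> set vs \<and> N1 b \<and> N2 b c \<and>
    (insert c (set vs) \<subseteq> ?U \<or> ?U \<subseteq> insert c (set vs))"
  proof (cases "?U \<subseteq> set vs")
    case True
    have "card (set vs) < card {..<n}" using vs(1,2) Suc.prems by (simp add: distinct_card)
    then have "\<not> {..<n} \<subseteq> set vs" using card_mono[of "set vs" "{..<n}"] by auto
    then obtain c where c: "c < n" "c \<notin> set vs" by blast
    then obtain b where "b < n" "N1 b" "N2 b c" using leaf[of c] True by blast
    then show ?thesis using c True by blast
  next
    case False
    then have sub: "set vs \<subseteq> ?U" using vs(6) by blast
    obtain c where "c < n" "c \<notin> set vs" "N1 c" using False by blast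
    moreover have "vs ! 0 \<in> set vs" using vs(1) Suc.hyps by simp
    ultimately obtain b c where "b \<in> set vs" "c < n" "c \<notin> set vs" "N1 c" "N2 b c"
      using conn[OF sub] by blast
    then show ?thesis using sub by blast
  qed
  then obtain b c where bc: "b \<in> set vs" "c < n" "c \<notin> set vs" "N1 b" "N2 b c"
    "insert c (set vs) \<subseteq> ?U \<or> ?U \<subseteq> insert c (set vs)" by blast
  obtain i where i: "i < k" "vs ! i = b" using bc(1) vs(1) by (auto simp: in_set_conv_nth)
  have "\<exists>i<j. N1 ((vs @ [c]) ! i) \<and> N2 ((vs @ [c]) ! i) ((vs @ [c]) ! j)" if j: "j < Suc k" "0 < j" for j
  proof (cases "j = k")
    case True
    then show ?thesis using i bc vs(1) by (intro exI[of _ i]) (simp add: nth_append)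
  next
    case False
    then have "j < k" using j by simp
    then obtain i where "i < j" "N1 (vs ! i)" "N2 (vs ! i) (vs ! j)" using vs(5) j(2) by blast
    then show ?thesis using \<open>j < k\<close> vs(1) by (intro exI[of _ i]) (simp add: nth_append)
  qed
  then have "\<forall>j<Suc k. 0 < j \<longrightarrow> (\<exists>i<j. N1 ((vs @ [c]) ! i) \<and> N2 ((vs @ [c]) ! i) ((vs @ [c]) ! j))"
    by blast
  moreover have "length (vs @ [c]) = Suc k" "distinct (vs @ [c])" "set (vs @ [c]) \<subseteq> {..<n}"
    "N1 ((vs @ [c]) ! 0)"
    using vs(1-4) bc(2,3) Suc.hyps by (simp_all add: nth_append)
  moreover have "set (vs @ [c]) \<subseteq> ?U \<or> ?U \<subseteq> set (vs @ [c])" using bc(6) by simp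
  ultimately show ?case by (intro exI[of _ "vs @ [c]"] conjI)
qed

lemma spanning_tree:
  fixes N1 :: "nat \<Rightarrow> bool" and N2 :: "nat \<Rightarrow> nat \<Rightarrow> bool"
  assumes leaf: "\<And>e. e < 5 \<Longrightarrow> \<not> N1 e \<Longrightarrow> \<exists>j<5. N1 j \<and> N2 j e"
    and conn: "\<And>B b c. \<lbrakk>B \<subseteq> {i. i < 5 \<and> N1 i}; b \<in> B; c < 5; c \<notin> B; N1 c\<rbrakk> \<Longrightarrow>
      \<exists>b\<in>B. \<exists>c<5. c \<notin> B \<and> N1 c \<and> N2 b c"
    and sym: "\<And>i j. N2 i j = N2 j i"
  shows "\<exists>p\<in>{path, fork, star}. \<exists>\<pi>. bij_betw \<pi> {..<5} {..<5} \<and>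
    (\<forall>i<5. N1 (\<pi> (p i)) \<and> (p i \<noteq> i \<longrightarrow> N2 (\<pi> (p i)) (\<pi> i)))"
proof -
  obtain vs where vs: "length vs = 5" "distinct vs" "set vs \<subseteq> {..<5}" "N1 (vs ! 0)"
    "\<And>j. j < 5 \<Longrightarrow> 0 < j \<Longrightarrow> \<exists>i<j. N1 (vs ! i) \<and> N2 (vs ! i) (vs ! j)"
  proof -
    have "\<exists>vs. length vs = 5 \<and> distinct vs \<and> set vs \<subseteq> {..<5} \<and> N1 (vs ! 0) \<and>
      (\<forall>j<5. 0 < j \<longrightarrow> (\<exists>i<j. N1 (vs ! i) \<and> N2 (vs ! i) (vs ! j))) \<and>
      (set vs \<subseteq> {i. i < 5 \<and> N1 i} \<or> {i. i < 5 \<and> N1 i} \<subseteq> set vs)"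
      by (rule grow_list[of 5 N1 N2 5, OF leaf conn]) (assumption | simp)+
    then show thesis using that by blast
  qed
  obtain a b c d e where abcde: "vs = [a, b, c, d, e]"
    using vs(1) by (auto simp: numeral_eq_Suc length_Suc_conv)
  define P where "P x y \<longleftrightarrow> N1 x \<and> N2 x y" for x y
  define G where "G p \<longleftrightarrow> (\<exists>\<pi>. bij_betw \<pi> {..<5} {..<5} \<and>
    (\<forall>i<5. N1 (\<pi> (p i)) \<and> (p i \<noteq> i \<longrightarrow> N2 (\<pi> (p i)) (\<pi> i))))" for p :: "nat \<Rightarrow> nat"
  have GI: "G p" if xs: "set xs = set vs" "length xs = 5"
    and good: "\<forall>i<5. N1 (xs ! p i) \<and> (p i \<noteq> i \<longrightarrow> N2 (xs ! p i) (xs ! i))" for xs p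
  proof -
    have "card (set vs) = card {..<5 :: nat}" using vs by (simp add: distinct_card)
    then have set: "set vs = {..<5}" using vs(3) by (intro card_subset_eq) auto
    have "distinct xs" using xs vs by (metis card_distinct distinct_card)
    then have "bij_betw (\<lambda>i. xs ! i) {..<5} {..<5}"
      using xs set by (intro bij_betw_nth) auto
    with good show ?thesis unfolding G_def by blast
  qed
  have ab: "P a b" "set vs = {a, b, c, d, e}"
    using vs(5)[of 1] by (auto simp: abcde P_def)
  have c: "P a c \<or> P b c"
    using vs(5)[of 2] by (auto simp: abcde P_def less_Suc_eq numeral_eq_Suc)
  have d: "P a d \<or> P b d \<or> P c d"
    using vs(5)[of 3] by (auto simp: abcde P_def less_Suc_eq numeral_eq_Suc)
  have e: "P a e \<or> P b e \<or> P c e \<or> P d e"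
    using vs(5)[of 4] by (auto simp: abcde P_def less_Suc_eq numeral_eq_Suc)
  have k1: "\<exists>p\<in>{path, fork, star}. G p" if "P a c" "P a d" "P a e"
    using that ab by (intro bexI[of _ star] GI[of "[b, c, d, e, a]"]) (auto simp: P_def star_def sym less_5 nth_Cons')
  have k2: "\<exists>p\<in>{path, fork, star}. G p" if "P a c" "P a d" "P b e"
    using that ab by (intro bexI[of _ fork] GI[of "[c, d, e, b, a]"]) (auto simp: P_def fork_def sym less_5 nth_Cons')
  have k3: "\<exists>p\<in>{path, fork, star}. G p" if "P a c" "P a d" "P c e"
    using that ab by (intro bexI[of _ fork] GI[of "[b, d, e, c, a]"]) (auto simp: P_def fork_def sym less_5 nth_Cons')
  have k4: "\<exists>p\<in>{path, fork, star}. G p" if "P a c" "P a d" "P d e"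
    using that ab by (intro bexI[of _ fork] GI[of "[b, c, e, d, a]"]) (auto simp: P_def fork_def sym less_5 nth_Cons')
  have k5: "\<exists>p\<in>{path, fork, star}. G p" if "P a c" "P b d" "P a e"
    using that ab by (intro bexI[of _ fork] GI[of "[c, e, d, b, a]"]) (auto simp: P_def fork_def sym less_5 nth_Cons')
  have k6: "\<exists>p\<in>{path, fork, star}. G p" if "P a c" "P b d" "P b e"
    using that ab by (intro bexI[of _ fork] GI[of "[d, e, c, a, b]"]) (auto simp: P_def fork_def sym less_5 nth_Cons')
  have k7: "\<exists>p\<in>{path, fork, star}. G p" if "P a c" "P b d" "P c e"
    using that ab by (intro bexI[of _ path] GI[of "[d, e, a, b, c]"]) (auto simp: P_def path_def sym less_5 nth_Cons')
  have k8: "\<exists>p\<in>{path, fork, star}. G p" if "P a c" "P b d" "P d e"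
    using that ab by (intro bexI[of _ path] GI[of "[c, e, b, a, d]"]) (auto simp: P_def path_def sym less_5 nth_Cons')
  have k9: "\<exists>p\<in>{path, fork, star}. G p" if "P a c" "P c d" "P a e"
    using that ab by (intro bexI[of _ fork] GI[of "[b, e, d, c, a]"]) (auto simp: P_def fork_def sym less_5 nth_Cons')
  have k10: "\<exists>p\<in>{path, fork, star}. G p" if "P a c" "P c d" "P b e"
    using that ab by (intro bexI[of _ path] GI[of "[d, e, a, c, b]"]) (auto simp: P_def path_def sym less_5 nth_Cons')
  have k11: "\<exists>p\<in>{path, fork, star}. G p" if "P a c" "P c d" "P c e"
    using that ab by (intro bexI[of _ fork] GI[of "[d, e, b, a, c]"]) (auto simp: P_def fork_def sym less_5 nth_Cons')
  have k12: "\<exists>p\<in>{path, fork, star}. G p" if "P a c" "P c d" "P d e"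
    using that ab by (intro bexI[of _ path] GI[of "[b, e, c, a, d]"]) (auto simp: P_def path_def sym less_5 nth_Cons')
  have k13: "\<exists>p\<in>{path, fork, star}. G p" if "P b c" "P a d" "P a e"
    using that ab by (intro bexI[of _ fork] GI[of "[d, e, c, b, a]"]) (auto simp: P_def fork_def sym less_5 nth_Cons')
  have k14: "\<exists>p\<in>{path, fork, star}. G p" if "P b c" "P a d" "P b e"
    using that ab by (intro bexI[of _ fork] GI[of "[c, e, d, a, b]"]) (auto simp: P_def fork_def sym less_5 nth_Cons')
  have k15: "\<exists>p\<in>{path, fork, star}. G p" if "P b c" "P a d" "P c e"
    using that ab by (intro bexI[of _ path] GI[of "[d, e, b, a, c]"]) (auto simp: P_def path_def sym less_5 nth_Cons')
  have k16: "\<exists>p\<in>{path, fork, star}. G p" if "P b c" "P a d" "P d e"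
    using that ab by (intro bexI[of _ path] GI[of "[c, e, a, b, d]"]) (auto simp: P_def path_def sym less_5 nth_Cons')
  have k17: "\<exists>p\<in>{path, fork, star}. G p" if "P b c" "P b d" "P a e"
    using that ab by (intro bexI[of _ fork] GI[of "[c, d, e, a, b]"]) (auto simp: P_def fork_def sym less_5 nth_Cons')
  have k18: "\<exists>p\<in>{path, fork, star}. G p" if "P b c" "P b d" "P b e"
    using that ab by (intro bexI[of _ star] GI[of "[a, c, d, e, b]"]) (auto simp: P_def star_def sym less_5 nth_Cons')
  have k19: "\<exists>p\<in>{path, fork, star}. G p" if "P b c" "P b d" "P c e"
    using that ab by (intro bexI[of _ fork] GI[of "[a, d, e, c, b]"]) (auto simp: P_def fork_def sym less_5 nth_Cons')
  have k20: "\<exists>p\<in>{path, fork, star}. G p" if "P b c" "P b d" "P d e"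
    using that ab by (intro bexI[of _ fork] GI[of "[a, c, e, d, b]"]) (auto simp: P_def fork_def sym less_5 nth_Cons')
  have k21: "\<exists>p\<in>{path, fork, star}. G p" if "P b c" "P c d" "P a e"
    using that ab by (intro bexI[of _ path] GI[of "[d, e, b, c, a]"]) (auto simp: P_def path_def sym less_5 nth_Cons')
  have k22: "\<exists>p\<in>{path, fork, star}. G p" if "P b c" "P c d" "P b e"
    using that ab by (intro bexI[of _ fork] GI[of "[a, e, d, c, b]"]) (auto simp: P_def fork_def sym less_5 nth_Cons')
  have k23: "\<exists>p\<in>{path, fork, star}. G p" if "P b c" "P c d" "P c e"
    using that ab by (intro bexI[of _ fork] GI[of "[d, e, a, b, c]"]) (auto simp: P_def fork_def sym less_5 nth_Cons')
  have k24: "\<exists>p\<in>{path, fork, star}. G p" if "P b c" "P c d" "P d e"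
    using that ab by (intro bexI[of _ path] GI[of "[a, e, c, b, d]"]) (auto simp: P_def path_def sym less_5 nth_Cons')
  have "\<exists>p\<in>{path, fork, star}. G p"
    using c d e
    by (elim disjE) (rule k1 k2 k3 k4 k5 k6 k7 k8 k9 k10 k11 k12
      k13 k14 k15 k16 k17 k18 k19 k20 k21 k22 k23 k24, assumption, assumption, assumption)+
  then show ?thesis unfolding G_def .
qed

section \<open>Families of five variable sets\<close>

definition face :: "(nat \<Rightarrow> nat set) \<Rightarrow> nat \<Rightarrow> nat set"
  where "face A x = {j. j < 5 \<and> x \<in> A j}"

definition gens_ideal :: "(nat \<Rightarrow> nat set) \<Rightarrow> (nat, 'k::field) mpoly set"
  where "gens_ideal A = mon_ideal {1..} (ind ` A ` {..<5})"

definition all_vars :: "(nat \<Rightarrow> nat set) \<Rightarrow> nat set"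
  where "all_vars A = \<Union> (A ` {..<5})"

locale five_sets =
  fixes A :: "nat \<Rightarrow> nat set"
  assumes finite_sets: "finite (A j)" and sets_pos: "A j \<subseteq> {1..}" and beyond: "5 \<le> j \<Longrightarrow> A j = {}"
    and anti: "i < 5 \<Longrightarrow> j < 5 \<Longrightarrow> A i \<subseteq> A j \<Longrightarrow> i = j"
begin

lemma ideal_vars_sub: "A j \<subseteq> all_vars A"
  using beyond[of j] by (cases "j < 5") (auto simp: all_vars_def)

sublocale taylor 5 A "all_vars A"
  by unfold_locales (use finite_sets ideal_vars_sub in auto)

lemma inj_A: "inj_on A {..<5}"
  using anti by (auto simp: inj_on_def)

lemma antichain_A: "antichain (ind ` A ` {..<5})"
  unfolding antichain_def
proof (intro ballI impI)
  fix e e' assume "e \<in> ind ` A ` {..<5}" "e' \<in> ind ` A ` {..<5}" "e \<preceq> e'"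
  then obtain i j where ij: "i < 5" "j < 5" "e = ind (A i)" "e' = ind (A j)" "ind (A i) \<preceq> ind (A j)"
    by blast
  then have "A i \<subseteq> A j" using finite_sets by (simp add: ind_exp_le)
  then show "e = e'" using anti ij by blast
qed

lemma keys_gen: "e \<in> ind ` A ` {..<5} \<Longrightarrow> keys e \<subseteq> {1..}"
  using sets_pos keys_ind[OF finite_sets] by fastforce

lemma min_gens_A: "min_gens (gens_ideal A :: (nat, 'k::field) mpoly set) = (\<lambda>j. monom (ind (A j))) ` {..<5}"
proof -
  have "min_gens (gens_ideal A :: (nat, 'k) mpoly set) = monom ` ind ` A ` {..<5}"
    unfolding gens_ideal_def by (rule min_gens_eqI[OF antichain_A]) (erule keys_gen)
  then show ?thesis by (simp only: image_image)
qed

lemma inj_monom_A: "inj_on (\<lambda>j. monom (ind (A j)) :: (nat, 'k::field) mpoly) {..<5}"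
  using inj_A finite_sets by (auto simp: inj_on_def ind_inject)

lemma num_gens_A: "num_gens (gens_ideal A :: (nat, 'k::field) mpoly set) = 5"
  unfolding num_gens_def min_gens_A by (simp add: card_image inj_monom_A)

lemma ideal_vars_A: "ideal_vars (gens_ideal A :: (nat, 'k::field) mpoly set) = all_vars A"
  unfolding ideal_vars_def min_gens_A all_vars_def using finite_sets by simp

lemma restricted_ideal:
  "gens_ideal A \<inter> carrier (mpoly_ring (all_vars A)) = (I :: (nat, 'k::field) mpoly set)"
proof -
  have "all_vars A \<subseteq> {1..}" using sets_pos by (auto simp: all_vars_def)
  then show ?thesis by (auto simp: gens_ideal_def mon_ideal_def carrier_mpoly_ring)
qed

lemma squarefree_A: "(gens_ideal A :: (nat, 'k::field) mpoly set) \<in> squarefree_monomial_ideals"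
proof -
  let ?G = "monom ` ind ` A ` {..<5} :: (nat, 'k) mpoly set"
  have "gens_ideal A = Idl\<^bsub>S_inf\<^esub> ?G"
    unfolding gens_ideal_def by (rule genideal_S_inf_monom[symmetric]) (erule keys_gen)
  moreover have "?G \<subseteq> carrier S_inf"
  proof (rule image_subsetI)
    fix e assume "e \<in> ind ` A ` {..<5}"
    then show "monom e \<in> (carrier S_inf :: (nat, 'k) mpoly set)"
      using keys_gen[of e] by (simp only: S_inf_def carrier_mpoly_ring mpoly_vars_monom)
  qed
  moreover have "is_squarefree_monomial (monom (ind (A j)) :: (nat, 'k) mpoly)" for j
    unfolding is_squarefree_monomial_iff using finite_sets by blast
  then have "\<forall>m\<in>?G. is_squarefree_monomial m" by blast
  moreover have "finite ?G" by simp
  ultimately show ?thesis unfolding squarefree_monomial_ideals_def by blast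
qed

lemma face_subset: "face A x \<subseteq> {..<5}"
  by (auto simp: face_def)

lemma cov_iff:
  assumes "i < 5" "j < 5"
  shows "cov i j \<longleftrightarrow> (\<forall>x. face A x \<noteq> {i} \<and> face A x \<noteq> {i, j})"
proof -
  have "cov i j \<longleftrightarrow> (\<forall>x\<in>A i. \<exists>k<5. k \<noteq> i \<and> k \<noteq> j \<and> x \<in> A k)"
    by (auto simp: cov_def L_def)
  also have "\<dots> \<longleftrightarrow> (\<forall>x. face A x \<noteq> {i} \<and> face A x \<noteq> {i, j})"
  proof (intro iffI allI ballI)
    fix x assume *: "\<forall>x\<in>A i. \<exists>k<5. k \<noteq> i \<and> k \<noteq> j \<and> x \<in> A k"
    show "face A x \<noteq> {i} \<and> face A x \<noteq> {i, j}"
    proof (cases "x \<in> A i")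
      case True
      then obtain k where "k < 5" "k \<noteq> i" "k \<noteq> j" "x \<in> A k" using * by blast
      then have "k \<in> face A x" "k \<notin> {i}" "k \<notin> {i, j}" by (auto simp: face_def)
      then show ?thesis by blast
    next
      case False
      then have "i \<notin> face A x" by (simp add: face_def)
      then show ?thesis by blast
    qed
  next
    fix x assume *: "\<forall>x. face A x \<noteq> {i} \<and> face A x \<noteq> {i, j}" and x: "x \<in> A i"
    show "\<exists>k<5. k \<noteq> i \<and> k \<noteq> j \<and> x \<in> A k"
    proof (rule ccontr)
      assume "\<not> (\<exists>k<5. k \<noteq> i \<and> k \<noteq> j \<and> x \<in> A k)"
      then have "face A x \<subseteq> {i, j}" "i \<in> face A x" using assms x by (auto simp: face_def)
      then have "face A x = {i} \<or> face A x = {i, j}" by blast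
      then show False using * by blast
    qed
  qed
  finally show ?thesis .
qed

lemma covering_tree_exists:
  assumes "proj_dim (mpoly_ring (all_vars A)) (quotient_module (mpoly_ring (all_vars A))
    (gens_ideal A \<inter> carrier (mpoly_ring (all_vars A)) :: (nat, 'k::field) mpoly set)) = 3"
  shows "\<exists>p\<in>{path, fork, star}. \<exists>\<pi>. bij_betw \<pi> {..<5} {..<5} \<and>
    (\<forall>i<5. \<forall>x. face A x \<noteq> {\<pi> (p i)} \<and> face A x \<noteq> {\<pi> i, \<pi> (p i)})"
proof -
  have "proj_dim (mpoly_ring (all_vars A)) (M :: ((nat, 'k) mpoly, _) module) = enat (5 - 2)"
    using assms unfolding restricted_ideal by (simp add: numeral_eq_enat)
  then obtain P :: "nat \<Rightarrow> ((nat, 'k) mpoly, nat \<Rightarrow> (nat, 'k) mpoly) module" and d a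
    where res: "projective_resolution (mpoly_ring (all_vars A)) M (5 - 2) P d a"
    using proj_dim_eqD by blast
  define N1 where "N1 i \<longleftrightarrow> (\<forall>x. face A x \<noteq> {i})" for i
  define N2 where "N2 i j \<longleftrightarrow> (\<forall>x. face A x \<noteq> {i, j})" for i j
  have cov: "cov i j \<longleftrightarrow> N1 i \<and> N2 i j" if "i < 5" "j < 5" for i j
    using cov_iff[OF that] by (auto simp: N1_def N2_def)
  have self: "N2 i i \<longleftrightarrow> N1 i" for i by (simp add: N1_def N2_def)
  have sym: "N2 i j \<longleftrightarrow> N2 j i" for i j by (simp add: N2_def insert_commute)
  have "\<exists>p\<in>{path, fork, star}. \<exists>\<pi>. bij_betw \<pi> {..<5} {..<5} \<and>
      (\<forall>i<5. N1 (\<pi> (p i)) \<and> (p i \<noteq> i \<longrightarrow> N2 (\<pi> (p i)) (\<pi> i)))"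
  proof (rule spanning_tree)
    fix e assume e: "e < 5" "\<not> N1 e"
    then show "\<exists>j<5. N1 j \<and> N2 j e"
      using short_resolution_cov[OF _ res, of e] cov self by auto
  next
    fix B b c assume B: "B \<subseteq> {i. i < 5 \<and> N1 i}" "b \<in> B" "c < 5" "c \<notin> B" "N1 c"
    have "B \<subseteq> {i. i < 5 \<and> cov i i}" "cov c c" using B cov self by auto
    then obtain b c where "b \<in> B" "c < 5" "c \<notin> B" "cov c b"
      using short_resolution_connected[OF _ res, of B b c] B by auto
    then show "\<exists>b\<in>B. \<exists>c<5. c \<notin> B \<and> N1 c \<and> N2 b c" using cov sym B(1) by blast
  qed (rule sym)
  then obtain p \<pi> where p: "p \<in> {path, fork, star}" "bij_betw \<pi> {..<5} {..<5}"
      "\<And>i. i < 5 \<Longrightarrow> N1 (\<pi> (p i)) \<and> (p i \<noteq> i \<longrightarrow> N2 (\<pi> (p i)) (\<pi> i))" by blast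
  have "N1 (\<pi> (p i)) \<and> N2 (\<pi> i) (\<pi> (p i))" if "i < 5" for i
    using p(3)[OF that] self[of "\<pi> i"] sym by (cases "p i = i") auto
  then show ?thesis using p(1,2) unfolding N1_def N2_def by blast
qed

end

text \<open>The edges and the inner vertices of the tree; for the root, \<open>{i, p i}\<close> is one of the latter.\<close>

definition excluded :: "(nat \<Rightarrow> nat) \<Rightarrow> nat set set"
  where "excluded p = (\<Union>i<5. {{p i}, {i, p i}})"

text \<open>The ideal whose hypergraph is as large as the tree with parent function \<open>p\<close> permits.\<close>

locale tree_family =
  fixes A :: "nat \<Rightarrow> nat set" and p :: "nat \<Rightarrow> nat" and r N :: nat
  assumes sets: "A j \<subseteq> {1..N}" and empty: "5 \<le> j \<Longrightarrow> A j = {}"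
    and p_lt: "i < 5 \<Longrightarrow> p i < 5" and root: "r < 5" "p r = r"
    and depth2: "i < 5 \<Longrightarrow> p (p i) = r" and p_not_self: "i < 5 \<Longrightarrow> i \<noteq> r \<Longrightarrow> p i \<noteq> i"
    and inj_face: "inj_on (face A) {1..N}"
    and faces_eq: "face A ` {1..N} = {s. s \<subseteq> {..<5} \<and> s \<noteq> {} \<and> s \<noteq> {..<5} \<and> s \<notin> excluded p}"
    and pair: "{0, 1} \<notin> excluded p"
begin

lemma face_obtain:
  assumes "s \<subseteq> {..<5}" "card s = 3 \<or> s = {0, 1}"
  obtains x where "x \<in> {1..N}" "face A x = s"
proof -
  have "s \<notin> excluded p"
  proof (cases "s = {0, 1}")
    case False
    then have "card s = 3" using assms by simp
    moreover have "card t \<le> 2" if t: "t \<in> excluded p" for t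
    proof -
      obtain i where "t = {p i} \<or> t = {i, p i}" using t by (auto simp: excluded_def)
      then show ?thesis by (auto simp: card_insert_if)
    qed
    ultimately show ?thesis by fastforce
  qed (use pair in simp)
  moreover have "card s \<noteq> 0" "card s \<noteq> 5" using assms(2) by auto
  then have "s \<noteq> {}" "s \<noteq> {..<5}" by auto
  ultimately have "s \<in> face A ` {1..N}" using assms(1) unfolding faces_eq by simp
  then show thesis by (elim imageE) (rule that, simp_all)
qed

lemma third: "i < 5 \<Longrightarrow> j < 5 \<Longrightarrow> \<exists>k<5. k \<noteq> i \<and> k \<noteq> (j :: nat)"
  by presburger

lemma separate:
  assumes "i < 5" "j < 5" "i \<noteq> j"
  shows "\<exists>x. x \<in> A i \<and> x \<notin> A j"
proof -
  obtain k where k: "k < 5" "k \<noteq> i" "k \<noteq> j" using third assms by blast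
  have "card ({..<5} - {j, k}) = 3" using k assms by (simp add: card_Diff_subset)
  then obtain x where x: "face A x = {..<5} - {j, k}" using face_obtain[of "{..<5} - {j, k}"] by blast
  have "i \<in> face A x" "j \<notin> face A x" unfolding x using assms k by auto
  then show ?thesis using assms by (auto simp: face_def)
qed

sublocale five_sets A
proof
  show "finite (A j)" for j using sets finite_subset by blast
  show "A j \<subseteq> {1..}" for j using sets[of j] by auto
  show "i = j" if "i < 5" "j < 5" "A i \<subseteq> A j" for i j using separate[of i j] that by blast
qed (rule empty)

lemma all_vars_eq: "all_vars A = {1..N}"
proof
  show "all_vars A \<subseteq> {1..N}"
  proof
    fix x assume "x \<in> all_vars A"
    then obtain j where "x \<in> A j" by (auto simp: all_vars_def)
    then show "x \<in> {1..N}" using sets[of j] by blast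
  qed
  show "{1..N} \<subseteq> all_vars A"
  proof
    fix x assume "x \<in> {1..N}"
    then have "face A x \<noteq> {}" using faces_eq by blast
    then show "x \<in> all_vars A" by (auto simp: face_def all_vars_def)
  qed
qed

lemma face_cases:
  "face A x = {} \<or> (x \<in> {1..N} \<and> face A x \<noteq> {..<5} \<and> face A x \<notin> excluded p)"
proof (cases "face A x = {}")
  case False
  then obtain j where "x \<in> A j" by (auto simp: face_def)
  then have "x \<in> {1..N}" using sets[of j] by blast
  then have "face A x \<in> face A ` {1..N}" by (rule imageI)
  with \<open>x \<in> {1..N}\<close> show ?thesis unfolding faces_eq by simp
qed simp

sublocale covering_tree 5 A "all_vars A" p r
proof
  show "cov (p i) i" if "i < 5" for i
  proof -
    have "{p i} \<in> excluded p" "{p i, i} \<in> excluded p"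
      using that by (auto simp: excluded_def insert_commute)
    then show ?thesis
      unfolding cov_iff[OF p_lt[OF that] that] using face_cases by (metis insert_not_empty)
  qed
qed (use p_lt root depth2 p_not_self in auto)

lemma proj_dim_eq_3:
  "proj_dim (mpoly_ring (all_vars A)) (quotient_module (mpoly_ring (all_vars A))
    (gens_ideal A \<inter> carrier (mpoly_ring (all_vars A)) :: (nat, 'k::field) mpoly set)) = 3"
proof -
  have t: "{2, 3, 4} \<in> faces 3" by (simp add: faces_def)
  have ex: "\<exists>x. x \<in> A i \<and> x \<notin> L t"
    if s: "s \<subseteq> {..<5}" "card s = 3 \<or> s = {0, 1}" "i \<in> s" and t: "s \<inter> t = {}" "t \<subseteq> {..<5}" for i s t
  proof -
    obtain x where x: "face A x = s" using face_obtain[OF s(1,2)] by metis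
    have "x \<in> A i" using s(3) unfolding x[symmetric] by (simp add: face_def)
    moreover have "x \<notin> A j" if "j \<in> t" for j
    proof
      assume "x \<in> A j"
      then have "j \<in> s" using t(2) that unfolding x[symmetric] face_def by blast
      then show False using t(1) that by blast
    qed
    ultimately show ?thesis by (auto simp: L_def)
  qed
  have "\<exists>x. x \<in> A 2 \<and> x \<notin> L {3, 4}" by (rule ex[of "{0, 1, 2}"]) simp_all
  moreover have "\<exists>x. x \<in> A 3 \<and> x \<notin> L {2, 4}" by (rule ex[of "{0, 1, 3}"]) simp_all
  moreover have "\<exists>x. x \<in> A 4 \<and> x \<notin> L {2, 3}" by (rule ex[of "{0, 1, 4}"]) simp_all
  moreover have "{2, 3, 4} - {2 :: nat} = {3, 4}" "{2, 3, 4} - {3 :: nat} = {2, 4}"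
    "{2, 3, 4} - {4 :: nat} = {2, 3}" by auto
  ultimately have "\<not> A 2 \<subseteq> L ({2, 3, 4} - {2})" "\<not> A 3 \<subseteq> L ({2, 3, 4} - {3})"
    "\<not> A 4 \<subseteq> L ({2, 3, 4} - {4})" by (simp_all only: subset_iff) blast+
  then have 1: "\<not> A i \<subseteq> L ({2, 3, 4} - {i})" if "i \<in> {2, 3, 4}" for i
    using that by (elim insertE emptyE) (simp_all only: not_False_eq_True)
  have "\<exists>x. x \<in> A 0 \<and> x \<notin> L {2, 3, 4}" "\<exists>x. x \<in> A 1 \<and> x \<notin> L {2, 3, 4}"
    by (rule ex[of "{0, 1}"]; simp)+
  then have 2: "\<not> A i \<subseteq> L {2, 3, 4}" if "i \<in> {..<5} - {2, 3, 4}" for i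
  proof -
    have "i = 0 \<or> i = 1" using that by (auto simp: less_5)
    then show ?thesis using \<open>\<exists>x. x \<in> A 0 \<and> x \<notin> L {2, 3, 4}\<close> \<open>\<exists>x. x \<in> A 1 \<and> x \<notin> L {2, 3, 4}\<close> by blast
  qed
  obtain P :: "nat \<Rightarrow> ((nat, 'k) mpoly, nat \<Rightarrow> (nat, 'k) mpoly) module" and d a
    where res: "projective_resolution (mpoly_ring (all_vars A)) M (5 - 2) P d a"
    using resolution_exists by blast
  have "proj_dim (mpoly_ring (all_vars A)) (M :: ((nat, 'k) mpoly, _) module) = enat 3"
  proof (rule proj_dim_eqI)
    show "projective_resolution (mpoly_ring (all_vars A)) M 3 P d a" using res by simp
    show "\<not> projective_resolution (mpoly_ring (all_vars A)) M m' P' d' a'" if "m' < 3"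
      for m' and P' :: "nat \<Rightarrow> ((nat, 'k) mpoly, nat \<Rightarrow> (nat, 'k) mpoly) module" and d' a'
      by (rule no_resolution_below_face[OF t _ _ that]) (erule 1, erule 2)
  qed
  then show ?thesis unfolding restricted_ideal by (simp add: numeral_eq_enat)
qed

lemma height_eq_2: "height S_inf (gens_ideal A :: (nat, 'k::field) mpoly set) = 2"
proof -
  obtain x where x: "x \<in> {1..N}" "face A x = {0, 1, 2}" by (rule face_obtain[of "{0, 1, 2}"]) auto
  obtain y where y: "y \<in> {1..N}" "face A y = {2, 3, 4}" by (rule face_obtain[of "{2, 3, 4}"]) auto
  have "3 \<notin> face A x" "3 \<in> face A y" by (simp_all add: x y)
  then have neq: "x \<noteq> y" by auto
  have xA: "x \<in> A j" if "j \<in> {0, 1, 2}" for j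
  proof -
    have "j \<in> face A x" using that x(2) by simp
    then show ?thesis by (simp add: face_def)
  qed
  have yA: "y \<in> A j" if "j \<in> {2, 3, 4}" for j
  proof -
    have "j \<in> face A y" using that y(2) by simp
    then show ?thesis by (simp add: face_def)
  qed
  show ?thesis
    unfolding gens_ideal_def
  proof (rule height_eq_2I[of _ x y])
    show "finite D \<and> D \<subseteq> {1..}" if "D \<in> A ` {..<5}" for D
      using that finite_sets sets_pos by auto
    show "\<exists>D\<in>A ` {..<5}. v \<notin> D" for v
    proof (rule ccontr)
      assume "\<not> (\<exists>D\<in>A ` {..<5}. v \<notin> D)"
      then have "face A v = {..<5}" by (auto simp: face_def)
      moreover have "0 \<in> {..<5 :: nat}" by simp
      ultimately show False using face_cases[of v] by blast
    qed
    show "x \<in> D \<or> y \<in> D" if "D \<in> A ` {..<5}" for D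
      using that xA yA by (auto simp: less_5)
  qed (use x y neq in auto)
qed

lemma connected: "connected_ideal (gens_ideal A :: (nat, 'k::field) mpoly set)"
proof -
  have share: "\<not> monom_coprime (monom (ind (A i))) (monom (ind (A j)) :: (nat, 'k) mpoly)"
    if ij: "i < 5" "j < 5" "i \<noteq> j" for i j
  proof -
    obtain k where k: "k < 5" "k \<noteq> i" "k \<noteq> j" using third ij by blast
    then obtain x where x: "face A x = {i, j, k}" using face_obtain[of "{i, j, k}"] ij by auto
    have "i \<in> face A x" "j \<in> face A x" by (simp_all add: x)
    then have "x \<in> A i" "x \<in> A j" by (simp_all add: face_def)
    then show ?thesis using monom_coprime_iff[OF finite_sets finite_sets] by blast
  qed
  show ?thesis
    unfolding connected_ideal_def min_gens_A
  proof (intro ballI impI r_into_rtrancl)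
    fix m m' :: "(nat, 'k) mpoly"
    assume m: "m \<in> (\<lambda>j. monom (ind (A j))) ` {..<5}" "m' \<in> (\<lambda>j. monom (ind (A j))) ` {..<5}" "m \<noteq> m'"
    then obtain i j where "i < 5" "j < 5" "m = monom (ind (A i))" "m' = monom (ind (A j))" "i \<noteq> j" by blast
    then show "(m, m') \<in> {(a, b). a \<in> (\<lambda>j. monom (ind (A j))) ` {..<5} \<and>
        b \<in> (\<lambda>j. monom (ind (A j))) ` {..<5} \<and> \<not> monom_coprime a b}"
      using m share by simp
  qed
qed

end

section \<open>Generic sets\<close>

lemma prod_monom_ind:
  assumes "finite S" "\<And>v. v \<in> S \<Longrightarrow> finite (D v)"
    "\<And>v w. v \<in> S \<Longrightarrow> w \<in> S \<Longrightarrow> v \<noteq> w \<Longrightarrow> D v \<inter> D w = {}"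
  shows "(\<Prod>v\<in>S. monom (ind (D v))) = (monom (ind (\<Union>v\<in>S. D v)) :: ('v, 'k::field) mpoly)"
  using assms
proof (induction S rule: finite_induct)
  case (insert x S)
  have IH: "(\<Prod>v\<in>S. monom (ind (D v))) = (monom (ind (\<Union>v\<in>S. D v)) :: ('v, 'k) mpoly)"
    using insert.prems by (intro insert.IH) auto
  have "D x \<inter> (\<Union>v\<in>S. D v) = {}" using insert.prems(2)[of x] insert.hyps(2) by blast
  then have "ind (D x \<union> (\<Union>v\<in>S. D v)) = ind (D x) + ind (\<Union>v\<in>S. D v)"
    using insert.hyps(1) insert.prems(1) by (intro ind_Un_disjoint) auto
  then show ?case using insert.hyps IH by (simp add: monom_mult)
qed simp

definition covers :: "(nat, 'k::field) mpoly set \<Rightarrow> (nat, 'k) mpoly set \<Rightarrow> bool"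
  where "covers I J \<longleftrightarrow> (\<exists>f M.
       bij_betw f (min_gens I) (min_gens J) \<and>
       (\<forall>v\<in>ideal_vars I. is_squarefree_monomial (M v) \<and> mpoly_vars (M v) \<subseteq> ideal_vars J) \<and>
       (\<forall>v\<in>ideal_vars I. \<forall>w\<in>ideal_vars I. v \<noteq> w \<longrightarrow> monom_coprime (M v) (M w)) \<and>
       (\<forall>m\<in>min_gens I. (\<Prod>v\<in>mpoly_vars m. M v) = f m))"

lemma generic_set_iff: "generic_set C X \<longleftrightarrow> X \<subseteq> C \<and> (\<forall>J\<in>C. \<exists>I\<in>X. covers I J)"
  unfolding generic_set_def covers_def ..

context five_sets
begin

definition gen :: "nat \<Rightarrow> (nat, 'k::field) mpoly"
  where "gen j = monom (ind (A j))"

lemma bij_gen: "bij_betw gen {..<5} (min_gens (gens_ideal A :: (nat, 'k::field) mpoly set))"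
  unfolding bij_betw_def min_gens_A gen_def using inj_monom_A by blast

lemma vars_gen [simp]: "mpoly_vars (gen j) = A j"
  by (simp add: gen_def finite_sets)

end

lemma (in tree_family) covers_if:
  assumes D: "five_sets D" and \<pi>: "bij_betw \<pi> {..<5} {..<5}"
    and avoid: "\<And>i x. i < 5 \<Longrightarrow> face D x \<noteq> {\<pi> (p i)} \<and> face D x \<noteq> {\<pi> i, \<pi> (p i)}"
    and proper: "\<And>x. face D x \<noteq> {..<5}"
  shows "covers (gens_ideal A :: (nat, 'k::field) mpoly set) (gens_ideal D)"
proof -
  interpret D: five_sets D by fact
  define E where "E v = {x \<in> all_vars D. face D x = \<pi> ` face A v}" for v
  have finE: "finite (E v)" for v
    using D.finite_sets by (auto simp: E_def all_vars_def)
  have disj: "E v \<inter> E w = {}" if "v \<in> {1..N}" "w \<in> {1..N}" "v \<noteq> w" for v w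
  proof (rule ccontr)
    assume "E v \<inter> E w \<noteq> {}"
    then have "\<pi> ` face A v = \<pi> ` face A w" by (auto simp: E_def)
    then have "face A v = face A w"
      using inj_on_image_eq_iff[OF bij_betw_imp_inj_on[OF \<pi>] face_subset face_subset] by blast
    then have "v = w" using inj_face that(1,2) by (metis inj_onD)
    then show False using that(3) by simp
  qed
  have union: "(\<Union>v\<in>A j. E v) = D (\<pi> j)" if j: "j < 5" for j
  proof (intro equalityI subsetI)
    fix x assume "x \<in> (\<Union>v\<in>A j. E v)"
    then obtain v where v: "v \<in> A j" "face D x = \<pi> ` face A v" by (auto simp: E_def)
    then have "\<pi> j \<in> face D x" using j by (simp add: face_def)
    then show "x \<in> D (\<pi> j)" by (simp add: face_def)
  next
    fix x assume x: "x \<in> D (\<pi> j)"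
    define s where "s = {i. i < 5 \<and> \<pi> i \<in> face D x}"
    have \<pi>5: "\<pi> i < 5" if "i < 5" for i using \<pi> that by (auto simp: bij_betw_def)
    have s: "\<pi> ` s = face D x"
    proof
      show "face D x \<subseteq> \<pi> ` s"
      proof
        fix i assume i: "i \<in> face D x"
        then have "i \<in> \<pi> ` {..<5}" using \<pi> by (auto simp: bij_betw_def face_def)
        then show "i \<in> \<pi> ` s" using i by (auto simp: s_def)
      qed
    qed (auto simp: s_def)
    have js: "j \<in> s" using j x \<pi>5[OF j] by (simp add: s_def face_def)
    have "s \<noteq> {..<5}" using s proper[of x] \<pi> by (metis bij_betw_def)
    moreover have "s \<notin> excluded p"
    proof
      assume "s \<in> excluded p"
      then obtain i where "i < 5" "s = {p i} \<or> s = {i, p i}" by (auto simp: excluded_def)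
      then show False using s avoid[of i x] by auto
    qed
    moreover have "s \<subseteq> {..<5}" by (auto simp: s_def)
    ultimately have "s \<in> face A ` {1..N}" unfolding faces_eq using js by blast
    then obtain v where v: "face A v = s" by blast
    have "x \<in> E v" using D.ideal_vars_sub[of "\<pi> j"] x by (auto simp: E_def v s)
    moreover have "v \<in> A j" using js unfolding v[symmetric] by (simp add: face_def)
    ultimately show "x \<in> (\<Union>v\<in>A j. E v)" by blast
  qed
  have bij_A: "bij_betw gen {..<5} (min_gens (gens_ideal A :: (nat, 'k) mpoly set))" by (rule bij_gen)
  have bij_D: "bij_betw D.gen {..<5} (min_gens (gens_ideal D :: (nat, 'k) mpoly set))" by (rule D.bij_gen)
  define g :: "(nat, 'k) mpoly \<Rightarrow> nat" where "g = the_inv_into {..<5} gen"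
  have g: "g (gen j) = j" if "j < 5" for j
    using that bij_betw_imp_inj_on[OF bij_A] by (simp add: g_def the_inv_into_f_f)
  have bij: "bij_betw (\<lambda>m. D.gen (\<pi> (g m)) :: (nat, 'k) mpoly) (min_gens (gens_ideal A)) (min_gens (gens_ideal D))"
    using bij_betw_trans[OF bij_betw_trans[OF bij_betw_the_inv_into[OF bij_A] \<pi>] bij_D]
    by (simp add: g_def comp_def)
  show ?thesis
    unfolding covers_def ideal_vars_A D.ideal_vars_A
  proof (intro exI conjI ballI impI)
    show "bij_betw (\<lambda>m. D.gen (\<pi> (g m)) :: (nat, 'k) mpoly) (min_gens (gens_ideal A)) (min_gens (gens_ideal D))"
      by (rule bij)
    fix v assume v: "v \<in> all_vars A"
    show "is_squarefree_monomial (monom (ind (E v)) :: (nat, 'k) mpoly)"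
      using finE by (auto simp: is_squarefree_monomial_iff)
    show "mpoly_vars (monom (ind (E v)) :: (nat, 'k) mpoly) \<subseteq> all_vars D"
      using finE by (auto simp: E_def)
    fix w assume w: "w \<in> all_vars A" "v \<noteq> w"
    show "monom_coprime (monom (ind (E v))) (monom (ind (E w)) :: (nat, 'k) mpoly)"
      using v w disj unfolding monom_coprime_iff[OF finE finE] all_vars_eq by blast
  next
    fix m :: "(nat, 'k) mpoly"
    assume "m \<in> min_gens (gens_ideal A)"
    then obtain j where j: "j < 5" "m = gen j" using bij_A by (auto simp: bij_betw_def)
    have "(\<Prod>v\<in>A j. monom (ind (E v))) = (monom (ind (\<Union>v\<in>A j. E v)) :: (nat, 'k) mpoly)"
    proof (rule prod_monom_ind)
      show "E v \<inter> E w = {}" if "v \<in> A j" "w \<in> A j" "v \<noteq> w" for v w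
        using disj that sets[of j] by blast
    qed (use finite_sets finE in auto)
    then show "(\<Prod>v\<in>mpoly_vars m. monom (ind (E v))) = (D.gen (\<pi> (g m)) :: (nat, 'k) mpoly)"
      using j g union by (simp add: D.gen_def)
  qed
qed

lemma tree_family_covers:
  assumes A: "tree_family A p r N" and D: "tree_family D q s N'"
    and covers: "covers (gens_ideal A :: (nat, 'k::field) mpoly set) (gens_ideal D)"
  shows "\<exists>\<pi>. bij_betw \<pi> {..<5} {..<5} \<and> (\<forall>t\<in>excluded p. \<pi> ` t \<in> excluded q)"
proof -
  interpret A: tree_family A p r N by fact
  interpret D: tree_family D q s N' by fact
  obtain f and M :: "nat \<Rightarrow> (nat, 'k) mpoly" where
    f: "bij_betw f (min_gens (gens_ideal A :: (nat, 'k) mpoly set)) (min_gens (gens_ideal D :: (nat, 'k) mpoly set))"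
    and M: "\<And>v. v \<in> {1..N} \<Longrightarrow> is_squarefree_monomial (M v)"
    and cop: "\<And>v w. v \<in> {1..N} \<Longrightarrow> w \<in> {1..N} \<Longrightarrow> v \<noteq> w \<Longrightarrow> monom_coprime (M v) (M w)"
    and prod: "\<And>m. m \<in> min_gens (gens_ideal A :: (nat, 'k) mpoly set) \<Longrightarrow> (\<Prod>v\<in>mpoly_vars m. M v) = f m"
    using covers unfolding covers_def A.ideal_vars_A A.all_vars_eq
    by (elim exE conjE) (rule that; (erule bspec | assumption | blast))
  have "\<forall>v\<in>{1..N}. \<exists>X. finite X \<and> M v = monom (ind X)"
    using M by (simp add: is_squarefree_monomial_iff)
  then obtain E where E: "\<And>v. v \<in> {1..N} \<Longrightarrow> finite (E v)" "\<And>v. v \<in> {1..N} \<Longrightarrow> M v = monom (ind (E v))"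
    by metis
  have disj: "E v \<inter> E w = {}" if "v \<in> {1..N}" "w \<in> {1..N}" "v \<noteq> w" for v w
    using cop[OF that] E that monom_coprime_iff[of "E v" "E w", where ?'k = 'k] by simp
  have bij_A: "bij_betw A.gen {..<5} (min_gens (gens_ideal A :: (nat, 'k) mpoly set))" by (rule A.bij_gen)
  have bij_D: "bij_betw D.gen {..<5} (min_gens (gens_ideal D :: (nat, 'k) mpoly set))" by (rule D.bij_gen)
  define \<pi> where "\<pi> = (\<lambda>j. the_inv_into {..<5} D.gen (f (A.gen j)))"
  have \<pi>: "bij_betw \<pi> {..<5} {..<5}"
    using bij_betw_trans[OF bij_betw_trans[OF bij_A f] bij_betw_the_inv_into[OF bij_D]]
    by (simp add: \<pi>_def comp_def)
  have gen_\<pi>: "D.gen (\<pi> j) = f (A.gen j)" if "j < 5" for j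
  proof -
    have "f (A.gen j) \<in> D.gen ` {..<5}"
      using bij_betw_apply[OF f bij_betw_apply[OF bij_A, of j]] bij_D that by (simp add: bij_betw_def)
    then show ?thesis
      unfolding \<pi>_def using bij_betw_imp_inj_on[OF bij_D] by (simp add: f_the_inv_into_f)
  qed
  have D_\<pi>: "D (\<pi> j) = (\<Union>v\<in>A j. E v)" if j: "j < 5" for j
  proof -
    have AN: "A j \<subseteq> {1..N}" by (rule A.sets)
    have "D.gen (\<pi> j) = (\<Prod>v\<in>A j. M v)"
      using gen_\<pi>[OF j] prod[of "A.gen j"] bij_betw_apply[OF bij_A, of j] j by simp
    also have "\<dots> = (\<Prod>v\<in>A j. monom (ind (E v)))"
      using AN E(2) by (intro prod.cong) auto
    also have "\<dots> = monom (ind (\<Union>v\<in>A j. E v))"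
      using AN E(1) disj A.finite_sets by (intro prod_monom_ind) blast+
    finally have "mpoly_vars (D.gen (\<pi> j) :: (nat, 'k) mpoly) =
        mpoly_vars (monom (ind (\<Union>v\<in>A j. E v)) :: (nat, 'k) mpoly)" by (rule arg_cong)
    moreover have "finite (\<Union>v\<in>A j. E v)" using AN E(1) A.finite_sets by blast
    ultimately show ?thesis by simp
  qed
  have "\<pi> ` t \<in> excluded q" if t: "t \<in> excluded p" for t
  proof (rule ccontr)
    assume no: "\<pi> ` t \<notin> excluded q"
    obtain i where i: "i < 5" "t = {p i} \<or> t = {i, p i}" using t by (auto simp: excluded_def)
    then have t5: "t \<subseteq> {..<5}" "t \<noteq> {}" "card t \<le> 2" "finite t"
      using A.p_lt by (auto simp: card_insert_if)
    have "card (\<pi> ` t) \<le> 2" using t5 card_image_le[of t \<pi>] by linarith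
    then have "\<pi> ` t \<noteq> {..<5}" by auto
    moreover have "\<pi> ` t \<subseteq> {..<5}" using \<pi> t5(1) by (auto simp: bij_betw_def)
    ultimately have "\<pi> ` t \<in> face D ` {1..N'}" unfolding D.faces_eq using no t5(2) by blast
    then obtain x where x: "face D x = \<pi> ` t" by blast
    have \<pi>5: "\<pi> i < 5" if "i < 5" for i using \<pi> that by (auto simp: bij_betw_def)
    have mem: "x \<in> D (\<pi> i) \<longleftrightarrow> i \<in> t" if "i < 5" for i
    proof -
      have "x \<in> D (\<pi> i) \<longleftrightarrow> \<pi> i \<in> \<pi> ` t" using \<pi>5[OF that] by (simp add: x[symmetric] face_def)
      also have "\<dots> \<longleftrightarrow> i \<in> t"
        using inj_on_image_mem_iff[OF bij_betw_imp_inj_on[OF \<pi>], of i t] that t5(1) by simp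
      finally show ?thesis .
    qed
    obtain j where j: "j \<in> t" "j < 5" using t5 by blast
    then have "x \<in> D (\<pi> j)" using mem by blast
    then obtain v where v: "v \<in> A j" "x \<in> E v" unfolding D_\<pi>[OF j(2)] by blast
    have vN: "v \<in> {1..N}" using v(1) A.sets[of j] by blast
    have "v \<in> A i \<longleftrightarrow> i \<in> t" if "i < 5" for i
    proof -
      have "x \<in> D (\<pi> i) \<longleftrightarrow> (\<exists>w\<in>A i. x \<in> E w)" by (simp add: D_\<pi>[OF that])
      also have "\<dots> \<longleftrightarrow> v \<in> A i"
        using v(2) disj[OF vN] A.sets[of i] by blast
      finally show ?thesis using mem[OF that] by simp
    qed
    then have "face A v = t" using t5(1) by (auto simp: face_def)
    then have "t \<in> face A ` {1..N}" using vN by blast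
    then show False using t unfolding A.faces_eq by simp
  qed
  then show ?thesis using \<pi> by blast
qed

definition neighbours :: "(nat \<Rightarrow> nat) \<Rightarrow> nat \<Rightarrow> nat set"
  where "neighbours p v = set (filter (\<lambda>w. w \<noteq> v \<and> (p v = w \<or> p w = v)) [0..<5])"

lemma neighbours_iff: "v < 5 \<Longrightarrow> w \<in> neighbours p v \<longleftrightarrow> w < 5 \<and> w \<noteq> v \<and> {v, w} \<in> excluded p"
  by (auto simp: neighbours_def excluded_def doubleton_eq_iff)

lemma tree_data:
  "card (path ` set [0..<5]) = 3" "card (fork ` set [0..<5]) = 2" "card (star ` set [0..<5]) = 1"
  "\<forall>v\<in>set [0..<5]. card (neighbours path v) \<le> 2" "\<forall>v\<in>set [0..<5]. card (neighbours fork v) \<le> 3"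
  "card (neighbours fork 4) = 3" "card (neighbours star 4) = 4"
  unfolding neighbours_def path_def fork_def star_def by code_simp+

lemma excluded_map_unique:
  assumes pq: "p \<in> {path, fork, star}" "q \<in> {path, fork, star}"
    and \<pi>: "bij_betw \<pi> {..<5} {..<5}" and map: "\<And>t. t \<in> excluded p \<Longrightarrow> \<pi> ` t \<in> excluded q"
  shows "p = q"
proof -
  have set5: "set [0..<5] = {..<5 :: nat}" by auto
  have lt: "p i < 5" if "i < 5" for i
    using pq(1) that by (auto simp: path_def fork_def star_def less_5)
  have inj: "inj_on \<pi> {..<5}" and \<pi>5: "\<And>i. i < 5 \<Longrightarrow> \<pi> i < 5" using \<pi> by (auto simp: bij_betw_def)
  have "\<pi> ` p ` {..<5} \<subseteq> q ` {..<5}"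
  proof (intro subsetI)
    fix x assume "x \<in> \<pi> ` p ` {..<5}"
    then obtain i where i: "i < 5" "x = \<pi> (p i)" by blast
    then have "{x} \<in> excluded q" using map[of "{p i}"] by (auto simp: excluded_def)
    then obtain k where k: "k < 5" "{x} = {q k} \<or> {x} = {k, q k}" by (auto simp only: excluded_def)
    then have "x = q k" by auto
    then show "x \<in> q ` {..<5}" using k(1) by simp
  qed
  then have "card (\<pi> ` p ` {..<5}) \<le> card (q ` {..<5})" by (intro card_mono) auto
  moreover have "inj_on \<pi> (p ` {..<5})" using inj by (rule inj_on_subset) (use lt in auto)
  ultimately have internal: "card (p ` {..<5}) \<le> card (q ` {..<5})" by (simp add: card_image)
  have degree: "card (neighbours p v) \<le> card (neighbours q (\<pi> v))" if v: "v < 5" for v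
  proof -
    have "\<pi> ` neighbours p v \<subseteq> neighbours q (\<pi> v)"
    proof
      fix x assume "x \<in> \<pi> ` neighbours p v"
      then obtain w where w: "x = \<pi> w" "w < 5" "w \<noteq> v" "{v, w} \<in> excluded p"
        using neighbours_iff[OF v] by blast
      then have "{\<pi> v, x} \<in> excluded q" using map[of "{v, w}"] by simp
      moreover have "x \<noteq> \<pi> v" using w v inj by (auto simp: inj_on_def)
      ultimately show "x \<in> neighbours q (\<pi> v)" using neighbours_iff[OF \<pi>5[OF v]] \<pi>5 w by blast
    qed
    moreover have "finite (neighbours q (\<pi> v))" by (simp add: neighbours_def)
    ultimately have "card (\<pi> ` neighbours p v) \<le> card (neighbours q (\<pi> v))" by (rule card_mono[rotated])
    moreover have "inj_on \<pi> (neighbours p v)"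
      using inj by (rule inj_on_subset) (auto simp: neighbours_def)
    ultimately show ?thesis by (simp add: card_image)
  qed
  note data = tree_data[unfolded set5]
  have "\<pi> 4 \<in> {..<5}" using \<pi>5[of 4] by simp
  then have "card (neighbours path (\<pi> 4)) \<le> 2" "card (neighbours fork (\<pi> 4)) \<le> 3"
    using data(4,5) by blast+
  then show ?thesis
    using pq internal degree[of 4] data(1-3,6,7) by auto
qed

section \<open>The class and its three maximal members\<close>

definition target_class :: "(nat, 'k::field) mpoly set set"
  where "target_class = {I \<in> squarefree_monomial_ideals.
      num_gens I = 5 \<and>
      proj_dim (mpoly_ring (ideal_vars I))
        (quotient_module (mpoly_ring (ideal_vars I)) (I \<inter> carrier (mpoly_ring (ideal_vars I)))) = 3 \<and>
      height S_inf I = 2 \<and>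
      connected_ideal I}"

lemma (in tree_family) in_target_class: "(gens_ideal A :: (nat, 'k::field) mpoly set) \<in> target_class"
  unfolding target_class_def
  using squarefree_A num_gens_A proj_dim_eq_3 height_eq_2 connected by (simp add: ideal_vars_A)

lemma target_class_obtain:
  fixes J :: "(nat, 'k::field) mpoly set"
  assumes "J \<in> target_class"
  obtains D where "five_sets D" "J = gens_ideal D"
proof -
  have n: "num_gens J = 5" and "J \<in> squarefree_monomial_ideals"
    using assms by (auto simp: target_class_def)
  from this(2) obtain E where E: "finite E" "antichain (ind ` E)" "\<And>X. X \<in> E \<Longrightarrow> finite X \<and> X \<subseteq> {1..}"
    "J = mon_ideal {1..} (ind ` E)" "min_gens J = monom ` ind ` E"
    by (rule squarefree_monomial_idealsE) (rule that)
  have "inj_on (\<lambda>X. monom (ind X) :: (nat, 'k) mpoly) E"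
    using E(3) by (auto simp: inj_on_def ind_inject)
  then have "card E = 5"
    using n unfolding num_gens_def E(5) image_image by (simp add: card_image)
  then obtain h where h: "bij_betw h {0..<5 :: nat} E" using ex_bij_betw_nat_finite[OF E(1)] by metis
  define D where "D j = (if j < 5 then h j else {})" for j
  have DE: "D ` {..<5} = E" using h by (auto simp: D_def bij_betw_def atLeast0LessThan)
  have mem: "D j \<in> E" if "j < 5" for j using DE that by blast
  have "five_sets D"
  proof
    show "finite (D j)" "D j \<subseteq> {1..}" for j
      using E(3)[OF mem[of j]] by (cases "j < 5"; simp add: D_def)+
    show "D j = {}" if "5 \<le> j" for j using that by (simp add: D_def)
    show "i = j" if ij: "i < 5" "j < 5" "D i \<subseteq> D j" for i j
    proof -
      have "ind (D i) \<preceq> ind (D j)" using E(3)[OF mem] ij by (simp add: ind_exp_le)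
      then have "ind (D i) = ind (D j)" using E(2) mem ij by (auto simp: antichain_def)
      then have "D i = D j" using E(3)[OF mem] ij by (simp add: ind_inject)
      then show ?thesis using h ij by (auto simp: D_def bij_betw_def inj_on_def)
    qed
  qed
  moreover have "J = gens_ideal D" unfolding gens_ideal_def DE E(4) ..
  ultimately show thesis by (rule that)
qed

lemma target_class_covered:
  fixes J :: "(nat, 'k::field) mpoly set"
  assumes J: "J \<in> target_class"
    and families: "tree_family A1 path r1 N1" "tree_family A2 fork r2 N2" "tree_family A3 star r3 N3"
  shows "\<exists>I\<in>{gens_ideal A1, gens_ideal A2, gens_ideal A3}. covers I J"
proof -
  obtain D where D: "five_sets D" "J = gens_ideal D" using J by (rule target_class_obtain)
  interpret D: five_sets D by fact
  have pd: "proj_dim (mpoly_ring (all_vars D)) (quotient_module (mpoly_ring (all_vars D))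
      (gens_ideal D \<inter> carrier (mpoly_ring (all_vars D)) :: (nat, 'k) mpoly set)) = 3"
    and ht: "height S_inf (gens_ideal D :: (nat, 'k) mpoly set) = 2"
    using J unfolding D(2) target_class_def by (simp_all add: D.ideal_vars_A)
  obtain p \<pi> where p: "p \<in> {path, fork, star}" "bij_betw \<pi> {..<5} {..<5}"
    "\<And>i x. i < 5 \<Longrightarrow> face D x \<noteq> {\<pi> (p i)} \<and> face D x \<noteq> {\<pi> i, \<pi> (p i)}"
    using D.covering_tree_exists[OF pd] by blast
  have proper: "face D x \<noteq> {..<5}" for x
  proof
    assume f: "face D x = {..<5}"
    then have all: "x \<in> D j" if "j < 5" for j using that by (auto simp: face_def)
    then have "x \<in> D 0" by simp
    then have x1: "1 \<le> x" using D.sets_pos[of 0] by (meson atLeast_iff subsetD)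
    have "\<exists>X\<in>D ` {..<5}. x \<notin> X"
    proof (rule height_eq_2D[OF _ x1 ht[unfolded gens_ideal_def]])
      show "finite X \<and> X \<subseteq> {1..}" if "X \<in> D ` {..<5}" for X
        using that D.finite_sets D.sets_pos by blast
    qed
    then show False using all by auto
  qed
  note c = tree_family.covers_if[OF _ D(1) p(2,3) proper, where ?'k = 'k]
  show ?thesis
    using p(1) c[of A1 r1 N1] c[of A2 r2 N2] c[of A3 r3 N3] families unfolding D(2) by auto
qed

lemma minimal_generic_families:
  fixes A1 A2 A3 :: "nat \<Rightarrow> nat set"
  assumes families: "tree_family A1 path r1 N1" "tree_family A2 fork r2 N2" "tree_family A3 star r3 N3"
  shows "minimal_generic_set (target_class :: (nat, 'k::field) mpoly set set)
    {gens_ideal A1, gens_ideal A2, gens_ideal A3}"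
proof -
  let ?X = "{gens_ideal A1, gens_ideal A2, gens_ideal A3} :: (nat, 'k) mpoly set set"
  have trees: "path \<noteq> fork" "path \<noteq> star" "fork \<noteq> star"
    using tree_data(1-3) by auto
  have gen: "generic_set target_class ?X"
    unfolding generic_set_iff
  proof (intro conjI ballI)
    show "?X \<subseteq> target_class" using families[THEN tree_family.in_target_class, where ?'k = 'k] by simp
    show "\<exists>I\<in>?X. covers I J" if "J \<in> target_class" for J
      by (rule target_class_covered[OF that families])
  qed
  have no: "\<not> covers (gens_ideal A :: (nat, 'k) mpoly set) (gens_ideal D)"
    if fam: "tree_family A p r N" "tree_family D q s N'" "p \<in> {path, fork, star}" "q \<in> {path, fork, star}" "p \<noteq> q"
    for A D p q r s N N'
  proof
    assume "covers (gens_ideal A :: (nat, 'k) mpoly set) (gens_ideal D)"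
    from tree_family_covers[OF fam(1,2) this]
    obtain \<pi> where \<pi>: "bij_betw \<pi> {..<5} {..<5}" "\<forall>t\<in>excluded p. \<pi> ` t \<in> excluded q" by blast
    have "p = q" by (rule excluded_map_unique[OF fam(3,4) \<pi>(1) bspec[OF \<pi>(2)]])
    then show False using fam(5) by simp
  qed
  have "B = ?X" if B: "generic_set target_class B" "B \<subseteq> ?X" for B
  proof -
    have ex: "\<exists>I\<in>B. covers I J" if "J \<in> ?X" for J
    proof -
      have "J \<in> target_class" using gen that unfolding generic_set_iff by (meson subsetD)
      then show ?thesis using conjunct2[OF B(1)[unfolded generic_set_iff]] by (rule bspec[rotated])
    qed
    have "gens_ideal A1 \<in> B"
      using ex[of "gens_ideal A1"] B(2) no[OF families(2,1)] no[OF families(3,1)] trees by auto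
    moreover have "gens_ideal A2 \<in> B"
      using ex[of "gens_ideal A2"] B(2) no[OF families(1,2)] no[OF families(3,2)] trees by auto
    moreover have "gens_ideal A3 \<in> B"
      using ex[of "gens_ideal A3"] B(2) no[OF families(1,3)] no[OF families(2,3)] trees by auto
    ultimately show ?thesis using B(2) by blast
  qed
  then show ?thesis unfolding minimal_generic_set_def using gen by blast
qed

definition family :: "nat list list \<Rightarrow> nat \<Rightarrow> nat set"
  where "family l j = (if j < 5 then set (l ! j) else {})"

definition incidence :: "nat list list \<Rightarrow> nat \<Rightarrow> bool list"
  where "incidence l x = map (\<lambda>d. x \<in> set d) l"

definition excluded_list :: "(nat \<Rightarrow> nat) \<Rightarrow> bool list list"
  where "excluded_list p = concat (map (\<lambda>i. [map (\<lambda>j. j = p i) [0..<5], map (\<lambda>j. j = i \<or> j = p i) [0..<5]]) [0..<5])"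

lemma tree_family_of_lists:
  assumes len: "length l = 5" and range: "\<forall>d\<in>set l. \<forall>x\<in>set d. 1 \<le> x \<and> x \<le> N"
    and dist: "distinct (map (incidence l) [1..<Suc N])"
    and faces: "\<forall>b\<in>set (List.n_lists 5 [True, False]).
      b \<in> set (map (incidence l) [1..<Suc N]) \<longleftrightarrow>
      b \<noteq> replicate 5 False \<and> b \<noteq> replicate 5 True \<and> b \<notin> set (excluded_list p)"
    and p: "\<forall>i<5. p i < 5 \<and> p (p i) = r \<and> (i \<noteq> r \<longrightarrow> p i \<noteq> i)" "r < 5" "p r = r" "p 0 \<noteq> 0" "p 0 \<noteq> 1" "p 1 \<noteq> 0" "p 1 \<noteq> 1"
  shows "tree_family (family l) p r N"
proof
  define vec where "vec s = map (\<lambda>j. j \<in> s) [0..<5]" for s :: "nat set"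
  have vec_eq: "vec s = vec t \<longleftrightarrow> s = t" if "s \<subseteq> {..<5}" "t \<subseteq> {..<5}" for s t
  proof
    assume "vec s = vec t"
    then have "j \<in> s \<longleftrightarrow> j \<in> t" if "j < 5" for j using that by (auto simp: vec_def)
    then show "s = t" using that by blast
  qed simp
  have inc: "vec (face (family l) x) = incidence l x" for x
    by (rule nth_equalityI) (auto simp: vec_def incidence_def len face_def family_def)
  have sub: "face (family l) x \<subseteq> {..<5}" for x by (auto simp: face_def)
  have set_x: "set [1..<Suc N] = {1..N}" by auto
  show "family l j \<subseteq> {1..N}" for j
  proof (cases "j < 5")
    case True
    then have "l ! j \<in> set l" using len by simp
    then show ?thesis using range True by (fastforce simp: family_def)
  qed (simp add: family_def)
  show "family l j = {}" if "5 \<le> j" for j using that by (simp add: family_def)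
  show "inj_on (face (family l)) {1..N}"
  proof (rule inj_onI)
    fix x y assume xy: "x \<in> {1..N}" "y \<in> {1..N}" "face (family l) x = face (family l) y"
    then have "incidence l x = incidence l y" by (metis inc)
    moreover have "inj_on (incidence l) {1..N}" using dist unfolding distinct_map set_x by simp
    ultimately show "x = y" using xy(1,2) by (auto dest: inj_onD)
  qed
  have excl: "s \<in> excluded p \<longleftrightarrow> vec s \<in> set (excluded_list p)" if s: "s \<subseteq> {..<5}" for s
  proof -
    have eq: "s = {p i} \<or> s = {i, p i} \<longleftrightarrow> vec s = vec {p i} \<or> vec s = vec {i, p i}" if "i < 5" for i
      using vec_eq[OF s, of "{p i}"] vec_eq[OF s, of "{i, p i}"] p(1) that by simp
    have "s \<in> excluded p \<longleftrightarrow> (\<exists>i<5. s = {p i} \<or> s = {i, p i})"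
      by (auto simp: excluded_def)
    also have "\<dots> \<longleftrightarrow> (\<exists>i<5. vec s = vec {p i} \<or> vec s = vec {i, p i})"
      by (intro ex_cong1 conj_cong eq refl)
    also have "\<dots> \<longleftrightarrow> vec s \<in> set (excluded_list p)"
    proof -
      have "excluded_list p = concat (map (\<lambda>i. [vec {p i}, vec {i, p i}]) [0..<5])"
        by (simp only: excluded_list_def vec_def insert_iff empty_iff simp_thms)
      moreover have "set [0..<5] = {..<5 :: nat}" by auto
      ultimately show ?thesis by (simp only: set_concat set_map) auto
    qed
    finally show ?thesis .
  qed
  show "face (family l) ` {1..N} = {s. s \<subseteq> {..<5} \<and> s \<noteq> {} \<and> s \<noteq> {..<5} \<and> s \<notin> excluded p}"
  proof -
    have "s \<in> face (family l) ` {1..N} \<longleftrightarrow> s \<noteq> {} \<and> s \<noteq> {..<5} \<and> s \<notin> excluded p" if s: "s \<subseteq> {..<5}" for s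
    proof -
      have "s \<in> face (family l) ` {1..N} \<longleftrightarrow> vec s \<in> set (map (incidence l) [1..<Suc N])"
        using vec_eq[OF s sub] unfolding set_map set_x image_iff inc[symmetric] by blast
      moreover have "vec s \<in> set (List.n_lists 5 [True, False])"
        by (auto simp: set_n_lists vec_def)
      then have "vec s \<in> set (map (incidence l) [1..<Suc N]) \<longleftrightarrow>
          vec s \<noteq> replicate 5 False \<and> vec s \<noteq> replicate 5 True \<and> vec s \<notin> set (excluded_list p)"
        using faces by (rule bspec[rotated])
      moreover have "replicate 5 False = vec {}" "replicate 5 True = vec {..<5}"
        by (simp_all add: vec_def numeral_eq_Suc)
      ultimately show ?thesis
        using excl[OF s] vec_eq[OF s, of "{}"] vec_eq[OF s, of "{..<5}"] by simp
    qed
    then show ?thesis using sub by blast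
  qed
  show "{0, 1} \<notin> excluded p"
    using p(4-) by (auto simp: excluded_def doubleton_eq_iff)
qed (use p in auto)

definition list1 :: "nat list list"
  where "list1 = [[1, 3, 7, 8, 9, 10, 12, 14, 15, 18, 19, 20, 21, 22],
    [2, 4, 5, 8, 9, 11, 13, 14, 17, 18, 19, 20, 21, 23],
    [3, 5, 9, 11, 12, 15, 16, 17, 19, 20, 22, 23],
    [4, 6, 10, 11, 12, 13, 16, 18, 19, 21, 22, 23],
    [6, 7, 10, 13, 14, 15, 16, 17, 20, 21, 22, 23]]"

definition list2 :: "nat list list"
  where "list2 = [[1, 4, 7, 9, 10, 12, 15, 16, 18, 19, 20, 22, 23, 24],
    [2, 5, 8, 9, 11, 14, 15, 17, 18, 19, 21, 22, 23, 24],
    [3, 6, 7, 8, 11, 12, 13, 16, 17, 19, 20, 21, 23, 24],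
    [4, 5, 10, 11, 12, 13, 14, 15, 20, 21, 22, 23],
    [6, 10, 13, 14, 16, 17, 18, 20, 21, 22, 24]]"

definition list3 :: "nat list list"
  where "list3 = [[1, 5, 6, 7, 11, 12, 15, 18, 19, 20, 21, 22, 23, 24],
    [2, 5, 8, 9, 11, 13, 15, 16, 17, 18, 21, 22, 24, 25],
    [3, 6, 8, 10, 12, 14, 15, 16, 17, 20, 21, 23, 24, 25],
    [4, 7, 9, 10, 13, 14, 17, 18, 19, 20, 22, 23, 24, 25],
    [11, 12, 13, 14, 16, 19, 21, 22, 23, 25]]"

lemma family1: "tree_family (family list1) path 2 23"
proof (rule tree_family_of_lists)
  show "distinct (map (incidence list1) [1..<Suc 23])" by code_simp
  show "\<forall>b\<in>set (List.n_lists 5 [True, False]).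
      b \<in> set (map (incidence list1) [1..<Suc 23]) \<longleftrightarrow>
      b \<noteq> replicate 5 False \<and> b \<noteq> replicate 5 True \<and> b \<notin> set (excluded_list path)" by code_simp
qed (auto simp: list1_def path_def less_5)

lemma family2: "tree_family (family list2) fork 4 24"
proof (rule tree_family_of_lists)
  show "distinct (map (incidence list2) [1..<Suc 24])" by code_simp
  show "\<forall>b\<in>set (List.n_lists 5 [True, False]).
      b \<in> set (map (incidence list2) [1..<Suc 24]) \<longleftrightarrow>
      b \<noteq> replicate 5 False \<and> b \<noteq> replicate 5 True \<and> b \<notin> set (excluded_list fork)" by code_simp
qed (auto simp: list2_def fork_def less_5)

lemma family3: "tree_family (family list3) star 4 25"
proof (rule tree_family_of_lists)
  show "distinct (map (incidence list3) [1..<Suc 25])" by code_simp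
  show "\<forall>b\<in>set (List.n_lists 5 [True, False]).
      b \<in> set (map (incidence list3) [1..<Suc 25]) \<longleftrightarrow>
      b \<noteq> replicate 5 False \<and> b \<noteq> replicate 5 True \<and> b \<notin> set (excluded_list star)" by code_simp
qed (auto simp: list3_def star_def less_5)

section \<open>Renaming variables\<close>

definition ren :: "('v \<Rightarrow> 'w) \<Rightarrow> ('v \<Rightarrow>\<^sub>0 nat) \<Rightarrow> ('w \<Rightarrow>\<^sub>0 nat)"
  where "ren g e = (\<Sum>v\<in>keys e. single (g v) (lookup e v))"

definition Ren :: "('v \<Rightarrow> 'w) \<Rightarrow> ('v, 'k::field) mpoly \<Rightarrow> ('w, 'k) mpoly"
  where "Ren g p = (\<Sum>e\<in>keys p. single (ren g e) (lookup p e))"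

lemma ren_superset: "finite S \<Longrightarrow> keys e \<subseteq> S \<Longrightarrow> ren g e = (\<Sum>v\<in>S. single (g v) (lookup e v))"
  unfolding ren_def by (intro sum.mono_neutral_left) (auto simp: in_keys_iff)

lemma ren_zero [simp]: "ren g 0 = 0"
  by (simp add: ren_def)

lemma ren_single: "ren g (single v k) = single (g v) k"
  by (simp add: ren_def)

lemma ren_add: "ren g (e + d) = ren g e + ren g d"
proof -
  have "finite (keys e \<union> keys d)" "keys (e + d) \<subseteq> keys e \<union> keys d"
    by (simp_all add: exp_keys_add)
  from ren_superset[OF this, of g]
  have "ren g (e + d) = (\<Sum>v\<in>keys e \<union> keys d. single (g v) (lookup e v + lookup d v))"
    by (simp only: lookup_add)
  also have "\<dots> = ren g e + ren g d"
    by (simp add: single_add sum.distrib ren_superset[of "keys e \<union> keys d"])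
  finally show ?thesis .
qed

lemma ren_sum: "ren g (sum f X) = (\<Sum>x\<in>X. ren g (f x))"
  by (induction X rule: infinite_finite_induct) (simp_all add: ren_add)

lemma ren_inverse:
  assumes "\<And>v. v \<in> keys e \<Longrightarrow> f (g v) = v"
  shows "ren f (ren g e) = e"
proof -
  have "ren f (ren g e) = (\<Sum>v\<in>keys e. single (f (g v)) (lookup e v))"
    unfolding ren_def[of g] by (simp add: ren_sum ren_single)
  also have "\<dots> = (\<Sum>v\<in>keys e. single v (lookup e v))"
    using assms by (intro sum.cong) auto
  also have "\<dots> = e"
    by (auto simp: lookup_sum lookup_single when_def in_keys_iff intro!: poly_mapping_eqI)
  finally show ?thesis .
qed

lemma ren_ind: "finite D \<Longrightarrow> inj_on g D \<Longrightarrow> ren g (ind D) = ind (g ` D)"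
  unfolding ind_def by (simp add: ren_sum ren_single sum.reindex)

lemma ren_exp_le: "e \<preceq> d \<Longrightarrow> ren g e \<preceq> ren g d"
  unfolding exp_le_iff using ren_add by metis

lemma keys_ren: "keys (ren g e) \<subseteq> g ` keys e"
proof
  fix w assume "w \<in> keys (ren g e)"
  then have "w \<in> (\<Union>v\<in>keys e. keys (single (g v) (lookup e v)))"
    using keys_sum unfolding ren_def by (rule subsetD[rotated])
  then show "w \<in> g ` keys e" by (auto split: if_splits)
qed

lemma Ren_superset:
  "finite S \<Longrightarrow> keys p \<subseteq> S \<Longrightarrow> Ren g p = (\<Sum>e\<in>S. single (ren g e) (lookup p e))"
  unfolding Ren_def by (intro sum.mono_neutral_left) (auto simp: in_keys_iff)

lemma Ren_zero [simp]: "Ren g 0 = 0"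
  by (simp add: Ren_def)

lemma Ren_single: "Ren g (single e c) = single (ren g e) c"
  by (simp add: Ren_def)

lemma Ren_add: "Ren g (p + q) = Ren g p + Ren g q"
proof -
  have "finite (keys p \<union> keys q)" "keys (p + q) \<subseteq> keys p \<union> keys q"
    by (simp_all add: keys_add)
  from Ren_superset[OF this, of g]
  have "Ren g (p + q) = (\<Sum>e\<in>keys p \<union> keys q. single (ren g e) (lookup p e + lookup q e))"
    by (simp only: lookup_add)
  also have "\<dots> = Ren g p + Ren g q"
    by (simp add: single_add sum.distrib Ren_superset[of "keys p \<union> keys q"])
  finally show ?thesis .
qed

lemma Ren_sum: "Ren g (sum f X) = (\<Sum>x\<in>X. Ren g (f x))"
  by (induction X rule: infinite_finite_induct) (simp_all add: Ren_add)

lemma Ren_mult: "Ren g (p * q) = Ren g p * Ren g q"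
proof -
  have "p * q = (\<Sum>e\<in>keys p. single e (lookup p e)) * (\<Sum>d\<in>keys q. single d (lookup q d))"
    by (simp only: mpoly_expand[symmetric])
  also have "\<dots> = (\<Sum>e\<in>keys p. \<Sum>d\<in>keys q. single (e + d) (lookup p e * lookup q d))"
    by (simp add: sum_product mult_single)
  finally have "Ren g (p * q) = (\<Sum>e\<in>keys p. \<Sum>d\<in>keys q. single (ren g e + ren g d) (lookup p e * lookup q d))"
    by (simp only: Ren_sum Ren_single ren_add)
  also have "\<dots> = Ren g p * Ren g q"
    by (simp add: Ren_def sum_product mult_single)
  finally show ?thesis .
qed

lemma Ren_one: "Ren g 1 = 1"
  using Ren_single[of g 0 1] by simp

lemma Ren_inverse:
  assumes "\<And>v. v \<in> mpoly_vars p \<Longrightarrow> f (g v) = v"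
  shows "Ren f (Ren g p) = p"
proof -
  have "Ren f (Ren g p) = (\<Sum>e\<in>keys p. single (ren f (ren g e)) (lookup p e))"
    unfolding Ren_def[of g] by (simp add: Ren_sum Ren_single)
  also have "\<dots> = (\<Sum>e\<in>keys p. single e (lookup p e))"
    using assms by (intro sum.cong refl) (subst ren_inverse; auto simp: mpoly_vars_def)
  also have "\<dots> = p" by (simp only: mpoly_expand[symmetric])
  finally show ?thesis .
qed

lemma keys_Ren: "keys (Ren g p) \<subseteq> ren g ` keys p"
proof
  fix w assume "w \<in> keys (Ren g p)"
  then have "w \<in> (\<Union>e\<in>keys p. keys (single (ren g e) (lookup p e)))"
    using keys_sum unfolding Ren_def by (rule subsetD[rotated])
  then show "w \<in> ren g ` keys p" by (auto split: if_splits)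
qed

lemma mpoly_vars_Ren: "mpoly_vars (Ren g p) \<subseteq> g ` mpoly_vars p"
proof -
  have "keys u \<subseteq> g ` mpoly_vars p" if u: "u \<in> keys (Ren g p)" for u
  proof -
    obtain e where "e \<in> keys p" "u = ren g e" using u keys_Ren[of g p] by blast
    moreover from this have "g ` keys e \<subseteq> g ` mpoly_vars p" by (intro image_mono) (auto simp: mpoly_vars_def)
    ultimately show ?thesis using keys_ren[of g e] by blast
  qed
  then show ?thesis by (simp add: mpoly_vars_subset_iff)
qed

lemma Ren_mon_ideal:
  assumes "p \<in> mon_ideal V E" "g ` V \<subseteq> W" "ren g ` E \<subseteq> E'"
  shows "Ren g p \<in> mon_ideal W E'"
proof -
  have "mpoly_vars (Ren g p) \<subseteq> W"
    using mpoly_vars_Ren[of g p] assms(1,2) by (auto simp: mon_ideal_def)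
  moreover have "\<exists>a\<in>E'. a \<preceq> u" if u: "u \<in> keys (Ren g p)" for u
  proof -
    obtain e where e: "e \<in> keys p" "u = ren g e" using u keys_Ren[of g p] by blast
    then obtain a where "a \<in> E" "a \<preceq> e" using assms(1) by (auto simp: mon_ideal_def)
    then show ?thesis using e assms(3) ren_exp_le by blast
  qed
  ultimately show ?thesis by (simp add: mon_ideal_def)
qed

lemma quot_alg_iso_rename:
  fixes F :: "'v \<Rightarrow> 'w" and V :: "'v set"
  assumes F: "inj_on F V" and D: "\<And>j. j \<in> X \<Longrightarrow> finite (D j) \<and> D j \<subseteq> V"
  shows "quot_alg_iso (F ` V) (mon_ideal (F ` V) ((\<lambda>j. ind (F ` D j)) ` X))
    V (mon_ideal V ((\<lambda>j. ind (D j)) ` X) :: ('v, 'k::field) mpoly set)"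
proof -
  define H where "H = F ` V"
  define G where "G = inv_into V F"
  let ?R = "mpoly_ring H :: ('w, 'k) mpoly ring" and ?S = "mpoly_ring V :: ('v, 'k) mpoly ring"
  define I where "I = (mon_ideal H ((\<lambda>j. ind (F ` D j)) ` X) :: ('w, 'k) mpoly set)"
  define J where "J = (mon_ideal V ((\<lambda>j. ind (D j)) ` X) :: ('v, 'k) mpoly set)"
  have GF: "G (F v) = v" if "v \<in> V" for v using that F by (simp add: G_def)
  have FG: "F (G w) = w" if "w \<in> H" for w using that F by (auto simp: H_def G_def)
  have GH: "G ` H \<subseteq> V" and FV: "F ` V \<subseteq> H" using GF by (auto simp: H_def)
  interpret R: cring ?R by (rule cring_mpoly_ring)
  interpret S: cring ?S by (rule cring_mpoly_ring)
  interpret J: ideal J ?S unfolding J_def by (rule ideal_mon_ideal)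
  have renG: "ren G ` (\<lambda>j. ind (F ` D j)) ` X \<subseteq> (\<lambda>j. ind (D j)) ` X"
  proof -
    have "ren G (ind (F ` D j)) = ind (D j)" if "j \<in> X" for j
    proof -
      have FD: "inj_on F (D j)" using F D[OF that] inj_on_subset by blast
      have "ren G (ren F (ind (D j))) = ind (D j)"
        using D[OF that] GF by (intro ren_inverse) auto
      then show ?thesis using ren_ind[OF _ FD] D[OF that] by simp
    qed
    then show ?thesis by auto
  qed
  have renF: "ren F ` (\<lambda>j. ind (D j)) ` X \<subseteq> (\<lambda>j. ind (F ` D j)) ` X"
  proof -
    have "ren F (ind (D j)) = ind (F ` D j)" if "j \<in> X" for j
      using D[OF that] F inj_on_subset by (intro ren_ind) blast+
    then show ?thesis by auto
  qed
  have closed: "mpoly_vars (Ren G p) \<subseteq> V" if "mpoly_vars p \<subseteq> H" for p :: "('w, 'k) mpoly"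
    using mpoly_vars_Ren[of G p] GH that by blast
  have closed': "mpoly_vars (Ren F p) \<subseteq> H" if "mpoly_vars p \<subseteq> V" for p :: "('v, 'k) mpoly"
    using mpoly_vars_Ren[of F p] FV that by blast
  have RenFG: "Ren F (Ren G p) = p" if "mpoly_vars p \<subseteq> H" for p :: "('w, 'k) mpoly"
    using that FG by (intro Ren_inverse) auto
  have RenGF: "Ren G (Ren F p) = p" if "mpoly_vars p \<subseteq> V" for p :: "('v, 'k) mpoly"
    using that GF by (intro Ren_inverse) auto
  have mem: "Ren G p \<in> J \<longleftrightarrow> p \<in> I" if p: "mpoly_vars p \<subseteq> H" for p :: "('w, 'k) mpoly"
  proof
    assume "Ren G p \<in> J"
    then have "Ren F (Ren G p) \<in> I"
      unfolding I_def J_def using FV renF by (rule Ren_mon_ideal)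
    then show "p \<in> I" using RenFG[OF p] by simp
  next
    assume "p \<in> I"
    then show "Ren G p \<in> J"
      unfolding I_def J_def using GH renG by (rule Ren_mon_ideal)
  qed
  define h where "h p = J +>\<^bsub>?S\<^esub> Ren G p" for p
  note hom = J.rcos_ring_hom
  have h_hom: "h \<in> ring_hom ?R (?S Quot J)"
  proof (rule ring_hom_memI)
    fix p q :: "('w, 'k) mpoly"
    assume p: "p \<in> carrier ?R"
    then have p': "Ren G p \<in> carrier ?S" using closed by (simp add: carrier_mpoly_ring)
    show "h p \<in> carrier (?S Quot J)" unfolding h_def by (rule ring_hom_closed[OF hom p'])
    assume "q \<in> carrier ?R"
    then have q': "Ren G q \<in> carrier ?S" using closed by (simp add: carrier_mpoly_ring)
    show "h (p \<otimes>\<^bsub>?R\<^esub> q) = h p \<otimes>\<^bsub>?S Quot J\<^esub> h q"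
      using ring_hom_mult[OF hom p' q'] by (simp add: h_def Ren_mult)
    show "h (p \<oplus>\<^bsub>?R\<^esub> q) = h p \<oplus>\<^bsub>?S Quot J\<^esub> h q"
      using ring_hom_add[OF hom p' q'] by (simp add: h_def Ren_add)
  next
    show "h \<one>\<^bsub>?R\<^esub> = \<one>\<^bsub>?S Quot J\<^esub>"
      using ring_hom_one[OF hom] by (simp add: h_def Ren_one)
  qed
  interpret h: ring_hom_ring ?R "?S Quot J" h
    by (rule ring_hom_ringI2[OF R.ring_axioms J.quotient_is_ring h_hom])
  have zero: "\<zero>\<^bsub>?S Quot J\<^esub> = J" by (simp add: FactRing_def)
  have coset: "J +>\<^bsub>?S\<^esub> q = J \<longleftrightarrow> q \<in> J" if "mpoly_vars q \<subseteq> V" for q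
    using quotient_module_mpoly_simps(3)[OF J.ideal_axioms that] .
  have kernel: "a_kernel ?R (?S Quot J) h = I"
  proof -
    have "mpoly_vars p \<subseteq> H" if "p \<in> I" for p using that by (simp add: I_def mon_ideal_def)
    moreover have "h p = J \<longleftrightarrow> p \<in> I" if "mpoly_vars p \<subseteq> H" for p
      unfolding h_def coset[OF closed[OF that]] by (rule mem[OF that])
    ultimately show ?thesis
      unfolding a_kernel_def' zero carrier_mpoly_ring by blast
  qed
  have surj: "h ` carrier ?R = carrier (?S Quot J)"
  proof
    show "h ` carrier ?R \<subseteq> carrier (?S Quot J)" using ring_hom_closed[OF h_hom] by blast
    show "carrier (?S Quot J) \<subseteq> h ` carrier ?R"
    proof
      fix x assume "x \<in> carrier (?S Quot J)"
      then obtain q where q: "mpoly_vars q \<subseteq> V" "x = J +>\<^bsub>?S\<^esub> q"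
        using quotient_module_mpoly_simps(1)[OF J.ideal_axioms] by (auto simp: quotient_module_def)
      have "h (Ren F q) = x" using RenGF[OF q(1)] q(2) by (simp add: h_def)
      moreover have "Ren F q \<in> carrier ?R" using closed'[OF q(1)] by (simp add: carrier_mpoly_ring)
      ultimately show "x \<in> h ` carrier ?R" by blast
    qed
  qed
  have iso: "(\<lambda>X. the_elem (h ` X)) \<in> ring_iso (?R Quot I) (?S Quot J)"
    using h.FactRing_iso_set[OF surj] unfolding kernel .
  have const: "the_elem (h ` (I +>\<^bsub>?R\<^esub> Const c)) = J +>\<^bsub>?S\<^esub> Const c" for c
  proof -
    have "mpoly_vars (Const c :: ('w, 'k) mpoly) \<subseteq> H"
      unfolding Const_def using mpoly_vars_single[of "0 :: 'w \<Rightarrow>\<^sub>0 nat" c] by simp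
    then have "Const c \<in> carrier ?R" by (simp add: carrier_mpoly_ring)
    then have "the_elem (h ` (I +>\<^bsub>?R\<^esub> Const c)) = h (Const c)"
      using h.the_elem_simp unfolding kernel by blast
    then show ?thesis by (simp add: h_def Const_def Ren_single)
  qed
  have "quot_alg_iso H I V J"
    unfolding quot_alg_iso_def using const by (intro bexI[OF _ iso]) simp
  then show ?thesis unfolding I_def J_def H_def .
qed

section \<open>Reducedness\<close>

lemma (in tree_family) hypergraph_iso:
  fixes m :: "nat \<Rightarrow> (nat, 'k::field) mpoly"
  assumes m: "gens_numbering (gens_ideal A) m"
  shows "quot_alg_iso (hypergraph (gens_ideal A) m)
    (hypergraph_ideal (num_gens (gens_ideal A :: (nat, 'k) mpoly set)) (hypergraph (gens_ideal A) m))
    (ideal_vars (gens_ideal A :: (nat, 'k) mpoly set))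
    (gens_ideal A \<inter> carrier (mpoly_ring (ideal_vars (gens_ideal A :: (nat, 'k) mpoly set))) :: (nat, 'k) mpoly set)"
proof -
  let ?J = "gens_ideal A :: (nat, 'k) mpoly set"
  have bij: "bij_betw gen {..<5} (min_gens ?J)" by (rule bij_gen)
  have m': "bij_betw m {1..5} (min_gens ?J)"
    using m by (simp add: gens_numbering_def num_gens_A)
  define \<sigma> where "\<sigma> = (\<lambda>j. the_inv_into {..<5} gen (m j))"
  have \<sigma>: "bij_betw \<sigma> {1..5} {..<5}"
    using bij_betw_trans[OF m' bij_betw_the_inv_into[OF bij]] by (simp add: \<sigma>_def comp_def)
  have m_gen: "m j = gen (\<sigma> j)" if "j \<in> {1..5}" for j
  proof -
    have "m j \<in> gen ` {..<5}" using bij_betw_apply[OF m' that] bij by (simp add: bij_betw_def)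
    then show ?thesis
      unfolding \<sigma>_def using bij_betw_imp_inj_on[OF bij] by (simp add: f_the_inv_into_f)
  qed
  define F where "F x = {j \<in> {1..5}. x \<in> A (\<sigma> j)}" for x
  define H where "H = F ` all_vars A"
  have hyp: "hypergraph ?J m = H"
  proof -
    have "{j \<in> {1..num_gens ?J}. Var x dvd m j} = F x" for x
      using m_gen Var_dvd_monom_ind[OF finite_sets, where ?'k = 'k] by (auto simp: F_def num_gens_A gen_def)
    then show ?thesis unfolding hypergraph_def ideal_vars_A H_def by auto
  qed
  have F: "inj_on F (all_vars A)"
    unfolding all_vars_eq
  proof (rule inj_onI)
    fix x y assume xy: "x \<in> {1..N}" "y \<in> {1..N}" "F x = F y"
    have "x \<in> A i \<longleftrightarrow> y \<in> A i" if "i < 5" for i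
    proof -
      have "i \<in> \<sigma> ` {1..5}" using \<sigma> that by (simp add: bij_betw_def)
      then obtain j where "j \<in> {1..5}" "i = \<sigma> j" by blast
      then show ?thesis using xy(3) by (auto simp: F_def)
    qed
    then have "face A x = face A y" by (auto simp: face_def)
    then show "x = y" using inj_face xy(1,2) by (metis inj_onD)
  qed
  have prod: "(\<Prod>f\<in>{f \<in> H. j \<in> f}. Var f) = (monom (ind (F ` A (\<sigma> j))) :: (nat set, 'k) mpoly)"
    if j: "j \<in> {1..5}" for j
  proof -
    have "{f \<in> H. j \<in> f} = F ` A (\<sigma> j)"
      using j ideal_vars_sub[of "\<sigma> j"] by (auto simp: H_def F_def)
    then show ?thesis using finite_sets by (simp add: sqf_eq_monom)
  qed
  have "hypergraph_ideal (num_gens ?J) (hypergraph ?J m) =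
      (Idl\<^bsub>mpoly_ring H\<^esub> (monom ` (\<lambda>j. ind (F ` A (\<sigma> j))) ` {1..5}) :: (nat set, 'k) mpoly set)"
    unfolding hypergraph_ideal_def hyp num_gens_A image_image
    by (intro arg_cong[where f = "genideal (mpoly_ring H)"] image_cong refl prod)
  also have "\<dots> = mon_ideal H ((\<lambda>j. ind (F ` A (\<sigma> j))) ` {1..5})"
  proof (rule genideal_monom)
    fix e assume "e \<in> (\<lambda>j. ind (F ` A (\<sigma> j))) ` {1..5}"
    then obtain j where "e = ind (F ` A (\<sigma> j))" by blast
    then have "keys e = F ` A (\<sigma> j)" using finite_sets by simp
    then show "keys e \<subseteq> H" using ideal_vars_sub[of "\<sigma> j"] by (auto simp: H_def)
  qed
  finally have left: "hypergraph_ideal (num_gens ?J) (hypergraph ?J m) =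
      (mon_ideal H ((\<lambda>j. ind (F ` A (\<sigma> j))) ` {1..5}) :: (nat set, 'k) mpoly set)" .
  have "{..<5} = \<sigma> ` {1..5}" using \<sigma> by (simp add: bij_betw_def)
  then have "ind ` A ` {..<5} = (\<lambda>j. ind (A (\<sigma> j))) ` {1..5}" by (simp only: image_image)
  then have right: "?J \<inter> carrier (mpoly_ring (all_vars A)) = mon_ideal (all_vars A) ((\<lambda>j. ind (A (\<sigma> j))) ` {1..5})"
    unfolding restricted_ideal by simp
  have "quot_alg_iso (F ` all_vars A) (mon_ideal (F ` all_vars A) ((\<lambda>j. ind (F ` A (\<sigma> j))) ` {1..5}))
      (all_vars A) (mon_ideal (all_vars A) ((\<lambda>j. ind (A (\<sigma> j))) ` {1..5}) :: (nat, 'k) mpoly set)"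
    using F finite_sets ideal_vars_sub by (intro quot_alg_iso_rename) auto
  then show ?thesis
    unfolding left ideal_vars_A right unfolding hyp H_def .
qed

lemma gens_ideal_family:
  assumes "length l = 5" "\<forall>d\<in>set l. \<forall>x\<in>set d. 1 \<le> x"
  shows "gens_ideal (family l) = (Idl\<^bsub>S_inf\<^esub> (sqf ` set ` set l) :: (nat, 'k::field) mpoly set)"
proof -
  have "family l ` {..<5} = set ` set l"
    using assms(1) by (auto simp: family_def set_conv_nth image_iff)
  moreover have "sqf ` set ` set l = (monom ` ind ` set ` set l :: (nat, 'k) mpoly set)"
    by (auto simp: sqf_def sqf_eq_monom image_iff)
  moreover have "Idl\<^bsub>S_inf\<^esub> (monom ` ind ` set ` set l) = (mon_ideal {1..} (ind ` set ` set l) :: (nat, 'k) mpoly set)"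
    by (rule genideal_S_inf_monom) (use assms(2) in auto)
  ultimately show ?thesis by (simp add: gens_ideal_def)
qed

theorem theorem6p5:
  fixes C :: "(nat, 'k::field) mpoly set set"
    and J1 J2 J3 :: "(nat, 'k) mpoly set"
  assumes "C = {I \<in> squarefree_monomial_ideals.
      num_gens I = 5 \<and>
      proj_dim (mpoly_ring (ideal_vars I))
        (quotient_module (mpoly_ring (ideal_vars I)) (I \<inter> carrier (mpoly_ring (ideal_vars I)))) = 3 \<and>
      height S_inf I = 2 \<and>
      connected_ideal I}"
    and "J1 = Idl\<^bsub>S_inf\<^esub>
      {sqf {1, 3, 7, 8, 9, 10, 12, 14, 15, 18, 19, 20, 21, 22},
       sqf {2, 4, 5, 8, 9, 11, 13, 14, 17, 18, 19, 20, 21, 23},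
       sqf {3, 5, 9, 11, 12, 15, 16, 17, 19, 20, 22, 23},
       sqf {4, 6, 10, 11, 12, 13, 16, 18, 19, 21, 22, 23},
       sqf {6, 7, 10, 13, 14, 15, 16, 17, 20, 21, 22, 23}}"
    and "J2 = Idl\<^bsub>S_inf\<^esub>
      {sqf {1, 4, 7, 9, 10, 12, 15, 16, 18, 19, 20, 22, 23, 24},
       sqf {2, 5, 8, 9, 11, 14, 15, 17, 18, 19, 21, 22, 23, 24},
       sqf {3, 6, 7, 8, 11, 12, 13, 16, 17, 19, 20, 21, 23, 24},
       sqf {4, 5, 10, 11, 12, 13, 14, 15, 20, 21, 22, 23},
       sqf {6, 10, 13, 14, 16, 17, 18, 20, 21, 22, 24}}"
    and "J3 = Idl\<^bsub>S_inf\<^esub>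
      {sqf {1, 5, 6, 7, 11, 12, 15, 18, 19, 20, 21, 22, 23, 24},
       sqf {2, 5, 8, 9, 11, 13, 15, 16, 17, 18, 21, 22, 24, 25},
       sqf {3, 6, 8, 10, 12, 14, 15, 16, 17, 20, 21, 23, 24, 25},
       sqf {4, 7, 9, 10, 13, 14, 17, 18, 19, 20, 22, 23, 24, 25},
       sqf {11, 12, 13, 14, 16, 19, 21, 22, 23, 25}}"
  shows "minimal_generic_set C {J1, J2, J3} \<and> reduced_generic_set C {J1, J2, J3} \<and>
    card (ideal_vars J1) = 23 \<and> card (ideal_vars J2) = 24 \<and> card (ideal_vars J3) = 25"
proof -
  have C: "C = target_class" using assms(1) by (simp only: target_class_def)
  have J1: "J1 = gens_ideal (family list1)"
    unfolding assms(2) by (subst gens_ideal_family) (simp_all add: list1_def)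
  have J2: "J2 = gens_ideal (family list2)"
    unfolding assms(3) by (subst gens_ideal_family) (simp_all add: list2_def)
  have J3: "J3 = gens_ideal (family list3)"
    unfolding assms(4) by (subst gens_ideal_family) (simp_all add: list3_def)
  interpret f1: tree_family "family list1" path 2 23 by (rule family1)
  interpret f2: tree_family "family list2" fork 4 24 by (rule family2)
  interpret f3: tree_family "family list3" star 4 25 by (rule family3)
  have minimal: "minimal_generic_set C {J1, J2, J3}"
    unfolding C J1 J2 J3 by (rule minimal_generic_families[OF family1 family2 family3])
  moreover have "reduced_generic_set C {J1, J2, J3}"
    unfolding reduced_generic_set_def
  proof (intro conjI ballI allI impI)
    show "generic_set C {J1, J2, J3}" using minimal by (simp add: minimal_generic_set_def)
    fix I m assume "I \<in> {J1, J2, J3}" "gens_numbering I m"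
    then show "quot_alg_iso (hypergraph I m) (hypergraph_ideal (num_gens I) (hypergraph I m))
         (ideal_vars I) (I \<inter> carrier (mpoly_ring (ideal_vars I)))"
      unfolding J1 J2 J3 using f1.hypergraph_iso f2.hypergraph_iso f3.hypergraph_iso by blast
  qed
  moreover have "card (ideal_vars J1) = 23" "card (ideal_vars J2) = 24" "card (ideal_vars J3) = 25"
    unfolding J1 J2 J3 f1.ideal_vars_A f2.ideal_vars_A f3.ideal_vars_A
      f1.all_vars_eq f2.all_vars_eq f3.all_vars_eq by simp_all
  ultimately show ?thesis by blast
qed

end
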